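(* Let $q$ be an odd prime power. Then: (1) if $q^2-q+1$ is prime, then $PSU_3(q)$ has a minimal logarithmic signature; (2) if $q > 5$ and $q+1 = 2p$ for some prime $p$, then $PSU_3(q)$ has a minimal logarithmic signature.
   Context: All groups are finite. For a finite group $G$, a logarithmic signature of $G$ is an ordered tuple $[A_1,\ldots,A_s]$ of subsets $A_i \subseteq G$ such that every element $g \in G$ can be written uniquely as a product $g = a_1a_2\cdots a_s$ with $a_i \in A_i$ for each $i$. Its length is $\sum_{i=1}^s |A_i|$. If $|G| = p_1^{\beta_1}\cdots p_k^{\beta_k}$ with $p_1,\ldots,p_k$ distinct primes and $\beta_j \ge 1$, every logarithmic signature has length at least $\sum_{j=1}^k \beta_j p_j$, and a logarithmic signature is called minimal (an MLS) if its length equals $\sum_{j=1}^k \beta_j p_j$. $PSU_3(q)$ is the projective special unitary group $SU_3(q)/Z(SU_3(q))$, where $SU_3(q)$ is the special unitary group of dimension $3$ over $GF(q^2)$. *)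

theory Defs
  imports "HOL-Analysis.Analysis" "HOL-Algebra.Coset" "HOL-Computational_Algebra.Primes"
begin

section \<open>Logarithmic signatures\<close>

text \<open>A logarithmic signature of a (finite) group G is a list [A_1,...,A_s] of subsets
  of the carrier such that every element g has exactly one factorisation
  g = a_1 ... a_s with a_i in A_i.\<close>

definition log_signature :: "('g, 'b) monoid_scheme \<Rightarrow> 'g set list \<Rightarrow> bool" where
  "log_signature G As \<longleftrightarrow>
     (\<forall>A\<in>set As. A \<subseteq> carrier G) \<and>
     (\<forall>g\<in>carrier G. \<exists>!xs. length xs = length As \<and> (\<forall>i<length As. xs ! i \<in> As ! i) \<and>
                          foldr (\<lambda>x y. x \<otimes>\<^bsub>G\<^esub> y) xs \<one>\<^bsub>G\<^esub> = g)"

definition ls_length :: "'g set list \<Rightarrow> nat" where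
  "ls_length As = sum_list (map card As)"

text \<open>Lower bound sum_j beta_j p_j where |G| = prod_j p_j^beta_j.\<close>
definition mls_bound :: "nat \<Rightarrow> nat" where
  "mls_bound n = (\<Sum>p\<in>prime_factors n. multiplicity p n * p)"

definition has_MLS :: "('g, 'b) monoid_scheme \<Rightarrow> bool" where
  "has_MLS G \<longleftrightarrow> (\<exists>As. log_signature G As \<and> ls_length As = mls_bound (order G))"

section \<open>The groups SU_3(q) and PSU_3(q)\<close>

text \<open>The field GF(q^2) is given as a finite field type 'a with CARD('a) = q^2;
  the field involution is x \<mapsto> x^q.\<close>

definition conjT :: "nat \<Rightarrow> 'a::field ^3^3 \<Rightarrow> 'a ^3^3" where
  "conjT q A = (\<chi> i j. (A $ j $ i) ^ q)"

definition SU3_set :: "nat \<Rightarrow> ('a::field ^3^3) set" where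
  "SU3_set q = {A. A ** conjT q A = mat 1 \<and> det A = 1}"

definition SU3 :: "nat \<Rightarrow> ('a::field ^3^3) monoid" where
  "SU3 q = \<lparr>carrier = SU3_set q, mult = (**), one = mat 1\<rparr>"

definition group_center :: "('g, 'b) monoid_scheme \<Rightarrow> 'g set" where
  "group_center G = {z \<in> carrier G. \<forall>g\<in>carrier G. z \<otimes>\<^bsub>G\<^esub> g = g \<otimes>\<^bsub>G\<^esub> z}"

definition PSU3 :: "nat \<Rightarrow> ('a::field ^3^3) set monoid" where
  "PSU3 q = SU3 q Mod group_center (SU3 q)"

end

theory Submission
  imports Defs "HOL-Algebra.Algebraic_Closure_Type"
begin

text \<open>
  Both hypotheses force \<open>3\<close> not to divide \<open>q + 1\<close>, so \<open>PSU\<^sub>3(q) = SU\<^sub>3(q)\<close>, and it suffices to write the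
  group as an exact product of subsets that are solvable subgroups, transversals of such, or have prime size.

  If \<open>r = q\<^sup>2 - q + 1\<close> is prime, take a set \<open>U\<close> of \<open>q\<^sup>2\<close> coset representatives of the centre of a Sylow subgroup for
  the defining prime. It tiles the \<open>q\<^sup>2 r\<close> non-isotropic points by translates of a set of \<open>r\<close> points, whence
  \<open>G = U X H\<close> with \<open>|X| = r\<close> and \<open>H\<close> the stabiliser of a non-isotropic point \<open>v\<close>; and \<open>H\<close> is a cyclic group, regular on
  the \<open>q + 1\<close> isotropic points orthogonal to \<open>v\<close>, times a solvable group.

  If \<open>q + 1 = 2 p\<close>, a cyclic subgroup \<open>C\<close> of order \<open>r\<close> has \<open>2 p\<close> regular orbits on the \<open>q\<^sup>3 + 1\<close> isotropic
  points. Pair these orbits arbitrarily. Since \<open>G\<close> is two-transitive, a second moment estimate shows that a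
  random element maps no point of the first orbit of a given pair into the second with probability at most
  \<open>1 / (q + 1)\<close>, so some \<open>a\<close> connects all \<open>p\<close> pairs. This gives \<open>G = C {1, a} X B\<close> with \<open>|X| = p\<close> and \<open>B\<close> the
  Borel subgroup.
\<close>

text \<open>For \<open>q > 2\<close> the group \<open>PSU_3(q)\<close> is simple, so no normal
  series leads down to prime factors, and coset spaces are split off instead. A set of prime size
  may serve as a factor whatever its structure; this is where the primality hypotheses enter. The
  index of \<open>H\<close> is \<open>q^2 r\<close>: an abelian quotient of a unipotent group
  supplies \<open>q^2\<close>, and what remains is a set of size \<open>r\<close>. The index of
  \<open>B\<close> is \<open>q^3 + 1 = 2 p r\<close>: the cyclic group \<open>C\<close> copes with
  \<open>r\<close> however it factors, and \<open>2 p\<close> is left to a pair and a set of size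
  \<open>p\<close>. Most of these pieces are not subgroups, so minimality is formulated for subsets,
  each measured against the bound for its own size. The bound turns products of sizes into sums,
  hence exact products of such subsets are again minimal. The probability \<open>1 / (q + 1)\<close>
  is \<open>1 / (2 p)\<close>, so a union bound over the \<open>p\<close> pairs leaves at least half
  of the group for the choice of \<open>a\<close>. That \<open>3\<close> does not divide
  \<open>q + 1\<close> also makes \<open>r\<close> coprime to \<open>q^2 - 1\<close>; therefore no
  nontrivial element of \<open>C\<close> fixes a projective point, and its orbits are
  regular.\<close>

hide_const (open) Divisibility.prime up_ring.coeff up_ring.monom Polynomials.degree
no_notation fps_nth (infixl "$" 75)

section \<open>Minimal factorisations of subsets\<close>

definition group_prod :: "('g, 'b) monoid_scheme \<Rightarrow> 'g list \<Rightarrow> 'g" where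
  "group_prod G xs = foldr (\<lambda>x y. x \<otimes>\<^bsub>G\<^esub> y) xs \<one>\<^bsub>G\<^esub>"

text \<open>Measuring against \<open>card S\<close> instead of the group order lets pieces of a
  group be treated separately. Bijectivity on \<open>listset As\<close> covers existence and
  uniqueness of factorisations at once.\<close>

definition min_factorisable :: "('g, 'b) monoid_scheme \<Rightarrow> 'g set \<Rightarrow> bool" where
  "min_factorisable G S \<longleftrightarrow>
     (\<exists>As. (\<forall>A\<in>set As. A \<subseteq> carrier G) \<and> bij_betw (group_prod G) (listset As) S
           \<and> ls_length As = mls_bound (card S))"

lemma listset_iff_list_all2: "xs \<in> listset As \<longleftrightarrow> list_all2 (\<in>) xs As"
  by (induction As arbitrary: xs) (auto simp: set_Cons_def list_all2_Cons2)

lemma has_MLS_if_min_factorisable: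
  assumes "min_factorisable G (carrier G)"
  shows "has_MLS G"
proof -
  obtain As where As: "\<forall>A\<in>set As. A \<subseteq> carrier G" "bij_betw (group_prod G) (listset As) (carrier G)"
    "ls_length As = mls_bound (card (carrier G))"
    using assms unfolding min_factorisable_def by blast
  have "\<exists>!xs. length xs = length As \<and> (\<forall>i<length As. xs ! i \<in> As ! i) \<and>
      foldr (\<lambda>x y. x \<otimes>\<^bsub>G\<^esub> y) xs \<one>\<^bsub>G\<^esub> = g" if "g \<in> carrier G" for g
  proof -
    have iff: "xs \<in> listset As \<longleftrightarrow> length xs = length As \<and> (\<forall>i<length As. xs ! i \<in> As ! i)" for xs
      by (auto simp: listset_iff_list_all2 list_all2_conv_all_nth)
    have "g \<in> group_prod G ` listset As" using bij_betw_imp_surj_on[OF As(2)] that by simp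
    then obtain xs where xs: "xs \<in> listset As" "group_prod G xs = g" by auto
    show ?thesis
    proof (rule ex1I[of _ xs])
      show "length xs = length As \<and> (\<forall>i<length As. xs ! i \<in> As ! i) \<and>
          foldr (\<lambda>x y. x \<otimes>\<^bsub>G\<^esub> y) xs \<one>\<^bsub>G\<^esub> = g"
        using xs iff unfolding group_prod_def by simp
      fix ys assume "length ys = length As \<and> (\<forall>i<length As. ys ! i \<in> As ! i) \<and>
          foldr (\<lambda>x y. x \<otimes>\<^bsub>G\<^esub> y) ys \<one>\<^bsub>G\<^esub> = g"
      then have "ys \<in> listset As" "group_prod G ys = group_prod G xs"
        using xs(2) iff[of ys] unfolding group_prod_def by simp_all
      then show "ys = xs" using inj_onD[OF bij_betw_imp_inj_on[OF As(2)]] xs(1) by blast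
    qed
  qed
  then show ?thesis
    using As(1,3) unfolding has_MLS_def log_signature_def Coset.order_def by blast
qed

lemma mls_bound_1: "mls_bound (Suc 0) = 0"
  by (simp add: mls_bound_def)

lemma mls_bound_prime: "prime p \<Longrightarrow> mls_bound p = p"
  by (simp add: mls_bound_def prime_factorization_prime)

text \<open>Multiplicities add over a product. Both bounds are extended to the primes of
  \<open>m * n\<close>, where the additional primes contribute zero.\<close>

lemma mls_bound_mult:
  assumes "m > 0" "n > 0"
  shows "mls_bound (m * n) = mls_bound m + mls_bound n"
proof -
  have extend: "mls_bound k = (\<Sum>p\<in>prime_factors (m * n). multiplicity p k * p)"
    if "k dvd m * n" for k
    unfolding mls_bound_def
  proof (rule sum.mono_neutral_left)
    have "m * n \<noteq> 0" using assms by simp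
    then show "prime_factors k \<subseteq> prime_factors (m * n)" using that by (rule dvd_prime_factors)
    show "\<forall>p\<in>prime_factors (m * n) - prime_factors k. multiplicity p k * p = 0"
      by (auto simp: prime_factors_multiplicity)
  qed simp
  have "mls_bound (m * n) = (\<Sum>p\<in>prime_factors (m * n). multiplicity p m * p + multiplicity p n * p)"
    unfolding mls_bound_def using assms
    by (intro sum.cong refl)
       (auto simp: prime_elem_multiplicity_mult_distrib in_prime_factors_imp_prime add_mult_distrib)
  then show ?thesis using extend[of m] extend[of n] by (simp add: sum.distrib)
qed

text \<open>A single factor suffices, since a prime is its own bound. Arbitrary sets of
  representatives become usable through this lemma.\<close>

lemma min_factorisable_prime_card:
  assumes "group G" "S \<subseteq> carrier G" "prime (card S)"
  shows "min_factorisable G S"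
proof -
  interpret group G by fact
  have "bij_betw (group_prod G) (listset [S]) S"
    using assms(2) by (intro bij_betwI[where g = "\<lambda>x. [x]"]) (auto simp: set_Cons_def group_prod_def)
  then show ?thesis
    unfolding min_factorisable_def using assms
    by (intro exI[of _ "[S]"]) (auto simp: ls_length_def mls_bound_prime)
qed

lemma min_factorisable_one:
  assumes "group G"
  shows "min_factorisable G {\<one>\<^bsub>G\<^esub>}"
  unfolding min_factorisable_def
  by (intro exI[of _ "[]"]) (auto simp: ls_length_def mls_bound_1 group_prod_def bij_betw_def)

lemma (in monoid) group_prod_closed:
  "set xs \<subseteq> carrier G \<Longrightarrow> group_prod G xs \<in> carrier G"
  by (induction xs) (auto simp: group_prod_def)

lemma (in monoid) group_prod_append:
  assumes "set xs \<subseteq> carrier G" "set ys \<subseteq> carrier G"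
  shows "group_prod G (xs @ ys) = group_prod G xs \<otimes> group_prod G ys"
  using assms(1)
proof (induction xs)
  case Nil
  then show ?case using group_prod_closed[OF assms(2)] by (simp add: group_prod_def)
next
  case (Cons x xs)
  then show ?case using group_prod_closed[OF assms(2)] group_prod_closed[of xs]
    by (simp add: group_prod_def m_assoc)
qed

lemma set_subset_if_listset:
  assumes "xs \<in> listset As" "\<forall>A\<in>set As. A \<subseteq> C"
  shows "set xs \<subseteq> C"
  using assms unfolding listset_iff_list_all2 by (induction rule: list_all2_induct) auto

lemma min_factorisable_subset:
  assumes "group G" "min_factorisable G S"
  shows "S \<subseteq> carrier G"
proof -
  obtain As where As: "\<forall>A\<in>set As. A \<subseteq> carrier G" "bij_betw (group_prod G) (listset As) S"
    using assms unfolding min_factorisable_def by blast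
  interpret group G by fact
  have "group_prod G xs \<in> carrier G" if "xs \<in> listset As" for xs
    using set_subset_if_listset[OF that As(1)] by (rule group_prod_closed)
  then show ?thesis
    unfolding bij_betw_imp_surj_on[OF As(2), symmetric] by blast
qed

text \<open>The two lists of factors are concatenated. Injectivity makes the sizes multiply, and
  positive sizes then make the bounds add.\<close>

lemma min_factorisable_mult:
  assumes G: "group G" and S: "min_factorisable G S" and T: "min_factorisable G T"
    and ne: "card S > 0" "card T > 0"
    and inj: "inj_on (\<lambda>(s, t). s \<otimes>\<^bsub>G\<^esub> t) (S \<times> T)"
  shows "min_factorisable G ((\<lambda>(s, t). s \<otimes>\<^bsub>G\<^esub> t) ` (S \<times> T))"
proof -
  interpret group G by fact
  obtain As where As: "\<forall>A\<in>set As. A \<subseteq> carrier G" "bij_betw (group_prod G) (listset As) S"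
    "ls_length As = mls_bound (card S)"
    using S unfolding min_factorisable_def by blast
  obtain Bs where Bs: "\<forall>A\<in>set Bs. A \<subseteq> carrier G" "bij_betw (group_prod G) (listset Bs) T"
    "ls_length Bs = mls_bound (card T)"
    using T unfolding min_factorisable_def by blast
  define f where "f = (\<lambda>(s, t). s \<otimes>\<^bsub>G\<^esub> t)"
  have split: "bij_betw (\<lambda>xs. (take (length As) xs, drop (length As) xs))
      (listset (As @ Bs)) (listset As \<times> listset Bs)"
    by (rule bij_betwI[where g = "\<lambda>(xs, ys). xs @ ys"])
       (auto simp: listset_iff_list_all2 list_all2_append2 list_all2_lengthD,
        blast dest: list_all2_lengthD)
  have prods: "bij_betw (map_prod (group_prod G) (group_prod G)) (listset As \<times> listset Bs) (S \<times> T)"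
    using As(2) Bs(2) unfolding bij_betw_def by (auto intro: map_prod_inj_on simp: map_prod_surj_on)
  have bij_f: "bij_betw f (S \<times> T) (f ` (S \<times> T))"
    using inj unfolding f_def by (rule inj_on_imp_bij_betw)
  have bij0: "bij_betw (f \<circ> (map_prod (group_prod G) (group_prod G)
      \<circ> (\<lambda>xs. (take (length As) xs, drop (length As) xs)))) (listset (As @ Bs)) (f ` (S \<times> T))"
    by (rule bij_betw_trans[OF bij_betw_trans[OF split prods] bij_f])
  have eq: "(f \<circ> (map_prod (group_prod G) (group_prod G)
      \<circ> (\<lambda>xs. (take (length As) xs, drop (length As) xs)))) xs = group_prod G xs"
    if "xs \<in> listset (As @ Bs)" for xs
  proof -
    have "set xs \<subseteq> carrier G"
      using set_subset_if_listset[OF that, of "carrier G"] As(1) Bs(1) by auto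
    then have "set (take (length As) xs) \<subseteq> carrier G" "set (drop (length As) xs) \<subseteq> carrier G"
      by (meson order_trans set_take_subset set_drop_subset)+
    from group_prod_append[OF this] show ?thesis by (simp add: f_def)
  qed
  have bij: "bij_betw (group_prod G) (listset (As @ Bs)) (f ` (S \<times> T))"
    by (rule iffD1[OF bij_betw_cong bij0]) (rule eq)
  have "card (f ` (S \<times> T)) = card S * card T"
    using inj unfolding f_def by (simp add: card_image card_cartesian_product)
  then have "ls_length (As @ Bs) = mls_bound (card (f ` (S \<times> T)))"
    using As(3) Bs(3) ne by (simp add: ls_length_def mls_bound_mult)
  moreover have "\<forall>A\<in>set (As @ Bs). A \<subseteq> carrier G" using As(1) Bs(1) by auto
  ultimately show ?thesis
    unfolding min_factorisable_def f_def[symmetric] using bij by blast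
qed

text \<open>The form in which every coset decomposition enters: \<open>S\<close> represents the left
  cosets of \<open>K\<close> in \<open>H\<close>. For a stabiliser \<open>K\<close>, the condition
  on \<open>inv s \<otimes> g\<close> becomes an equality of images of a point.\<close>

lemma min_factorisable_transversal:
  fixes G (structure)
  assumes G: "group G" and S: "min_factorisable G S" and K: "min_factorisable G K"
    and fin: "finite (carrier G)"
    and K': "subgroup K G" and H: "subgroup H G" and sub: "S \<subseteq> H" "K \<subseteq> H"
    and unique: "\<And>g. g \<in> H \<Longrightarrow> \<exists>!s. s \<in> S \<and> inv\<^bsub>G\<^esub> s \<otimes>\<^bsub>G\<^esub> g \<in> K"
  shows "min_factorisable G H"
proof -
  interpret group G by fact
  have HG: "H \<subseteq> carrier G" using H by (simp add: subgroup.subset)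
  let ?f = "\<lambda>(s, t). s \<otimes>\<^bsub>G\<^esub> t"
  have cancel: "inv s \<otimes> (s \<otimes> k) = k" if "s \<in> S" "k \<in> K" for s k
    using that sub HG by (metis inv_solve_left m_closed subsetD)
  have inj: "inj_on ?f (S \<times> K)"
  proof (intro inj_onI, clarify)
    fix s k s' k' assume *: "s \<in> S" "k \<in> K" "s' \<in> S" "k' \<in> K" "s \<otimes> k = s' \<otimes> k'"
    have "s \<otimes> k \<in> H" using * sub subgroup.m_closed[OF H] by blast
    then have "s = s'"
      using unique[of "s \<otimes> k"] cancel * by metis
    then show "s = s' \<and> k = k'" using cancel * by metis
  qed
  have "?f ` (S \<times> K) = H"
  proof
    show "?f ` (S \<times> K) \<subseteq> H" using sub subgroup.m_closed[OF H] by auto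
  next
    show "H \<subseteq> ?f ` (S \<times> K)"
    proof
      fix g assume g: "g \<in> H"
      then obtain s where s: "s \<in> S" "inv s \<otimes> g \<in> K" using unique by blast
      have "g = s \<otimes> (inv s \<otimes> g)"
        using s g sub HG by (metis inv_solve_left subsetD)
      then show "g \<in> ?f ` (S \<times> K)" using s by force
    qed
  qed
  moreover have "finite S" "finite K" using sub HG fin by (meson finite_subset)+
  moreover have "S \<noteq> {}" using unique subgroup.one_closed[OF H] by blast
  moreover have "K \<noteq> {}" using subgroup.one_closed[OF K'] by blast
  ultimately show ?thesis
    using min_factorisable_mult[OF G S K _ _ inj] by (simp add: card_gt_0_iff)
qed

lemma min_factorisable_mono:
  assumes "min_factorisable (G\<lparr>carrier := H\<rparr>) S" "H \<subseteq> carrier G"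
  shows "min_factorisable G S"
  using assms unfolding min_factorisable_def group_prod_def by fastforce

section \<open>Lifting along homomorphisms, abelian groups and abelian extensions\<close>

text \<open>A section of \<phi> is applied to every factor. It need not be a homomorphism: products
  of the chosen preimages still map to the original products, which keeps them distinct.\<close>

lemma min_factorisable_lift:
  assumes G: "group G" and H: "group H" and hom: "\<phi> \<in> hom G H" and surj: "\<phi> ` carrier G = carrier H"
    and T: "min_factorisable H T"
  shows "\<exists>S. S \<subseteq> carrier G \<and> min_factorisable G S \<and> bij_betw \<phi> S T"
proof -
  interpret G: group G by fact
  interpret H: group H by fact
  obtain As where As: "\<forall>A\<in>set As. A \<subseteq> carrier H" "bij_betw (group_prod H) (listset As) T"
    "ls_length As = mls_bound (card T)"
    using T unfolding min_factorisable_def by blast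
  define \<psi> where "\<psi> = inv_into (carrier G) \<phi>"
  have \<psi>: "\<psi> x \<in> carrier G" "\<phi> (\<psi> x) = x" if "x \<in> carrier H" for x
    using that surj unfolding \<psi>_def by (auto simp: inv_into_into f_inv_into_f)
  define S where "S = group_prod G ` map \<psi> ` listset As"
  have image: "listset (map ((`) \<psi>) Bs) = map \<psi> ` listset Bs" for Bs
  proof (induction Bs)
    case (Cons B Bs)
    then show ?case by (force simp: set_Cons_def image_iff)
  qed auto
  have prod: "\<phi> (group_prod G (map \<psi> xs)) = group_prod H xs" if "set xs \<subseteq> carrier H" for xs
    using that
  proof (induction xs)
    case Nil
    then show ?case using hom_one[OF hom G H] by (simp add: group_prod_def)
  next
    case (Cons x xs)
    have "set (map \<psi> xs) \<subseteq> carrier G" using Cons \<psi> by auto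
    then have "group_prod G (map \<psi> xs) \<in> carrier G" by (rule G.group_prod_closed)
    then have "\<phi> (\<psi> x \<otimes>\<^bsub>G\<^esub> group_prod G (map \<psi> xs)) = x \<otimes>\<^bsub>H\<^esub> \<phi> (group_prod G (map \<psi> xs))"
      using Cons \<psi> by (simp add: hom_mult[OF hom])
    then show ?case using Cons by (simp add: group_prod_def)
  qed
  have sub: "set xs \<subseteq> carrier H" if "xs \<in> listset As" for xs
    using set_subset_if_listset[OF that As(1)] .
  have inj: "inj_on (group_prod G \<circ> map \<psi>) (listset As)"
  proof (rule inj_onI)
    fix xs ys assume *: "xs \<in> listset As" "ys \<in> listset As"
      "(group_prod G \<circ> map \<psi>) xs = (group_prod G \<circ> map \<psi>) ys"
    then have "group_prod H xs = group_prod H ys" using prod[OF sub] by (metis comp_apply)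
    then show "xs = ys" using As(2) * unfolding bij_betw_def inj_on_def by blast
  qed
  have prods: "bij_betw (group_prod G) (map \<psi> ` listset As) S"
    using inj unfolding S_def by (intro inj_on_imp_bij_betw inj_on_imageI)
  have "\<phi> ` S = group_prod H ` listset As"
    unfolding S_def image_image by (intro image_cong refl prod sub)
  then have "\<phi> ` S = T" using As(2) by (simp add: bij_betw_def)
  moreover have "inj_on (\<phi> \<circ> (group_prod G \<circ> map \<psi>)) (listset As)"
    using As(2) prod[OF sub] unfolding bij_betw_def inj_on_def by simp
  then have "inj_on \<phi> S"
    unfolding S_def by (metis image_comp inj_on_imageI)
  ultimately have bij: "bij_betw \<phi> S T" unfolding bij_betw_def by blast
  have "card (\<psi> ` A) = card A" if "A \<in> set As" for A
    using that As(1) \<psi>(2) by (intro card_image inj_onI) (metis subsetD)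
  then have "ls_length (map ((`) \<psi>) As) = ls_length As"
    unfolding ls_length_def map_map comp_def by (simp cong: map_cong)
  then have "ls_length (map ((`) \<psi>) As) = mls_bound (card S)"
    using As(3) bij_betw_same_card[OF bij] by simp
  moreover have "\<forall>A\<in>set (map ((`) \<psi>) As). A \<subseteq> carrier G" using As(1) \<psi>(1) by auto
  ultimately have "min_factorisable G S"
    unfolding min_factorisable_def using prods image[of As] by metis
  then show ?thesis using bij min_factorisable_subset[OF G] by blast
qed

lemma min_factorisable_iso:
  assumes "group G" "group H" "\<phi> \<in> iso G H" "min_factorisable H (carrier H)"
  shows "min_factorisable G (carrier G)"
proof -
  have *: "\<phi> \<in> hom G H" "bij_betw \<phi> (carrier G) (carrier H)" using assms(3) by (auto simp: iso_def)
  then obtain S where S: "S \<subseteq> carrier G" "min_factorisable G S" "bij_betw \<phi> S (carrier H)"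
    using min_factorisable_lift[OF assms(1,2) *(1) _ assms(4)] by (auto simp: bij_betw_def)
  have "carrier G \<subseteq> S"
  proof
    fix x assume x: "x \<in> carrier G"
    then obtain y where "y \<in> S" "\<phi> y = \<phi> x" using S(3) *(2) by (metis bij_betwE bij_betw_imp_surj_on imageE)
    then show "x \<in> S" using *(2) S(1) x unfolding bij_betw_def inj_on_def by (metis subsetD)
  qed
  then show ?thesis using S by (metis subset_antisym)
qed

text \<open>By commutativity this set is the subgroup generated by \<open>y\<close> and
  \<open>K\<close>.\<close>

lemma (in comm_group) subgroup_adjoin:
  assumes K: "subgroup K G" and y: "y \<in> carrier G"
  shows "subgroup ((\<lambda>(i :: int, k). y [^] i \<otimes> k) ` (UNIV \<times> K)) G" (is "subgroup ?H G")
proof (rule subgroupI)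
  have KG: "k \<in> carrier G" if "k \<in> K" for k using that K by (rule subgroup.mem_carrier[rotated])
  show "?H \<subseteq> carrier G" using KG y by auto
  show "?H \<noteq> {}" using subgroup.one_closed[OF K] by auto
  fix a assume "a \<in> ?H"
  then obtain i :: int and k where a: "a = y [^] i \<otimes> k" "k \<in> K" by auto
  have "inv a = y [^] (- i) \<otimes> inv k" using a y KG by (simp add: inv_mult int_pow_neg)
  then show "inv a \<in> ?H" using a subgroup.m_inv_closed[OF K] by force
  fix b assume "b \<in> ?H"
  then obtain j :: int and l where b: "b = y [^] j \<otimes> l" "l \<in> K" by auto
  have "a \<otimes> b = y [^] (i + j) \<otimes> (k \<otimes> l)"
    using a b y KG by (simp add: int_pow_mult m_ac)
  then show "a \<otimes> b \<in> ?H" using a b subgroup.m_closed[OF K] by force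
qed

text \<open>The first \<open>s\<close> powers of \<open>y\<close> represent the cosets of
  \<open>K\<close>; as \<open>s\<close> is prime, they form one admissible factor.\<close>

lemma (in comm_group) min_factorisable_adjoin:
  assumes fin: "finite (carrier G)" and K: "subgroup K G" "min_factorisable G K"
    and y: "y \<in> carrier G" and s: "prime s" "y [^] s \<in> K"
    and not: "\<And>t :: nat. 0 < t \<Longrightarrow> t < s \<Longrightarrow> y [^] t \<notin> K"
  shows "min_factorisable G ((\<lambda>(i :: int, k). y [^] i \<otimes> k) ` (UNIV \<times> K))" (is "min_factorisable G ?H")
proof -
  define S where "S = (\<lambda>i :: nat. y [^] i) ` {..<s}"
  have KG: "k \<in> carrier G" if "k \<in> K" for k using that K(1) by (rule subgroup.mem_carrier[rotated])
  have less: "i = j" if "i < s" "j < s" "i \<le> j" "inv (y [^] i) \<otimes> y [^] j \<in> K" for i j :: nat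
  proof (rule ccontr)
    assume "i \<noteq> j"
    have "y [^] j = y [^] i \<otimes> y [^] (j - i)" using that y by (simp add: nat_pow_mult)
    then have "inv (y [^] i) \<otimes> y [^] j = y [^] (j - i)"
      using y by (simp add: m_assoc[symmetric])
    then show False using not[of "j - i"] that \<open>i \<noteq> j\<close> by auto
  qed
  have eq: "i = j" if "i < s" "j < s" "inv (y [^] i) \<otimes> y [^] j \<in> K" for i j :: nat
  proof (cases "i \<le> j")
    case False
    have "inv (inv (y [^] i) \<otimes> y [^] j) \<in> K" using that(3) by (rule subgroup.m_inv_closed[OF K(1)])
    then have "inv (y [^] j) \<otimes> y [^] i \<in> K" using y by (simp add: inv_mult m_comm)
    then show ?thesis using less[of j i] that False by simp
  qed (use less that in blast)
  have "inj_on (\<lambda>i :: nat. y [^] i) {..<s}"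
  proof (rule inj_onI)
    fix i j :: nat assume "i \<in> {..<s}" "j \<in> {..<s}" "y [^] i = y [^] j"
    then show "i = j" using eq[of i j] y subgroup.one_closed[OF K(1)] by simp
  qed
  then have "card S = s" unfolding S_def by (simp add: card_image)
  then have S: "min_factorisable G S"
    using s(1) y by (intro min_factorisable_prime_card) (auto simp: S_def)
  have SH: "S \<subseteq> ?H"
  proof
    fix x assume "x \<in> S"
    then obtain i where "x = y [^] int i \<otimes> \<one>" using y by (auto simp: S_def int_pow_int)
    then show "x \<in> ?H" using subgroup.one_closed[OF K(1)] by force
  qed
  have KH: "K \<subseteq> ?H"
  proof
    fix k assume "k \<in> K"
    then show "k \<in> ?H" using KG by (intro image_eqI[of _ _ "(0, k)"]) auto
  qed
  show ?thesis
  proof (rule min_factorisable_transversal[OF is_group S K(2) fin K(1) subgroup_adjoin[OF K(1) y] SH KH])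
    fix g assume "g \<in> ?H"
    then obtain i :: int and k where g: "g = y [^] i \<otimes> k" "k \<in> K" by auto
    \<comment> \<open>The exponent is reduced modulo \<open>s\<close>; what is removed is a power of
      \<open>y [^] s\<close> and is absorbed by \<open>K\<close>.\<close>
    define j where "j = nat (i mod int s)"
    have j: "j < s" "int j = i mod int s" using prime_gt_0_nat[OF s(1)]
      by (auto simp: j_def nat_less_iff)
    have "y [^] i = y [^] (int j + int s * (i div int s))" using j by simp
    also have "\<dots> = y [^] j \<otimes> (y [^] s) [^] (i div int s)"
      using y by (simp add: int_pow_mult int_pow_pow[symmetric] int_pow_int)
    finally have "g = y [^] j \<otimes> ((y [^] s) [^] (i div int s) \<otimes> k)"
      using g y KG by (simp add: m_assoc)
    then have "inv (y [^] j) \<otimes> g = (y [^] s) [^] (i div int s) \<otimes> k"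
      using y KG g by (simp add: m_assoc[symmetric])
    moreover have "(y [^] s) [^] (i div int s) \<otimes> k \<in> K"
      using g s subgroup.m_closed[OF K(1)] subgroup_int_pow_closed[OF K(1)] by blast
    ultimately have mem: "inv (y [^] j) \<otimes> g \<in> K" by simp
    have gG: "g \<in> carrier G" using g y KG by simp
    show "\<exists>!x. x \<in> S \<and> inv x \<otimes> g \<in> K"
    proof (rule ex1I[of _ "y [^] j"])
      show "y [^] j \<in> S \<and> inv (y [^] j) \<otimes> g \<in> K" using mem j by (auto simp: S_def)
      fix x assume x: "x \<in> S \<and> inv x \<otimes> g \<in> K"
      then obtain l where l: "x = y [^] l" "l < s" by (auto simp: S_def)
      have "(inv x \<otimes> g) \<otimes> inv (inv (y [^] j) \<otimes> g) \<in> K"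
        using x mem subgroup.m_closed[OF K(1)] subgroup.m_inv_closed[OF K(1)] by blast
      moreover have "(inv x \<otimes> g) \<otimes> inv (inv (y [^] j) \<otimes> g) = inv x \<otimes> y [^] j"
      proof -
        have "g \<otimes> (inv g \<otimes> y [^] j) = y [^] j"
          using y gG by (simp add: m_assoc[symmetric])
        then show ?thesis using l y gG by (simp add: inv_mult_group m_assoc)
      qed
      ultimately show "x = y [^] j" using eq[of l j] l j by simp
    qed
  qed
qed

text \<open>A maximal factorisable subgroup must be everything, because a proper one can be enlarged
  by a step of prime index.\<close>

lemma min_factorisable_comm_group:
  assumes "comm_group G" and fin: "finite (carrier G)"
  shows "min_factorisable G (carrier G)"
proof -
  interpret comm_group G by fact
  define Ks where "Ks = {K. subgroup K G \<and> min_factorisable G K}"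
  have "Ks \<subseteq> Pow (carrier G)" using subgroup.subset unfolding Ks_def by blast
  then have "finite Ks" using fin by (meson finite_Pow_iff finite_subset)
  moreover have "{\<one>\<^bsub>G\<^esub>} \<in> Ks"
    using min_factorisable_one[OF is_group] triv_subgroup by (simp add: Ks_def)
  ultimately obtain K where K: "K \<in> Ks" and max: "\<And>L. L \<in> Ks \<Longrightarrow> K \<subseteq> L \<Longrightarrow> L = K"
    using finite_has_maximal[of Ks] by blast
  have KG: "K \<subseteq> carrier G" using K subgroup.subset unfolding Ks_def by blast
  have "K = carrier G"
  proof (rule ccontr)
    assume "K \<noteq> carrier G"
    then obtain x where x: "x \<in> carrier G" "x \<notin> K" using KG by blast
    have "x [^]\<^bsub>G\<^esub> Coset.order G = \<one>\<^bsub>G\<^esub>" using x(1) by (rule pow_order_eq_1)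
    moreover have "\<one>\<^bsub>G\<^esub> \<in> K" using K subgroup.one_closed unfolding Ks_def by blast
    ultimately have ex: "\<exists>n :: nat. 0 < n \<and> x [^]\<^bsub>G\<^esub> n \<in> K"
      using order_gt_0_iff_finite fin by metis
    define m where "m = (LEAST n :: nat. 0 < n \<and> x [^]\<^bsub>G\<^esub> n \<in> K)"
    have m: "0 < m" "x [^]\<^bsub>G\<^esub> m \<in> K" using LeastI_ex[OF ex] by (auto simp: m_def)
    have least: "x [^]\<^bsub>G\<^esub> t \<notin> K" if "0 < t" "t < m" for t
      using not_less_Least[of t] that unfolding m_def by blast
    \<comment> \<open>With \<open>m\<close> the order of \<open>x\<close> modulo \<open>K\<close>
      and \<open>s\<close> a prime divisor of it, the power of \<open>x\<close> with exponent
      \<open>m / s\<close> has order \<open>s\<close> modulo \<open>K\<close>.\<close>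
    have "m \<noteq> 1" using m x by auto
    then obtain s where s: "prime s" "s dvd m" using prime_factor_nat by blast
    then obtain l where l: "m = s * l" by auto
    define y where "y = x [^]\<^bsub>G\<^esub> l"
    have y: "y \<in> carrier G" using x by (simp add: y_def)
    have pow: "y [^]\<^bsub>G\<^esub> t = x [^]\<^bsub>G\<^esub> (l * t)" for t :: nat using x by (simp add: y_def nat_pow_pow)
    let ?H = "(\<lambda>(i :: int, k). y [^]\<^bsub>G\<^esub> i \<otimes>\<^bsub>G\<^esub> k) ` (UNIV \<times> K)"
    have l0: "0 < l" using m l by (cases l) auto
    have "y [^]\<^bsub>G\<^esub> t \<notin> K" if "0 < t" "t < s" for t :: nat
      unfolding pow using that l l0 by (intro least) (auto simp: mult.commute)
    moreover have "y [^]\<^bsub>G\<^esub> s \<in> K" using m(2) unfolding pow l by (simp add: mult.commute)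
    ultimately have "?H \<in> Ks"
      using K min_factorisable_adjoin[OF fin _ _ y s(1), of K] subgroup_adjoin[OF _ y, of K]
      unfolding Ks_def by blast
    moreover have "K \<subseteq> ?H"
    proof
      fix k assume "k \<in> K"
      then show "k \<in> ?H" using KG by (intro image_eqI[of _ _ "(0, k)"]) auto
    qed
    ultimately have "?H = K" using max by blast
    moreover have "y [^]\<^bsub>G\<^esub> (1 :: int) \<otimes>\<^bsub>G\<^esub> \<one>\<^bsub>G\<^esub> \<in> ?H"
      using K subgroup.one_closed[of K G] unfolding Ks_def by (intro image_eqI[of _ _ "(1, \<one>\<^bsub>G\<^esub>)"]) auto
    ultimately have "y \<in> K" using y by simp
    moreover have "l < m" using l l0 prime_gt_1_nat[OF s(1)] by simp
    ultimately show False using least[of l] l0 by (simp add: y_def)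
  qed
  then show ?thesis using K unfolding Ks_def by simp
qed

text \<open>The step that handles solvable groups: representatives lifted from the abelian image are
  multiplied with the kernel. The map need not be onto \<open>H\<close>, so its image
  \<open>I\<close> takes the place of the quotient.\<close>

lemma min_factorisable_kernel:
  assumes G: "group G" "finite (carrier G)" and H: "comm_group H" and hom: "\<phi> \<in> hom G H"
    and ker: "min_factorisable G (kernel G H \<phi>)"
  shows "min_factorisable G (carrier G)"
proof -
  interpret G: group G by fact
  interpret H: comm_group H by fact
  interpret hom: group_hom G H \<phi>
    using hom by (intro group_hom.intro group_hom_axioms.intro) auto
  define I where "I = H\<lparr>carrier := \<phi> ` carrier G\<rparr>"
  have "subgroup (\<phi> ` carrier G) H" by (rule hom.img_is_subgroup)
  then have "group I" unfolding I_def by (rule subgroup.subgroup_is_group) (rule H.is_group)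
  then have I: "comm_group I"
    by (rule group.group_comm_groupI) (auto simp: I_def intro: H.m_comm)
  have mf: "min_factorisable I (carrier I)"
    using G(2) by (intro min_factorisable_comm_group[OF I]) (simp add: I_def)
  have hom': "\<phi> \<in> hom G I" using hom unfolding hom_def I_def by auto
  have surj: "\<phi> ` carrier G = carrier I" by (simp add: I_def)
  obtain S where S: "S \<subseteq> carrier G" "min_factorisable G S" "bij_betw \<phi> S (carrier I)"
    using min_factorisable_lift[OF G(1) \<open>group I\<close> hom' surj mf] by blast
  show ?thesis
  proof (rule min_factorisable_transversal[OF G(1) S(2) ker G(2) hom.subgroup_kernel G.subgroup_self S(1)])
    show "kernel G H \<phi> \<subseteq> carrier G" by (auto simp: kernel_def)
    fix g assume g: "g \<in> carrier G"
    have iff: "inv\<^bsub>G\<^esub> s \<otimes>\<^bsub>G\<^esub> g \<in> kernel G H \<phi> \<longleftrightarrow> \<phi> s = \<phi> g" if "s \<in> S" for s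
    proof -
      have s: "s \<in> carrier G" using that S by blast
      have "\<phi> (inv\<^bsub>G\<^esub> s \<otimes>\<^bsub>G\<^esub> g) = inv\<^bsub>H\<^esub> \<phi> s \<otimes>\<^bsub>H\<^esub> \<phi> g" using s g by simp
      moreover have "inv\<^bsub>H\<^esub> \<phi> s \<otimes>\<^bsub>H\<^esub> \<phi> g = \<one>\<^bsub>H\<^esub> \<longleftrightarrow> \<phi> s = \<phi> g"
        using s g by (metis H.inv_equality H.inv_inv H.inv_closed H.l_inv hom.hom_closed)
      ultimately show ?thesis using s g by (simp add: kernel_def)
    qed
    have "\<phi> g \<in> \<phi> ` S" using S(3) surj g unfolding bij_betw_def by blast
    then obtain s where s: "s \<in> S" "\<phi> s = \<phi> g" by auto
    show "\<exists>!s. s \<in> S \<and> inv\<^bsub>G\<^esub> s \<otimes>\<^bsub>G\<^esub> g \<in> kernel G H \<phi>"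
    proof (rule ex1I[of _ s])
      show "s \<in> S \<and> inv\<^bsub>G\<^esub> s \<otimes>\<^bsub>G\<^esub> g \<in> kernel G H \<phi>" using iff s by blast
      fix t assume t: "t \<in> S \<and> inv\<^bsub>G\<^esub> t \<otimes>\<^bsub>G\<^esub> g \<in> kernel G H \<phi>"
      then have "\<phi> t = \<phi> s" using iff[of t] s(2) by simp
      then show "t = s" using inj_onD[OF bij_betw_imp_inj_on[OF S(3)]] s(1) t by blast
    qed
  qed
qed

section \<open>Roots of unity and finite fields\<close>

lemma power_gcd_eq_1:
  fixes z :: "'b::field"
  assumes "z ^ m = 1" "z ^ n = 1" "m > 0"
  shows "z ^ gcd m n = 1"
proof -
  obtain x y where "m * x = n * y + gcd m n" using bezout_nat[of m n] assms(3) by auto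
  then have "z ^ (m * x) = z ^ (n * y) * z ^ gcd m n" by (simp add: power_add)
  then show ?thesis using assms by (simp add: power_mult)
qed

text \<open>A root of \<open>1 + z + ... + z^(s - 1)\<close> is an \<open>s\<close>-th root of
  unity. It is not 1, because the value of this sum at 1 is \<open>s\<close>, which is nonzero in
  the field; primality then forces the order to be \<open>s\<close>.\<close>

lemma primitive_root_prime:
  assumes "prime s" "of_nat s \<noteq> (0 :: 'b::alg_closed_field)"
  shows "\<exists>z :: 'b. \<forall>t. z ^ t = 1 \<longleftrightarrow> s dvd t"
proof -
  have "s - 1 > 0" using prime_gt_1_nat[OF assms(1)] by simp
  then obtain z :: 'b where "(\<Sum>k\<le>s - 1. 1 * z ^ k) = 0"
    using alg_closed[of "s - 1" "\<lambda>_. 1 :: 'b"] by auto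
  moreover have "{..s - 1} = {..<s}" using prime_gt_0_nat[OF assms(1)] by auto
  ultimately have z: "(\<Sum>k<s. z ^ k) = 0" by simp
  have "z ^ s - 1 = (z - 1) * (\<Sum>k<s. z ^ k)" by (rule power_diff_1_eq)
  then have zs: "z ^ s = 1" using z by simp
  have "z \<noteq> 1" using z assms(2) by auto
  have "s dvd t" if "z ^ t = 1" for t
  proof (rule ccontr)
    assume "\<not> s dvd t"
    then have "gcd s t = 1" using assms(1) by (simp add: prime_imp_coprime)
    then show False using power_gcd_eq_1[OF zs that] \<open>z \<noteq> 1\<close> prime_gt_0_nat[OF assms(1)] by simp
  qed
  moreover have "z ^ t = 1" if "s dvd t" for t using that zs by (auto simp: power_mult)
  ultimately show ?thesis by blast
qed

text \<open>One prime \<open>s\<close> at a time. If \<open>s\<close> divides \<open>m\<close>, an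
  \<open>s\<close>-th root of a primitive \<open>m\<close>-th root has order \<open>s * m\<close>;
  otherwise the orders are coprime and a product of roots works.\<close>

lemma primitive_root_exists:
  assumes "of_nat n \<noteq> (0 :: 'b::alg_closed_field)"
  shows "\<exists>z :: 'b. \<forall>t. z ^ t = 1 \<longleftrightarrow> n dvd t"
  using assms
proof (induction n rule: prime_divisors_induct[case_names zero unit factor])
  case (unit n)
  then show ?case by (intro exI[of _ 1]) auto
next
  case (factor s m)
  then obtain z :: 'b where z: "\<And>t. z ^ t = 1 \<longleftrightarrow> m dvd t" by auto
  have s0: "s > 0" using factor(1) prime_gt_0_nat by simp
  show ?case
  proof (cases "s dvd m")
    case True
    obtain y where y: "y ^ s = z" using nth_root_exists[OF s0] by blast
    have "y ^ t = 1 \<longleftrightarrow> s * m dvd t" for t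
    proof
      assume t: "y ^ t = 1"
      then have "z ^ t = 1" unfolding y[symmetric] by (metis power_mult power_one mult.commute)
      then have "s dvd t" using True z dvd_trans by blast
      then obtain u where u: "t = s * u" by auto
      then have "z ^ u = 1" using t y by (simp add: power_mult)
      then show "s * m dvd t" using z u by simp
    next
      assume "s * m dvd t"
      then obtain u where "t = s * (m * u)" by (metis dvdE mult.assoc)
      then have "y ^ t = z ^ (m * u)" using y by (simp add: power_mult)
      then show "y ^ t = 1" using z by simp
    qed
    then show ?thesis by blast
  next
    case False
    then have cop: "coprime s m" using factor(1) by (simp add: prime_imp_coprime)
    obtain w :: 'b where w: "\<And>t. w ^ t = 1 \<longleftrightarrow> s dvd t" 
      using primitive_root_prime[OF factor(1), where ?'b = 'b] factor(3) by auto
    have "(w * z) ^ t = 1 \<longleftrightarrow> s * m dvd t" for t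
    proof
      assume t: "(w * z) ^ t = 1"
      have "(w * z) ^ (t * s) = 1" "(w * z) ^ (t * m) = 1" using t by (simp_all add: power_mult)
      moreover have "w ^ (t * s) = 1" "z ^ (t * m) = 1" using w z by simp_all
      ultimately have "z ^ (t * s) = 1" "w ^ (t * m) = 1" by (simp_all add: power_mult_distrib)
      then have "m dvd t" "s dvd t"
        using w z cop by (simp_all add: coprime_dvd_mult_left_iff coprime_commute)
      then show "s * m dvd t" using cop by (simp add: divides_mult)
    next
      assume "s * m dvd t"
      then have "w ^ t = 1" "z ^ t = 1" using w z by (auto dest: dvd_mult_left dvd_mult_right)
      then show "(w * z) ^ t = 1" by (simp add: power_mult_distrib)
    qed
    then show ?thesis by blast
  qed
qed simp

lemma card_le_degree:
  fixes p :: "'b::field poly"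
  assumes "coeff p n \<noteq> 0" "degree p \<le> n" "\<And>x. x \<in> A \<Longrightarrow> poly p x = 0"
  shows "card A \<le> n"
proof -
  have "p \<noteq> 0" using assms(1) by auto
  then have "card A \<le> card {x. poly p x = 0}"
    using assms(3) poly_roots_finite by (intro card_mono) auto
  also have "\<dots> \<le> degree p" using \<open>p \<noteq> 0\<close> by (rule card_poly_roots_bound)
  finally show ?thesis using assms(2) by simp
qed

text \<open>Pigeonhole without slack: \<open>n * m\<close> points over at most \<open>m\<close>
  values, in fibres of at most \<open>n\<close>, leave no room for a smaller fibre. Degree bounds
  for polynomials thus become exact counts, and surjectivity follows.\<close>

lemma card_fibres_eq:
  assumes "finite A" "finite B" "f ` A \<subseteq> B" "card A = n * m" "card B \<le> m" "n > 0"
    and le: "\<And>y. y \<in> B \<Longrightarrow> card {x\<in>A. f x = y} \<le> n"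
  shows "card B = m" "y \<in> B \<Longrightarrow> card {x\<in>A. f x = y} = n"
proof -
  have sum: "card A = (\<Sum>y\<in>B. card {x\<in>A. f x = y})"
    using sum.group[OF assms(1,2,3), of "\<lambda>_. 1 :: nat"] by simp
  also have "\<dots> \<le> n * card B" using sum_bounded_above[of B "\<lambda>y. card {x\<in>A. f x = y}" n] le by (simp add: mult.commute)
  finally have "m \<le> card B" using assms(4,6) by simp
  then show card: "card B = m" using assms(5) by simp
  assume y: "y \<in> B"
  show "card {x\<in>A. f x = y} = n"
  proof (rule ccontr)
    assume "card {x\<in>A. f x = y} \<noteq> n"
    then have "(\<Sum>y\<in>B. card {x\<in>A. f x = y}) < (\<Sum>y\<in>B. n)"
      using le y assms(2) le_neq_implies_less[OF le[OF y]] by (intro sum_strict_mono_ex1) auto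
    then show False using sum assms(4) card by (simp add: mult.commute)
  qed
qed

text \<open>Multiplication by a nonzero \<open>x\<close> permutes the nonzero elements, so their
  product is unchanged.\<close>

lemma finite_field_pow_card:
  fixes x :: "'a::{field, finite}"
  shows "x ^ CARD('a) = x"
proof (cases "x = 0")
  case False
  have "(\<Prod>y\<in>UNIV-{0}. x * y) = x ^ (CARD('a) - 1) * \<Prod>(UNIV-{0})"
    by (simp add: prod.distrib)
  moreover have "(\<Prod>y\<in>UNIV-{0}. x * y) = (\<Prod>y\<in>UNIV-{0}. y)"
    by (rule prod.reindex_bij_witness[of _ "\<lambda>y. y / x" "\<lambda>y. x * y"]) (use False in auto)
  ultimately have "x ^ (CARD('a) - 1) = 1" by simp
  then have "x * x ^ (CARD('a) - 1) = x" by simp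
  then show ?thesis by (metis Suc_pred' finite_UNIV_card_ge_0 finite power_Suc)
qed simp

lemma of_nat_CARD_eq_0: "of_nat CARD('a) = (0 :: 'a::{ring_1, finite})"
proof -
  have "(\<Sum>x\<in>UNIV. x) = (\<Sum>x\<in>UNIV. x + (1 :: 'a))"
    by (rule sum.reindex_bij_witness[of _ "\<lambda>x. x + 1" "\<lambda>x. x - 1"]) auto
  then show ?thesis by (simp add: sum.distrib)
qed

section \<open>Conjugation, trace and norm on the field with \<open>q^2\<close> elements\<close>

locale unitary_field =
  fixes q :: nat and F :: "'a::{field, finite} itself"
  assumes card_field: "CARD('a) = q ^ 2"
    and prime_power: "\<exists>p k. prime p \<and> k \<ge> 1 \<and> q = p ^ k"
    and odd_q: "odd q"
begin

definition cj :: "'a \<Rightarrow> 'a" where "cj x = x ^ q"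

lemma q_gt_2: "q > 2"
proof -
  obtain p k where "prime p" "k \<ge> 1" "q = p ^ k" using prime_power by blast
  then have "q > 1" using one_less_power[of p k] prime_gt_1_nat[of p] by simp
  then show ?thesis using odd_q by (cases "q = 2") auto
qed

text \<open>Makes \<open>cj\<close> an iterate of the Frobenius map, hence additive.\<close>

lemma q_eq_CHAR_power: "prime CHAR('a)" "\<exists>k. q = CHAR('a) ^ k"
proof -
  show pr: "prime CHAR('a)" using finite_imp_CHAR_pos[where ?'a = 'a] prime_CHAR_semidom by auto
  obtain p k where p: "prime p" "k \<ge> 1" "q = p ^ k" using prime_power by blast
  have "CHAR('a) dvd p ^ (k * 2)"
    using of_nat_CARD_eq_0[where ?'a = 'a] unfolding of_nat_eq_0_iff_char_dvd card_field p(3) power_mult .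
  then have "CHAR('a) = p" using pr p(1) prime_dvd_power primes_dvd_imp_eq by blast
  then show "\<exists>k. q = CHAR('a) ^ k" using p by blast
qed

lemma cj_add [simp]: "cj (x + y) = cj x + cj y"
  unfolding cj_def using q_eq_CHAR_power freshmans_dream' by blast

lemma cj_mult [simp]: "cj (x * y) = cj x * cj y"
  by (simp add: cj_def power_mult_distrib)

lemma cj_cj [simp]: "cj (cj x) = x"
  using finite_field_pow_card[of x] by (simp add: cj_def card_field power2_eq_square flip: power_mult)

lemma cj_0 [simp]: "cj 0 = 0" and cj_1 [simp]: "cj 1 = 1"
  using q_gt_2 by (simp_all add: cj_def)

lemma cj_minus [simp]: "cj (- x) = - cj x"
  by (simp add: cj_def odd_q)

lemma cj_diff [simp]: "cj (x - y) = cj x - cj y"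
  using cj_add[of x "- y"] by simp

lemma cj_inverse [simp]: "cj (inverse x) = inverse (cj x)"
  by (simp add: cj_def power_inverse)

lemma cj_divide [simp]: "cj (x / y) = cj x / cj y"
  by (simp add: cj_def power_divide)

lemma cj_of_nat: "cj (of_nat n) = of_nat n"
  by (induction n) auto

lemma cj_numeral [simp]: "cj (numeral n) = numeral n"
  using cj_of_nat[of "numeral n"] by simp

lemma cj_eq_0_iff [simp]: "cj x = 0 \<longleftrightarrow> x = 0"
  using q_gt_2 by (simp add: cj_def)

lemma cj_eq_iff [simp]: "cj x = cj y \<longleftrightarrow> x = y"
  by (metis cj_cj)

lemma two_neq_0 [simp]: "(2 :: 'a) \<noteq> 0"
proof
  assume "(2 :: 'a) = 0"
  then have "CHAR('a) dvd 2" using of_nat_eq_0_iff_char_dvd[of 2] by (metis of_nat_numeral)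
  then have "CHAR('a) = 2" using q_eq_CHAR_power(1) by (metis primes_dvd_imp_eq two_is_prime_nat)
  then obtain k where "q = 2 ^ k" using q_eq_CHAR_power(2) by auto
  then show False using odd_q q_gt_2 by (cases k) auto
qed

lemma card_fixed_le: "card {x. cj x = x} \<le> q"
  by (rule card_le_degree[of "monom 1 q - monom 1 1"])
     (use q_gt_2 in \<open>auto simp: poly_monom cj_def degree_monom_eq intro!: degree_diff_le\<close>)

lemma card_trace_fibre_le: "card {x. x + cj x = t} \<le> q"
  by (rule card_le_degree[of "monom 1 q + (monom 1 1 - [:t:])"])
     (use q_gt_2 in \<open>auto simp: poly_monom cj_def degree_monom_eq coeff_pCons split: nat.splits
        intro!: degree_diff_le degree_add_le\<close>)

lemma card_norm_fibre_le: "card {x. x * cj x = t} \<le> q + 1"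
  by (rule card_le_degree[of "monom 1 (q + 1) - [:t:]"])
     (use q_gt_2 in \<open>auto simp: poly_monom cj_def degree_monom_eq coeff_pCons split: nat.splits
        intro!: degree_diff_le\<close>)

text \<open>The trace maps \<open>q * q\<close> elements into the fixed elements of
  \<open>cj\<close>; there are at most \<open>q\<close> of these and each fibre has at most
  \<open>q\<close> elements, so both bounds are attained.\<close>

lemma trace_fibre: "card {x. cj x = x} = q" "cj t = t \<Longrightarrow> card {x. x + cj x = t} = q"
proof -
  note * = card_fibres_eq[of "UNIV :: 'a set" "{x. cj x = x}" "\<lambda>x. x + cj x" q q]
  have **: "(\<lambda>x. x + cj x) ` UNIV \<subseteq> {x. cj x = x}" by (auto simp: add.commute)
  have card: "CARD('a) = q * q" by (simp add: card_field power2_eq_square)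
  have q0: "q > 0" using q_gt_2 by simp
  have le: "card {x \<in> UNIV. x + cj x = y} \<le> q" for y using card_trace_fibre_le[of y] by simp
  show "card {x. cj x = x} = q"
    by (rule *(1)[OF _ _ ** card card_fixed_le q0 le]) auto
  assume "cj t = t"
  then have "card {x \<in> UNIV. x + cj x = t} = q"
    by (intro *(2)[OF _ _ ** card card_fixed_le q0 le]) auto
  then show "card {x. x + cj x = t} = q" by simp
qed

lemma trace_surj: "cj t = t \<Longrightarrow> \<exists>x. x + cj x = t"
  using trace_fibre(2)[of t] q_gt_2 by (metis (mono_tags, lifting) Collect_empty_eq card.empty not_less_zero)

text \<open>The same count on nonzero elements, with
  \<open>q^2 - 1 = (q + 1) * (q - 1)\<close>.\<close>

lemma norm_surj:
  assumes "cj t = t"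
  shows "\<exists>x. x * cj x = t"
proof (cases "t = 0")
  case False
  have "card {x \<in> UNIV - {0}. x * cj x = t} = q + 1"
  proof (rule card_fibres_eq(2)[of "UNIV - {0}" "{x. cj x = x} - {0}" _ "q + 1" "q - 1"])
    show "(\<lambda>x. x * cj x) ` (UNIV - {0}) \<subseteq> {x. cj x = x} - {0}" by (auto simp: mult.commute)
    have "(q + 1) * (q - 1) = q ^ 2 - 1"
      using q_gt_2 by (simp add: algebra_simps power2_eq_square)
    then show "card (UNIV - {0 :: 'a}) = (q + 1) * (q - 1)" by (simp add: card_field)
    show "card ({x. cj x = x} - {0}) \<le> q - 1" using trace_fibre(1) by simp
    show "card {x \<in> UNIV - {0}. x * cj x = y} \<le> q + 1" for y
      by (rule order_trans[OF card_mono card_norm_fibre_le[of y]]) auto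
  qed (use assms False in auto)
  then show ?thesis by (metis (mono_tags, lifting) Collect_empty_eq card.empty add_is_0 zero_neq_one)
qed (intro exI[of _ 0], simp)

end

section \<open>Descending a normal series by homomorphisms into abelian groups\<close>

lemma subgroup_restricted_kernel:
  assumes G: "group G" and K: "subgroup K G" and H: "group H"
    and hom: "\<phi> \<in> hom (G\<lparr>carrier := K\<rparr>) H"
  shows "subgroup {x\<in>K. \<phi> x = \<one>\<^bsub>H\<^esub>} G"
proof -
  have "group_hom (G\<lparr>carrier := K\<rparr>) H \<phi>"
    using subgroup.subgroup_is_group[OF K G] H hom by (simp add: group_hom_def group_hom_axioms_def)
  from group_hom.subgroup_kernel[OF this]
  have "subgroup {x\<in>K. \<phi> x = \<one>\<^bsub>H\<^esub>} (G\<lparr>carrier := K\<rparr>)" by (simp add: kernel_def)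
  then show ?thesis by (rule group.incl_subgroup[OF G K])
qed

text \<open>Hypothesis and conclusion both speak of a group restricted to a subset, so that several
  steps of a series can be chained.\<close>

lemma min_factorisable_restricted_kernel:
  assumes G: "group G" "finite (carrier G)" and K: "subgroup K G" and H: "comm_group H"
    and hom: "\<phi> \<in> hom (G\<lparr>carrier := K\<rparr>) H"
    and ker: "min_factorisable (G\<lparr>carrier := {x\<in>K. \<phi> x = \<one>\<^bsub>H\<^esub>}\<rparr>) {x\<in>K. \<phi> x = \<one>\<^bsub>H\<^esub>}"
  shows "min_factorisable (G\<lparr>carrier := K\<rparr>) K"
proof -
  let ?G = "G\<lparr>carrier := K\<rparr>" and ?K = "{x\<in>K. \<phi> x = \<one>\<^bsub>H\<^esub>}"
  have group: "group ?G" using K G(1) by (rule subgroup.subgroup_is_group)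
  have fin: "finite (carrier ?G)" using subgroup.subset[OF K] G(2) by (simp add: finite_subset)
  have kernel: "kernel ?G H \<phi> = ?K" by (simp add: kernel_def)
  have "min_factorisable (?G\<lparr>carrier := ?K\<rparr>) ?K" using ker by simp
  then have "min_factorisable ?G (kernel ?G H \<phi>)"
    unfolding kernel by (rule min_factorisable_mono) auto
  from min_factorisable_kernel[OF group fin H hom this] show ?thesis by simp
qed

definition additive_group :: "'a::ab_group_add monoid" where
  "additive_group = \<lparr>carrier = UNIV, mult = (+), one = 0\<rparr>"

definition unit_group :: "'a::field monoid" where
  "unit_group = \<lparr>carrier = UNIV - {0}, mult = (*), one = 1\<rparr>"

lemma comm_group_additive_group: "comm_group additive_group"
  by (rule comm_groupI) (auto simp: additive_group_def algebra_simps intro: exI[of _ "- x" for x])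

lemma comm_group_unit_group: "comm_group unit_group"
proof (rule comm_groupI)
  fix x :: 'a assume "x \<in> carrier unit_group"
  then show "\<exists>y\<in>carrier unit_group. y \<otimes>\<^bsub>unit_group\<^esub> x = \<one>\<^bsub>unit_group\<^esub>"
    by (intro bexI[of _ "inverse x"]) (auto simp: unit_group_def)
qed (auto simp: unit_group_def)

section \<open>The unitary group of a hyperbolic form\<close>

definition mat3 :: "'a \<Rightarrow> 'a \<Rightarrow> 'a \<Rightarrow> 'a \<Rightarrow> 'a \<Rightarrow> 'a \<Rightarrow> 'a \<Rightarrow> 'a \<Rightarrow> 'a \<Rightarrow> 'a::zero ^3^3" where
  "mat3 a b c d e f g h i = vector [vector [a, b, c], vector [d, e, f], vector [g, h, i]]"

lemma mat3_nth [simp]: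
  "mat3 a b c d e f g h i $ 1 $ 1 = a" "mat3 a b c d e f g h i $ 1 $ 2 = b" "mat3 a b c d e f g h i $ 1 $ 3 = c"
  "mat3 a b c d e f g h i $ 2 $ 1 = d" "mat3 a b c d e f g h i $ 2 $ 2 = e" "mat3 a b c d e f g h i $ 2 $ 3 = f"
  "mat3 a b c d e f g h i $ 3 $ 1 = g" "mat3 a b c d e f g h i $ 3 $ 2 = h" "mat3 a b c d e f g h i $ 3 $ 3 = i"
  by (simp_all add: mat3_def)

definition vec3 :: "'a \<Rightarrow> 'a \<Rightarrow> 'a \<Rightarrow> 'a::zero ^3" where
  "vec3 a b c = vector [a, b, c]"

lemma vec3_nth [simp]: "vec3 a b c $ 1 = a" "vec3 a b c $ 2 = b" "vec3 a b c $ 3 = c"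
  by (simp_all add: vec3_def)

lemma vec3_eq_iff: "(x :: 'a ^3) = y \<longleftrightarrow> x $ 1 = y $ 1 \<and> x $ 2 = y $ 2 \<and> x $ 3 = y $ 3"
  by (simp add: vec_eq_iff forall_3)

lemma matrix_vector_mult_nth: "((A :: 'a::semiring_1 ^3^3) *v x) $ i = A $ i $ 1 * x $ 1 + A $ i $ 2 * x $ 2 + A $ i $ 3 * x $ 3"
  by (simp add: matrix_vector_mult_def sum_3)

lemma matrix_matrix_mult_nth: "((A :: 'a::semiring_1 ^3^3) ** B) $ i $ j = A $ i $ 1 * B $ 1 $ j + A $ i $ 2 * B $ 2 $ j + A $ i $ 3 * B $ 3 $ j"
  by (simp add: matrix_matrix_mult_def sum_3)

text \<open>A projective point is encoded by its nonzero vectors, so that a matrix acts on points by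
  plain images of sets and the zero vector stays apart.\<close>

definition line :: "'a::field ^3 \<Rightarrow> ('a ^3) set" where
  "line x = {c *s x | c. c \<noteq> 0}"

lemma line_eq_iff: "line x = line y \<longleftrightarrow> (\<exists>c. c \<noteq> 0 \<and> y = c *s x)"
proof
  assume "line x = line y"
  moreover have "y \<in> line y" unfolding line_def by (intro CollectI exI[of _ 1]) simp
  ultimately have "y \<in> line x" by simp
  then show "\<exists>c. c \<noteq> 0 \<and> y = c *s x" unfolding line_def by auto
next
  assume "\<exists>c. c \<noteq> 0 \<and> y = c *s x"
  then obtain c where c: "c \<noteq> 0" "y = c *s x" by auto
  show "line x = line y"
  proof (intro equalityI subsetI)
    fix z assume "z \<in> line x"
    then obtain d where "z = d *s x" "d \<noteq> 0" unfolding line_def by auto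
    then show "z \<in> line y" unfolding line_def using c
      by (intro CollectI exI[of _ "d / c"]) simp_all
  next
    fix z assume "z \<in> line y"
    then obtain d where "z = d *s y" "d \<noteq> 0" unfolding line_def by auto
    then show "z \<in> line x" unfolding line_def using c
      by (intro CollectI exI[of _ "d * c"]) simp_all
  qed
qed

context unitary_field
begin

text \<open>Here \<open>e1\<close> and \<open>e3\<close> are a hyperbolic pair and \<open>e2\<close>
  is a unit vector orthogonal to both. With this basis the stabiliser of the isotropic point
  \<open>e1\<close> is upper triangular.\<close>

definition hform :: "'a ^3 \<Rightarrow> 'a ^3 \<Rightarrow> 'a" where
  "hform x y = x $ 1 * cj (y $ 3) + x $ 2 * cj (y $ 2) + x $ 3 * cj (y $ 1)"

definition UG :: "('a ^3^3) monoid" where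
  "UG = \<lparr>carrier = {A. det A = 1 \<and> (\<forall>x y. hform (A *v x) (A *v y) = hform x y)},
         mult = (**), one = mat 1\<rparr>"

lemma UG_simps [simp]: "mult UG = (**)" "one UG = mat 1"
  by (simp_all add: UG_def)

lemma group_UG: "group UG"
proof (rule groupI)
  fix A assume A: "A \<in> carrier UG"
  then have "invertible A" by (simp add: invertible_det_nz UG_def)
  then obtain B where B: "A ** B = mat 1" "B ** A = mat 1" unfolding invertible_def by blast
  have "det B = 1" using A arg_cong[OF B(2), of det] by (simp add: det_mul UG_def)
  moreover have "hform (B *v x) (B *v y) = hform x y" for x y
  proof -
    have "hform (B *v x) (B *v y) = hform (A *v (B *v x)) (A *v (B *v y))" using A by (simp add: UG_def)
    then show ?thesis by (simp add: matrix_vector_mul_assoc B)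
  qed
  ultimately show "\<exists>B\<in>carrier UG. B \<otimes>\<^bsub>UG\<^esub> A = \<one>\<^bsub>UG\<^esub>" using B by (auto simp: UG_def)
qed (auto simp: UG_def det_mul matrix_mul_assoc simp flip: matrix_vector_mul_assoc)

sublocale UG: group UG by (rule group_UG)

lemma finite_UG: "finite (carrier UG)" by simp

lemma hform_UG: "A \<in> carrier UG \<Longrightarrow> hform (A *v x) (A *v y) = hform x y"
  and det_UG: "A \<in> carrier UG \<Longrightarrow> det A = 1"
  by (simp_all add: UG_def)

lemma hform_scale: "hform (c *s x) (d *s y) = c * cj d * hform x y"
  by (simp add: hform_def algebra_simps)

lemma cj_hform: "cj (hform x y) = hform y x"
  by (simp add: hform_def algebra_simps)

text \<open>Sesquilinearity reduces invariance to basis vectors, and Hermitian symmetry reduces the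
  nine pairs to six.\<close>

lemma UG_I:
  assumes "det A = 1" "hform (A *v vec3 1 0 0) (A *v vec3 1 0 0) = 0"
    "hform (A *v vec3 1 0 0) (A *v vec3 0 1 0) = 0" "hform (A *v vec3 1 0 0) (A *v vec3 0 0 1) = 1"
    "hform (A *v vec3 0 1 0) (A *v vec3 0 1 0) = 1" "hform (A *v vec3 0 1 0) (A *v vec3 0 0 1) = 0"
    "hform (A *v vec3 0 0 1) (A *v vec3 0 0 1) = 0"
  shows "A \<in> carrier UG"
proof -
  let ?c = "\<lambda>i. A *v (if i = 1 then vec3 1 0 0 else if i = 2 then vec3 0 1 0 else vec3 0 0 (1 :: 'a) :: 'a ^3)"
  have "hform (A *v x) (A *v y) = (\<Sum>i\<in>{1,2,3::nat}. \<Sum>j\<in>{1,2,3::nat}.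
      (if i = 1 then x $ 1 else if i = 2 then x $ 2 else x $ 3) *
      cj (if j = 1 then y $ 1 else if j = 2 then y $ 2 else y $ 3) * hform (?c i) (?c j))" for x y
    by (simp add: hform_def matrix_vector_mult_nth algebra_simps)
  moreover have "hform (A *v vec3 0 1 0) (A *v vec3 1 0 0) = 0"
    "hform (A *v vec3 0 0 1) (A *v vec3 1 0 0) = 1" "hform (A *v vec3 0 0 1) (A *v vec3 0 1 0) = 0"
    using assms(3,4,6) cj_hform cj_0 cj_1 by metis+
  ultimately have "hform (A *v x) (A *v y) = hform x y" for x y
    using assms(2-) by (simp add: hform_def[of x y])
  then show ?thesis using assms(1) by (simp add: UG_def)
qed

lemma UG_vector_cancel:
  assumes "A \<in> carrier UG"
  shows "inv\<^bsub>UG\<^esub> A *v (A *v x) = x" "A *v (inv\<^bsub>UG\<^esub> A *v x) = x"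
  using UG.l_inv[OF assms] UG.r_inv[OF assms] by (simp_all add: matrix_vector_mul_assoc)

lemma UG_mult_eq_0_iff [simp]: "A \<in> carrier UG \<Longrightarrow> A *v x = 0 \<longleftrightarrow> x = 0"
  using UG_vector_cancel(1) matrix_vector_mult_0_right by metis

lemma line_mult_eq_iff:
  assumes "A \<in> carrier UG"
  shows "line (A *v x) = line (A *v y) \<longleftrightarrow> line x = line y"
proof -
  have "A *v y = c *s (A *v x) \<longleftrightarrow> y = c *s x" for c
    using UG_vector_cancel(1)[OF assms] by (metis vector_scalar_commute)
  then show ?thesis by (simp add: line_eq_iff)
qed

definition stab :: "'a ^3 \<Rightarrow> ('a ^3^3) set" where
  "stab x = {A\<in>carrier UG. line (A *v x) = line x}"

text \<open>Translates the coset condition of \<open>min_factorisable_transversal\<close> into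
  geometry.\<close>

lemma inv_mult_stab_iff:
  assumes "A \<in> carrier UG" "B \<in> carrier UG"
  shows "inv\<^bsub>UG\<^esub> A \<otimes>\<^bsub>UG\<^esub> B \<in> stab x \<longleftrightarrow> line (A *v x) = line (B *v x)"
proof -
  have "inv\<^bsub>UG\<^esub> A ** B \<in> carrier UG" using UG.m_closed[OF UG.inv_closed[OF assms(1)] assms(2)] by simp
  then have "inv\<^bsub>UG\<^esub> A \<otimes>\<^bsub>UG\<^esub> B \<in> stab x \<longleftrightarrow> line (inv\<^bsub>UG\<^esub> A *v (B *v x)) = line x"
    by (simp add: stab_def matrix_vector_mul_assoc)
  also have "\<dots> \<longleftrightarrow> line (A *v (inv\<^bsub>UG\<^esub> A *v (B *v x))) = line (A *v x)"
    using line_mult_eq_iff[OF assms(1)] by blast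
  finally show ?thesis using UG_vector_cancel(2)[OF assms(1)] by auto
qed

lemma subgroup_stab: "subgroup (stab x) UG"
proof (rule UG.subgroupI)
  show "stab x \<subseteq> carrier UG" by (auto simp: stab_def)
  show "stab x \<noteq> {}" using UG.one_closed by (force simp: stab_def)
  fix A assume A: "A \<in> stab x"
  then have A': "A \<in> carrier UG" "line (A *v x) = line x" by (auto simp: stab_def)
  show "inv\<^bsub>UG\<^esub> A \<in> stab x"
    using inv_mult_stab_iff[OF A'(1) UG.one_closed, of x] A' by simp
  fix B assume B: "B \<in> stab x"
  then have B': "B \<in> carrier UG" "line (B *v x) = line x" by (auto simp: stab_def)
  show "A \<otimes>\<^bsub>UG\<^esub> B \<in> stab x"
    using UG.m_closed[OF A'(1) B'(1)] line_mult_eq_iff[OF A'(1), of "B *v x" x] A' B'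
    by (simp add: stab_def matrix_vector_mul_assoc)
qed

abbreviation "e1 \<equiv> vec3 1 0 0 :: 'a ^3"
abbreviation "e2 \<equiv> vec3 0 1 0 :: 'a ^3"
abbreviation "e3 \<equiv> vec3 0 0 1 :: 'a ^3"

section \<open>The Borel subgroup and its unipotent elements\<close>

lemma stab_e1_entries:
  assumes "A \<in> stab e1"
  shows "A $ 1 $ 1 \<noteq> 0" "A $ 2 $ 1 = 0" "A $ 3 $ 1 = 0"
proof -
  obtain c where c: "c \<noteq> 0" "e1 = c *s (A *v e1)"
    using assms unfolding stab_def line_eq_iff by auto
  then have "1 = c * A $ 1 $ 1" "0 = c * A $ 2 $ 1" "0 = c * A $ 3 $ 1"
    unfolding vec3_eq_iff by (auto simp: matrix_vector_mult_nth)
  then show "A $ 1 $ 1 \<noteq> 0" "A $ 2 $ 1 = 0" "A $ 3 $ 1 = 0" using c(1) by auto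
qed

text \<open>Such a matrix fixes the vector \<open>e1\<close>. Pairing \<open>e1\<close> with the
  other columns gives the last row, the determinant gives the middle entry, and orthogonality of the
  last two columns ties the entry at (1,2) to the one at (2,3).\<close>

lemma unipotent_entries:
  assumes "A \<in> stab e1" "A $ 1 $ 1 = 1"
  shows "A $ 2 $ 2 = 1" "A $ 3 $ 2 = 0" "A $ 3 $ 3 = 1" "A $ 1 $ 2 = - cj (A $ 2 $ 3)"
proof -
  note [simp] = stab_e1_entries[OF assms(1)] assms(2)
  have A: "A \<in> carrier UG" using assms(1) by (simp add: stab_def)
  show 32 [simp]: "A $ 3 $ 2 = 0"
    using hform_UG[OF A, of e1 e2] by (simp add: hform_def matrix_vector_mult_nth)
  show 33 [simp]: "A $ 3 $ 3 = 1"
    using hform_UG[OF A, of e1 e3] by (simp add: hform_def matrix_vector_mult_nth) (metis cj_1 cj_eq_iff)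
  show [simp]: "A $ 2 $ 2 = 1"
    using det_UG[OF A] by (simp add: det_3)
  show "A $ 1 $ 2 = - cj (A $ 2 $ 3)"
    using hform_UG[OF A, of e2 e3] by (simp add: hform_def matrix_vector_mult_nth eq_neg_iff_add_eq_0)
qed

text \<open>In a product, the entry at (1,3) contains the cross term
  \<open>A $ 1 $ 2 * B $ 2 $ 3\<close>. It becomes additive once the entry at (2,3) vanishes, which
  dictates the order of the three maps.\<close>

lemma entry_hom:
  assumes "subgroup K UG" "K \<subseteq> stab e1"
  shows "(\<lambda>A. A $ 1 $ 1) \<in> hom (UG\<lparr>carrier := K\<rparr>) unit_group"
    "(\<And>A. A \<in> K \<Longrightarrow> A $ 1 $ 1 = 1) \<Longrightarrow> (\<lambda>A. A $ 2 $ 3) \<in> hom (UG\<lparr>carrier := K\<rparr>) additive_group"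
    "(\<And>A. A \<in> K \<Longrightarrow> A $ 1 $ 1 = 1 \<and> A $ 2 $ 3 = 0) \<Longrightarrow>
       (\<lambda>A. A $ 1 $ 3) \<in> hom (UG\<lparr>carrier := K\<rparr>) additive_group"
  using assms stab_e1_entries unipotent_entries
  by (auto simp: hom_def unit_group_def additive_group_def matrix_matrix_mult_nth add.commute subset_iff)

text \<open>The entries at (1,1), (2,3) and (1,3) realise the abelian factors of a normal series of the Borel subgroup.\<close>

lemma min_factorisable_borel:
  assumes sub: "subgroup K UG" "K \<subseteq> stab e1"
  shows "min_factorisable UG K"
proof -
  note step = min_factorisable_restricted_kernel[OF group_UG finite_UG]
  note ker = subgroup_restricted_kernel[OF group_UG]
  note add = comm_group_additive_group and unit = comm_group_unit_group
  \<comment> \<open>\<open>K\<close> may be any subgroup of the Borel group, so the result also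
    covers the intersection with the stabiliser of a second point.\<close>
  define K1 where "K1 = {A\<in>K. A $ 1 $ 1 = \<one>\<^bsub>unit_group\<^esub>}"
  define K2 where "K2 = {A\<in>K1. A $ 2 $ 3 = \<one>\<^bsub>additive_group\<^esub>}"
  define K3 where "K3 = {A\<in>K2. A $ 1 $ 3 = \<one>\<^bsub>additive_group\<^esub>}"
  note hom0 = entry_hom(1)[OF sub]
  have sub1: "subgroup K1 UG" "K1 \<subseteq> stab e1"
    using ker[OF sub(1) comm_group.axioms(2)[OF unit] hom0] sub(2) by (auto simp: K1_def)
  have one1: "A $ 1 $ 1 = 1" if "A \<in> K1" for A using that by (simp add: K1_def unit_group_def)
  have hom1: "(\<lambda>A. A $ 2 $ 3) \<in> hom (UG\<lparr>carrier := K1\<rparr>) additive_group"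
    by (rule entry_hom(2)[OF sub1]) (rule one1)
  have sub2: "subgroup K2 UG" "K2 \<subseteq> stab e1"
    using ker[OF sub1(1) comm_group.axioms(2)[OF add] hom1] sub1(2) by (auto simp: K2_def)
  have one2: "A $ 1 $ 1 = 1 \<and> A $ 2 $ 3 = 0" if "A \<in> K2" for A
    using that one1 by (simp add: K2_def additive_group_def)
  have hom2: "(\<lambda>A. A $ 1 $ 3) \<in> hom (UG\<lparr>carrier := K2\<rparr>) additive_group"
    by (rule entry_hom(3)[OF sub2]) (rule one2)
  have sub3: "subgroup K3 UG" "K3 \<subseteq> stab e1"
    using ker[OF sub2(1) comm_group.axioms(2)[OF add] hom2] sub2(2) by (auto simp: K3_def)
  have "A = mat 1" if "A \<in> K3" for A
  proof -
    have A: "A \<in> stab e1" "A $ 1 $ 1 = 1" "A $ 2 $ 3 = 0" "A $ 1 $ 3 = 0"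
      using that one2[of A] sub3(2) by (auto simp: K3_def additive_group_def)
    then show ?thesis
      using stab_e1_entries[OF A(1)] unipotent_entries[OF A(1,2)]
      by (simp add: vec_eq_iff forall_3 mat_def)
  qed
  then have "K3 \<subseteq> {mat 1}" by blast
  moreover have "mat 1 \<in> K3" using subgroup.one_closed[OF sub3(1)] by simp
  ultimately have "K3 = {mat 1}" by blast
  then have "min_factorisable (UG\<lparr>carrier := K3\<rparr>) K3"
    using min_factorisable_one[OF subgroup.subgroup_is_group[OF sub3(1) group_UG]] by simp
  then have "min_factorisable (UG\<lparr>carrier := K2\<rparr>) K2"
    unfolding K3_def by (rule step[OF sub2(1) add hom2])
  then have "min_factorisable (UG\<lparr>carrier := K1\<rparr>) K1"
    unfolding K2_def by (rule step[OF sub1(1) add hom1])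
  then have "min_factorisable (UG\<lparr>carrier := K\<rparr>) K"
    unfolding K1_def by (rule step[OF sub(1) unit hom0])
  then show ?thesis
    using subgroup.subset[OF sub(1)] by (rule min_factorisable_mono)
qed

text \<open>The shape forced by \<open>unipotent_entries\<close>. The last column is the image of
  \<open>e3\<close>, and the condition in \<open>unip_in_UG\<close> says that this image is
  isotropic.\<close>

definition unip :: "'a \<Rightarrow> 'a \<Rightarrow> 'a ^3^3" where
  "unip \<alpha> \<beta> = mat3 1 (- cj \<alpha>) \<beta> 0 1 \<alpha> 0 0 1"

lemma unip_in_UG:
  assumes "\<beta> + cj \<beta> + \<alpha> * cj \<alpha> = 0"
  shows "unip \<alpha> \<beta> \<in> carrier UG"
  using assms by (intro UG_I) (auto simp: unip_def det_3 hform_def matrix_vector_mult_nth algebra_simps)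

lemma unip_exists: "\<exists>\<beta>. unip \<alpha> \<beta> \<in> carrier UG"
proof -
  obtain \<beta> where "\<beta> + cj \<beta> = - (\<alpha> * cj \<alpha>)"
    using trace_surj[of "- (\<alpha> * cj \<alpha>)"] by (auto simp: mult.commute)
  then show ?thesis using unip_in_UG[of \<beta> \<alpha>] by auto
qed

lemma unip_stab: "unip \<alpha> \<beta> \<in> carrier UG \<Longrightarrow> unip \<alpha> \<beta> \<in> stab e1"
  by (auto simp: stab_def unip_def line_eq_iff vec3_eq_iff matrix_vector_mult_nth intro!: exI[of _ 1])

text \<open>Interchanges \<open>e1\<close> and \<open>e3\<close>; the sign at \<open>e2\<close>
  makes the determinant 1.\<close>

definition weyl :: "'a ^3^3" where
  "weyl = mat3 0 0 1 0 (- 1) 0 1 0 0"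

lemma weyl_in_UG: "weyl \<in> carrier UG"
  by (intro UG_I) (auto simp: weyl_def det_3 hform_def matrix_vector_mult_nth)

end

section \<open>A factorisation through the stabiliser of a non-isotropic point\<close>

context unitary_field
begin

lemma line_affine: "x $ 3 \<noteq> 0 \<Longrightarrow> line x = line (vec3 (x $ 1 / x $ 3) (x $ 2 / x $ 3) 1)"
  for x :: "'a ^3"
  unfolding line_eq_iff by (intro exI[of _ "inverse (x $ 3)"]) (simp add: vec3_eq_iff field_simps)

lemma line_at_infinity: "x $ 3 = 0 \<Longrightarrow> x $ 2 \<noteq> 0 \<Longrightarrow> line x = line (vec3 (x $ 1 / x $ 2) 1 0)"
  for x :: "'a ^3"
  unfolding line_eq_iff by (intro exI[of _ "inverse (x $ 2)"]) (simp add: vec3_eq_iff field_simps)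

lemma line_vec3_eq_iff:
  "line (vec3 a b 1) = line (vec3 a' b' 1) \<longleftrightarrow> a = a' \<and> b = b'"
  "line (vec3 a 1 0) = line (vec3 a' 1 0) \<longleftrightarrow> a = a'"
  "line (vec3 a 1 0) \<noteq> line (vec3 a' b 1)" "line (vec3 a' b 1) \<noteq> line (vec3 a 1 0)"
  for a b a' b' :: 'a
  by (auto simp: line_eq_iff vec3_eq_iff)

text \<open>The entry at (2,3) maps the unipotent group onto the additive group of the field. A
  signature of that abelian group is lifted, giving one matrix for each value of the entry.\<close>

lemma unipotent_transversal:
  "\<exists>U. U \<subseteq> {A\<in>stab e1. A $ 1 $ 1 = 1} \<and> min_factorisable UG U \<and> bij_betw (\<lambda>A. A $ 2 $ 3) U UNIV"
proof -
  define Q where "Q = {A\<in>stab e1. A $ 1 $ 1 = \<one>\<^bsub>unit_group\<^esub>}"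
  have Q: "subgroup Q UG" "Q \<subseteq> stab e1" "Q \<subseteq> carrier UG"
    unfolding Q_def using subgroup_restricted_kernel[OF group_UG subgroup_stab
        comm_group.axioms(2)[OF comm_group_unit_group] entry_hom(1)[OF subgroup_stab order_refl]]
    by (auto simp: stab_def)
  let ?\<phi> = "\<lambda>A :: 'a ^3^3. A $ 2 $ 3"
  have hom: "?\<phi> \<in> hom (UG\<lparr>carrier := Q\<rparr>) additive_group"
    by (rule entry_hom(2)[OF Q(1,2)]) (simp add: Q_def unit_group_def)
  have "\<alpha> \<in> ?\<phi> ` Q" for \<alpha>
  proof -
    obtain \<beta> where "unip \<alpha> \<beta> \<in> carrier UG" using unip_exists by blast
    then have "unip \<alpha> \<beta> \<in> stab e1" by (rule unip_stab)
    then have "unip \<alpha> \<beta> \<in> Q" by (simp add: Q_def unip_def unit_group_def)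
    then show ?thesis by (rule rev_image_eqI) (simp add: unip_def)
  qed
  then have surj: "?\<phi> ` carrier (UG\<lparr>carrier := Q\<rparr>) = carrier additive_group"
    by (auto simp: additive_group_def)
  have mf: "min_factorisable additive_group (carrier (additive_group :: 'a monoid))"
    by (rule min_factorisable_comm_group[OF comm_group_additive_group]) simp
  obtain U where U: "U \<subseteq> Q" "min_factorisable (UG\<lparr>carrier := Q\<rparr>) U"
      "bij_betw ?\<phi> U (carrier additive_group)"
    using min_factorisable_lift[OF subgroup.subgroup_is_group[OF Q(1) group_UG]
        comm_group.axioms(2)[OF comm_group_additive_group] hom surj mf] by auto
  have "min_factorisable UG U" using U(2) Q(3) by (rule min_factorisable_mono)
  then show ?thesis using U(1,3) by (intro exI[of _ U]) (auto simp: Q_def unit_group_def additive_group_def)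
qed

text \<open>A concrete instance of Witt's theorem: a vector of nonzero norm is scaled to norm 1 and
  completed by a hyperbolic pair.\<close>

lemma non_isotropic_point_in_orbit:
  assumes "x + cj x \<noteq> 0"
  shows "\<exists>A\<in>carrier UG. line (A *v e2) = line (vec3 x 0 1)"
proof -
  obtain m where m: "m * cj m = inverse (x + cj x)"
    using norm_surj[of "inverse (x + cj x)"] by (auto simp: add.commute)
  have m1: "m * cj m * x + m * cj m * cj x = 1" and m0: "m \<noteq> 0"
    using m assms by (auto simp flip: distrib_left)
  \<comment> \<open>The middle column is \<open>cj m *s vec3 x 0 1\<close>, of norm 1. The vector
    \<open>w = vec3 (- m * cj x) 0 m\<close> has norm -1 and is orthogonal to that column and to
    \<open>e2\<close>; the outer columns are \<open>e2 + w\<close> and \<open>(e2 - w) / 2\<close>.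
    Using \<open>m\<close> in \<open>w\<close> but \<open>cj m\<close> in the middle makes the
    determinant 1.\<close>
  define A where "A = mat3 (- m * cj x) (cj m * x) (m * cj x / 2) 1 0 (1 / 2) m (cj m) (- m / 2)"
  have "A \<in> carrier UG"
    by (rule UG_I) (use m1 in \<open>simp_all add: A_def det_3 hform_def matrix_vector_mult_nth field_simps\<close>)
  moreover have "line (A *v e2) = line (vec3 x 0 1)"
    unfolding line_eq_iff using m0
    by (intro exI[of _ "inverse (cj m)"]) (simp add: A_def vec3_eq_iff matrix_vector_mult_nth)
  ultimately show ?thesis by blast
qed

text \<open>In an orthonormal basis of the plane spanned by \<open>e1\<close> and \<open>e3\<close>, extended by \<open>e2\<close>, this is the
  diagonal matrix with entries \<open>a\<close>, \<open>1\<close> and \<open>1 / a\<close>.\<close>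

definition rot :: "'a \<Rightarrow> 'a ^3^3" where
  "rot a = mat3 ((a + 1) / 2) 0 ((a - 1) / 4) 0 (inverse a) 0 (a - 1) 0 ((a + 1) / 2)"

lemma four_neq_0 [simp]: "(4 :: 'a) \<noteq> 0"
  using no_zero_divisors[OF two_neq_0 two_neq_0] by simp

lemma eight_neq_0 [simp]: "(8 :: 'a) \<noteq> 0"
  using no_zero_divisors[OF two_neq_0 four_neq_0] by simp

lemma sixteen_neq_0 [simp]: "(16 :: 'a) \<noteq> 0"
  using no_zero_divisors[OF four_neq_0 four_neq_0] by simp

lemma sixty_four_neq_0 [simp]: "(64 :: 'a) \<noteq> 0"
  using no_zero_divisors[OF four_neq_0 sixteen_neq_0] by simp

lemma rot_in_UG:
  assumes "a * cj a = 1"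
  shows "rot a \<in> carrier UG"
proof -
  have a: "a \<noteq> 0" using assms by auto
  then have cj: "cj a = inverse a" using assms by (simp add: inverse_unique)
  show ?thesis
    by (rule UG_I) (use a in \<open>simp_all add: rot_def det_3 hform_def matrix_vector_mult_nth cj field_simps\<close>)
qed

lemma rot_stab:
  assumes "a * cj a = 1"
  shows "rot a \<in> stab e2"
proof -
  have "a \<noteq> 0" using assms by auto
  then have "line (rot a *v e2) = line e2"
    unfolding line_eq_iff by (intro exI[of _ a]) (simp add: rot_def vec3_eq_iff matrix_vector_mult_nth)
  then show ?thesis using rot_in_UG[OF assms] by (simp add: stab_def)
qed

lemma rot_mult: "a \<noteq> 0 \<Longrightarrow> b \<noteq> 0 \<Longrightarrow> rot a ** rot b = rot (a * b)"
  unfolding vec_eq_iff forall_3 by (simp add: rot_def matrix_matrix_mult_nth field_simps)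

lemma rot_1: "rot 1 = mat 1"
  unfolding vec_eq_iff forall_3 by (simp add: rot_def mat_def)

lemma min_factorisable_rot: "min_factorisable UG (rot ` {a. a * cj a = 1})" (is "min_factorisable UG ?R")
proof -
  have nz: "a \<noteq> 0" if "a * cj a = 1" for a using that by auto
  have sub: "?R \<subseteq> carrier UG" using rot_in_UG by auto
  have R: "subgroup ?R UG"
  proof (rule UG.subgroupI[OF sub])
    show "?R \<noteq> {}" by (auto intro: exI[of _ 1])
    fix A assume "A \<in> ?R"
    then obtain a where a: "A = rot a" "a * cj a = 1" by auto
    have "inv\<^bsub>UG\<^esub> A = rot (inverse a)"
    proof (rule UG.inv_equality)
      show "rot (inverse a) \<otimes>\<^bsub>UG\<^esub> A = \<one>\<^bsub>UG\<^esub>" using a nz[OF a(2)] by (simp add: rot_mult rot_1)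
    qed (use a in \<open>auto intro!: rot_in_UG simp flip: inverse_mult_distrib\<close>)
    then show "inv\<^bsub>UG\<^esub> A \<in> ?R" using a by (auto intro!: imageI simp flip: inverse_mult_distrib)
    fix B assume "B \<in> ?R"
    then obtain b where b: "B = rot b" "b * cj b = 1" by auto
    have "a * b * cj (a * b) = 1" using a b by (simp add: algebra_simps) (metis a(2) b(2) mult.assoc mult.left_neutral mult.commute)
    then show "A \<otimes>\<^bsub>UG\<^esub> B \<in> ?R" using a b nz by (auto simp: rot_mult)
  qed
  have "comm_group (UG\<lparr>carrier := ?R\<rparr>)"
    by (rule group.group_comm_groupI[OF subgroup.subgroup_is_group[OF R group_UG]])
       (auto simp: rot_mult nz mult.commute)
  then have "min_factorisable (UG\<lparr>carrier := ?R\<rparr>) ?R"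
    using min_factorisable_comm_group[of "UG\<lparr>carrier := ?R\<rparr>"] by simp
  then show ?thesis using sub by (rule min_factorisable_mono)
qed

lemma rot_e1: "rot a *v e1 = vec3 ((a + 1) / 2) 0 (a - 1)"
  by (simp add: rot_def vec3_eq_iff matrix_vector_mult_nth)

text \<open>A Cayley transform. In the coordinate \<open>t = x / z\<close> the isotropic points
  satisfy \<open>cj t = - t\<close>, while \<open>rot a\<close> sends \<open>e1\<close> to the
  coordinate \<open>(a + 1) / (2 * (a - 1))\<close>. Solving for \<open>a\<close> gives the witness
  below, and \<open>a = 1\<close> belongs to \<open>z = 0\<close>.\<close>

lemma rot_regular:
  assumes "x \<noteq> 0 \<or> z \<noteq> 0" "x * cj z + z * cj x = 0"
  shows "\<exists>!a. a * cj a = 1 \<and> line (rot a *v e1) = line (vec3 x 0 z)"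
proof (rule ex_ex1I)
  show "\<exists>a. a * cj a = 1 \<and> line (rot a *v e1) = line (vec3 x 0 z)"
  proof (cases "z = 0")
    case True
    then show ?thesis using assms(1)
      by (intro exI[of _ 1]) (auto simp: rot_e1 line_eq_iff vec3_eq_iff)
  next
    case False
    define t where "t = x / z"
    have cj_t: "cj t = - t" using False assms(2) by (simp add: t_def field_simps eq_neg_iff_add_eq_0)
    \<comment> \<open>Otherwise \<open>2 * t\<close> would be 1 or -1, which \<open>cj\<close>
      fixes, whereas it negates \<open>t\<close>.\<close>
    have nz: "2 * t + 1 \<noteq> 0" "2 * t - 1 \<noteq> 0"
    proof -
      show "2 * t + 1 \<noteq> 0"
      proof
        assume *: "2 * t + 1 = 0"
        moreover have "cj (2 * t + 1) = 1 - 2 * t" by (simp add: cj_t)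
        ultimately have "1 - 2 * t = 0" by (metis cj_0)
        then have "(2 * t + 1) + (1 - 2 * t) = 0" using * by simp
        then show False by simp
      qed
      show "2 * t - 1 \<noteq> 0"
      proof
        assume *: "2 * t - 1 = 0"
        moreover have "cj (2 * t - 1) = - 1 - 2 * t" by (simp add: cj_t)
        ultimately have "- 1 - 2 * t = 0" by (metis cj_0)
        then have "- ((2 * t - 1) + (- 1 - 2 * t)) = 0" using * by simp
        then show False by simp
      qed
    qed
    define a where "a = (2 * t + 1) / (2 * t - 1)"
    have "cj a = (1 - 2 * t) / (- 1 - 2 * t)" by (simp add: a_def cj_t)
    also have "\<dots> = (- (2 * t - 1)) / (- (2 * t + 1))" by (simp only: minus_diff_eq minus_add_distrib) simp
    finally have cja: "cj a = (2 * t - 1) / (2 * t + 1)" by (simp only: minus_divide_divide)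
    have "a * cj a = 1" unfolding cja unfolding a_def using nz by simp
    moreover have "line (rot a *v e1) = line (vec3 x 0 z)"
    proof -
      have "a + 1 = 4 * t / (2 * t - 1)" "a - 1 = 2 / (2 * t - 1)" using nz by (simp_all add: a_def field_simps)
      then show ?thesis unfolding rot_e1 line_eq_iff using nz False
        by (intro exI[of _ "z * (2 * t - 1) / 2"]) (auto simp: vec3_eq_iff t_def)
    qed
    ultimately show ?thesis by blast
  qed
next
  fix a b
  assume "a * cj a = 1 \<and> line (rot a *v e1) = line (vec3 x 0 z)"
    "b * cj b = 1 \<and> line (rot b *v e1) = line (vec3 x 0 z)"
  then have "line (rot a *v e1) = line (rot b *v e1)" by simp
  then obtain c where c: "(b + 1) / 2 = c * ((a + 1) / 2)" "b - 1 = c * (a - 1)"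
    unfolding rot_e1 line_eq_iff by (auto simp: vec3_eq_iff)
  have "b + 1 = 2 * ((b + 1) / 2)" by simp
  also have "\<dots> = c * (a + 1)" unfolding c(1) by simp
  finally have "b + 1 = c * (a + 1)" .
  then have "(b + 1) * (a - 1) = (b - 1) * (a + 1)" using c(2) by simp
  then have "2 * (a - b) = 0" by (simp add: algebra_simps)
  then show "a = b" by simp
qed

lemma min_factorisable_stab_e2: "min_factorisable UG (stab e2)"
proof -
  let ?R = "rot ` {a. a * cj a = 1}" and ?K = "stab e2 \<inter> stab e1"
  have K: "subgroup ?K UG" by (rule UG.subgroups_Inter_pair[OF subgroup_stab subgroup_stab])
  show ?thesis
  proof (rule min_factorisable_transversal[OF group_UG min_factorisable_rot _ finite_UG K subgroup_stab])
    show "min_factorisable UG ?K" by (rule min_factorisable_borel[OF K]) simp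
    show "?R \<subseteq> stab e2" using rot_stab by auto
    show "?K \<subseteq> stab e2" by simp
    fix g assume g: "g \<in> stab e2"
    then have gU: "g \<in> carrier UG" by (simp add: stab_def)
    have "line e2 = line (g *v e2)" using g by (simp add: stab_def)
    then obtain c where c: "c \<noteq> 0" "g *v e2 = c *s e2" unfolding line_eq_iff by blast
    \<comment> \<open>Fixing the point \<open>e2\<close>, the element \<open>g\<close> preserves its
      orthogonal complement, so \<open>y\<close> is an isotropic vector with middle coordinate zero,
      as \<open>rot_regular\<close> requires.\<close>
    define y where "y = g *v e1"
    have "hform y (g *v e2) = 0" "hform y y = 0"
      using hform_UG[OF gU] by (simp_all add: y_def hform_def)
    then have y2: "y $ 2 = 0" and y13: "y $ 1 * cj (y $ 3) + y $ 3 * cj (y $ 1) = 0"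
      using c by (auto simp: hform_def)
    have "e1 \<noteq> 0" by (simp add: vec3_eq_iff)
    then have "y \<noteq> 0" using gU by (simp add: y_def)
    then have y0: "y $ 1 \<noteq> 0 \<or> y $ 3 \<noteq> 0" using y2 by (simp add: vec3_eq_iff)
    have y: "y = vec3 (y $ 1) 0 (y $ 3)" using y2 by (simp add: vec3_eq_iff)
    have iff: "inv\<^bsub>UG\<^esub> (rot a) \<otimes>\<^bsub>UG\<^esub> g \<in> ?K \<longleftrightarrow> line (rot a *v e1) = line y" if "a * cj a = 1" for a
    proof -
      have "inv\<^bsub>UG\<^esub> (rot a) \<otimes>\<^bsub>UG\<^esub> g \<in> stab e2"
        using g rot_stab[OF that] subgroup.m_closed[OF subgroup_stab] subgroup.m_inv_closed[OF subgroup_stab] by blast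
      then show ?thesis using inv_mult_stab_iff[OF rot_in_UG[OF that] gU, of e1] by (simp add: y_def)
    qed
    obtain a where a: "a * cj a = 1" "line (rot a *v e1) = line y"
        and unique: "\<And>b. b * cj b = 1 \<Longrightarrow> line (rot b *v e1) = line y \<Longrightarrow> b = a"
      using rot_regular[OF y0 y13] y by metis
    show "\<exists>!s. s \<in> ?R \<and> inv\<^bsub>UG\<^esub> s \<otimes>\<^bsub>UG\<^esub> g \<in> ?K"
    proof (rule ex1I[of _ "rot a"])
      show "rot a \<in> ?R \<and> inv\<^bsub>UG\<^esub> (rot a) \<otimes>\<^bsub>UG\<^esub> g \<in> ?K" using a iff by blast
      fix s assume "s \<in> ?R \<and> inv\<^bsub>UG\<^esub> s \<otimes>\<^bsub>UG\<^esub> g \<in> ?K"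
      then show "s = rot a" using iff unique by blast
    qed
  qed
qed

text \<open>The entry at (2,3) can be read off from either image, so that translates by elements
  with different entries cannot overlap.\<close>

lemma unipotent_affine:
  assumes "A \<in> stab e1" "A $ 1 $ 1 = 1"
  shows "A *v vec3 x 0 1 = vec3 (x + A $ 1 $ 3) (A $ 2 $ 3) 1" "A *v e2 = vec3 (- cj (A $ 2 $ 3)) 1 0"
  using stab_e1_entries[OF assms(1)] unipotent_entries[OF assms] assms(2)
  by (simp_all add: vec3_eq_iff matrix_vector_mult_nth)

theorem min_factorisable_UG_prime:
  assumes "prime (q ^ 2 - q + 1)"
  shows "min_factorisable UG (carrier UG)"
proof -
  obtain U where U: "U \<subseteq> {A\<in>stab e1. A $ 1 $ 1 = 1}" "min_factorisable UG U"
      "bij_betw (\<lambda>A. A $ 2 $ 3) U UNIV"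
    using unipotent_transversal by blast
  have UG: "U \<subseteq> carrier UG" using U(1) by (auto simp: stab_def)
  have inj_U: "A = B" if "A \<in> U" "B \<in> U" "A $ 2 $ 3 = B $ 2 $ 3" for A B
    by (rule inj_onD[OF bij_betw_imp_inj_on[OF U(3)] that(3,1,2)])
  have ex_U: "\<exists>A\<in>U. A $ 2 $ 3 = \<alpha>" for \<alpha>
  proof -
    have "\<alpha> \<in> (\<lambda>A. A $ 2 $ 3) ` U" using bij_betw_imp_surj_on[OF U(3)] by simp
    then show ?thesis by auto
  qed
  define D where "D = {x. x + cj x \<noteq> 0}"
  have "\<forall>x\<in>D. \<exists>A. A \<in> carrier UG \<and> line (A *v e2) = line (vec3 x 0 1)"
    using non_isotropic_point_in_orbit unfolding D_def by blast
  from bchoice[OF this] obtain k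
    where k: "\<And>x. x \<in> D \<Longrightarrow> k x \<in> carrier UG \<and> line (k x *v e2) = line (vec3 x 0 1)" by blast
  \<comment> \<open>Base points of the tiling: \<open>e2\<close> itself on the line at infinity, and
    the \<open>q^2 - q\<close> non-isotropic points \<open>vec3 x 0 1\<close>.\<close>
  define Xs where "Xs = insert (mat 1) (k ` D)"
  have XG: "Xs \<subseteq> carrier UG" using k UG.one_closed unfolding Xs_def by auto
  have inj_k: "inj_on k D"
  proof (rule inj_onI)
    fix x y assume "x \<in> D" "y \<in> D" "k x = k y"
    then show "x = y" using k line_vec3_eq_iff(1) by metis
  qed
  have not: "mat 1 \<notin> k ` D"
  proof
    assume "mat 1 \<in> k ` D"
    then obtain x where x: "x \<in> D" "k x = mat 1" by auto
    then have "line (mat 1 *v e2) = line (vec3 x 0 1)" using k by metis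
    then show False using line_vec3_eq_iff(3) by simp
  qed
  have "D = UNIV - {x. x + cj x = 0}" by (auto simp: D_def)
  then have "card D = q ^ 2 - q" using trace_fibre(2)[of 0] by (simp add: card_Diff_subset card_field)
  then have "card Xs = q ^ 2 - q + 1" using inj_k not by (simp add: Xs_def card_image)
  then have Xs: "min_factorisable UG Xs" "card Xs > 0"
    using assms XG by (auto intro!: min_factorisable_prime_card[OF group_UG] simp: prime_gt_0_nat)
  have UX1: "line ((A ** mat 1) *v e2) = line (vec3 (- cj (A $ 2 $ 3)) 1 0)" if "A \<in> U" for A
    using unipotent_affine(2)[of A] that U(1) by auto
  have UXk: "line ((A ** k x) *v e2) = line (vec3 (x + A $ 1 $ 3) (A $ 2 $ 3) 1)" if "A \<in> U" "x \<in> D" for A x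
  proof -
    have "line ((A ** k x) *v e2) = line (A *v vec3 x 0 1)"
      using line_mult_eq_iff[of A "k x *v e2" "vec3 x 0 1"] that UG k
      by (auto simp: matrix_vector_mul_assoc[symmetric])
    then show ?thesis using unipotent_affine(1)[of A x] that U(1) by auto
  qed
  have inj: "A = B \<and> C = C'"
    if *: "A \<in> U" "B \<in> U" "C \<in> Xs" "C' \<in> Xs" "line ((A ** C) *v e2) = line ((B ** C') *v e2)" for A B C C'
  proof (cases "C = mat 1")
    case C: True
    show ?thesis
    proof (cases "C' = mat 1")
      case True
      then show ?thesis using * C UX1[of A] UX1[of B] inj_U[of A B] line_vec3_eq_iff(2) by simp
    next
      case False
      then obtain x where "x \<in> D" "C' = k x" using *(4) Xs_def by auto
      then show ?thesis using * C UX1[of A] UXk[of B x] line_vec3_eq_iff(3) by metis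
    qed
  next
    case False
    then obtain x where x: "x \<in> D" "C = k x" using *(3) Xs_def by auto
    show ?thesis
    proof (cases "C' = mat 1")
      case True
      then show ?thesis using * x UX1[of B] UXk[of A x] line_vec3_eq_iff(4) by metis
    next
      case False
      then obtain y where y: "y \<in> D" "C' = k y" using *(4) Xs_def by auto
      have "x + A $ 1 $ 3 = y + B $ 1 $ 3" "A $ 2 $ 3 = B $ 2 $ 3"
        using * x y UXk[of A x] UXk[of B y] line_vec3_eq_iff(1) by metis+
      then have "A = B" using inj_U * by blast
      then show ?thesis using x y \<open>x + A $ 1 $ 3 = y + B $ 1 $ 3\<close> by simp
    qed
  qed
  have surj: "\<exists>A\<in>U. \<exists>C\<in>Xs. line ((A ** C) *v e2) = line (g *v e2)" if g: "g \<in> carrier UG" for g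
  proof -
    define y where "y = g *v e2"
    have hy: "hform y y = 1" using hform_UG[OF g, of e2 e2] by (simp add: y_def hform_def)
    show ?thesis
    proof (cases "y $ 3 = 0")
      case True
      then have y2: "y $ 2 \<noteq> 0" using hy by (auto simp: hform_def)
      obtain A where "A \<in> U" "A $ 2 $ 3 = - cj (y $ 1 / y $ 2)" using ex_U by blast
      then have "line ((A ** mat 1) *v e2) = line y"
        using UX1[of A] line_at_infinity[OF True y2] by simp
      then show ?thesis using \<open>A \<in> U\<close> by (auto simp: Xs_def y_def)
    next
      case False
      obtain A where A: "A \<in> U" "A $ 2 $ 3 = y $ 2 / y $ 3" using ex_U by blast
      \<comment> \<open>The first coordinate before translation by \<open>A\<close>. Its trace
        \<open>x + cj x\<close> is the norm of a nonzero multiple of \<open>y\<close>, hence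
        nonzero.\<close>
      define x where "x = y $ 1 / y $ 3 - A $ 1 $ 3"
      have Ax: "A *v vec3 x 0 1 = inverse (y $ 3) *s y"
        using unipotent_affine(1)[of A x] A U(1) False
        by (auto simp: x_def vec3_eq_iff field_simps)
      have "x + cj x = hform (vec3 x 0 1) (vec3 x 0 1)" by (simp add: hform_def)
      also have "\<dots> = hform (A *v vec3 x 0 1) (A *v vec3 x 0 1)" using hform_UG[of A] A UG by auto
      also have "\<dots> \<noteq> 0" unfolding Ax hform_scale hy using False by simp
      finally have x: "x \<in> D" by (simp add: D_def)
      then have "line ((A ** k x) *v e2) = line y"
        using UXk[OF A(1) x] A(2) line_affine[OF False] by (simp add: x_def)
      then show ?thesis using A x by (auto simp: Xs_def y_def)
    qed
  qed
  define S where "S = (\<lambda>(A, C). A \<otimes>\<^bsub>UG\<^esub> C) ` (U \<times> Xs)"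
  have "card U > 0" using bij_betw_same_card[OF U(3)] by (simp add: card_gt_0_iff)
  moreover have "inj_on (\<lambda>(A, C). A \<otimes>\<^bsub>UG\<^esub> C) (U \<times> Xs)"
    by (rule inj_onI) (use inj in auto)
  ultimately have S: "min_factorisable UG S"
    unfolding S_def by (intro min_factorisable_mult[OF group_UG U(2) Xs(1) _ Xs(2)])
  have SG: "S \<subseteq> carrier UG" by (rule min_factorisable_subset[OF group_UG S])
  show ?thesis
  proof (rule min_factorisable_transversal[OF group_UG S min_factorisable_stab_e2 finite_UG
        subgroup_stab UG.subgroup_self SG subgroup.subset[OF subgroup_stab]])
    fix g assume g: "g \<in> carrier UG"
    then obtain A C where AC: "A \<in> U" "C \<in> Xs" "line ((A ** C) *v e2) = line (g *v e2)" using surj by blast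
    show "\<exists>!s. s \<in> S \<and> inv\<^bsub>UG\<^esub> s \<otimes>\<^bsub>UG\<^esub> g \<in> stab e2"
    proof (rule ex1I[of _ "A ** C"])
      have "A ** C \<in> S" using AC unfolding S_def by force
      then show "A ** C \<in> S \<and> inv\<^bsub>UG\<^esub> (A ** C) \<otimes>\<^bsub>UG\<^esub> g \<in> stab e2"
        using inv_mult_stab_iff[of "A ** C" g e2] SG g AC(3) by blast
      fix s assume s: "s \<in> S \<and> inv\<^bsub>UG\<^esub> s \<otimes>\<^bsub>UG\<^esub> g \<in> stab e2"
      then obtain B C' where B: "B \<in> U" "C' \<in> Xs" "s = B ** C'" unfolding S_def by auto
      have "line (s *v e2) = line (g *v e2)" using inv_mult_stab_iff[of s g e2] SG g s by blast
      then show "s = A ** C" using inj[of A B C C'] AC B by simp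
    qed
  qed
qed

end

section \<open>Two-transitive actions and matchings of blocks\<close>

text \<open>Equidistribution in a division-free form. Requiring an inequality for all ordered pairs
  of fibres gives equality by exchanging them.\<close>

lemma card_equal_fibres:
  assumes fin: "finite C" "finite Y" and f: "f ` C \<subseteq> Y" and P: "P \<subseteq> Y"
    and eq: "\<And>y z. y \<in> Y \<Longrightarrow> z \<in> Y \<Longrightarrow> card {g\<in>C. f g = y} \<le> card {g\<in>C. f g = z}"
  shows "card {g\<in>C. f g \<in> P} * card Y = card P * card C"
proof (cases "Y = {}")
  case True
  then show ?thesis using f P by auto
next
  case False
  then obtain y where y: "y \<in> Y" by blast
  have fibre: "card {g\<in>C. f g = z} = card {g\<in>C. f g = y}" if "z \<in> Y" for z
    using eq[OF that y] eq[OF y that] by simp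
  have count: "card {g\<in>C. f g \<in> Q} = card Q * card {g\<in>C. f g = y}" if Q: "Q \<subseteq> Y" for Q
  proof -
    have "finite Q" using Q fin(2) by (rule finite_subset)
    then have "card {g\<in>C. f g \<in> Q} = (\<Sum>z\<in>Q. card {g\<in>{g\<in>C. f g \<in> Q}. f g = z})"
      using sum.group[of "{g\<in>C. f g \<in> Q}" Q f "\<lambda>_. 1 :: nat"] fin(1) by (simp add: image_subset_iff)
    also have "\<dots> = (\<Sum>z\<in>Q. card {g\<in>C. f g = y})"
    proof (rule sum.cong[OF refl])
      fix z assume z: "z \<in> Q"
      then have "{g\<in>{g\<in>C. f g \<in> Q}. f g = z} = {g\<in>C. f g = z}" by auto
      then show "card {g\<in>{g\<in>C. f g \<in> Q}. f g = z} = card {g\<in>C. f g = y}" using fibre z Q by auto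
    qed
    finally show ?thesis by simp
  qed
  have "{g\<in>C. f g \<in> Y} = C" using f by auto
  then show ?thesis using count[OF P] count[OF order_refl] by simp
qed

lemma card_distinct_pairs:
  assumes "finite S"
  shows "card {(x, y)\<in>S \<times> S. x \<noteq> y} = card S * (card S - 1)"
proof -
  have "{(x, y)\<in>S \<times> S. x \<noteq> y} = S \<times> S - (\<lambda>x. (x, x)) ` S" by auto
  moreover have "card ((\<lambda>x. (x, x)) ` S) = card S" by (rule card_image) (auto intro: inj_onI)
  ultimately show ?thesis
    using assms by (simp add: card_Diff_subset image_subset_iff card_cartesian_product diff_mult_distrib2)
qed

locale two_transitive_action = group G for G (structure) +
  fixes act :: "'a \<Rightarrow> 'w \<Rightarrow> 'w" and \<Omega> :: "'w set"
  assumes fin_G: "finite (carrier G)" and fin_\<Omega>: "finite \<Omega>"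
    and act_closed: "\<And>g x. g \<in> carrier G \<Longrightarrow> x \<in> \<Omega> \<Longrightarrow> act g x \<in> \<Omega>"
    and act_mult: "\<And>g h x. g \<in> carrier G \<Longrightarrow> h \<in> carrier G \<Longrightarrow> x \<in> \<Omega> \<Longrightarrow> act (g \<otimes> h) x = act g (act h x)"
    and act_one: "\<And>x. x \<in> \<Omega> \<Longrightarrow> act \<one> x = x"
    and two_transitive: "\<And>x y x' y'. x \<in> \<Omega> \<Longrightarrow> y \<in> \<Omega> \<Longrightarrow> x \<noteq> y \<Longrightarrow>
        x' \<in> \<Omega> \<Longrightarrow> y' \<in> \<Omega> \<Longrightarrow> x' \<noteq> y' \<Longrightarrow> \<exists>g\<in>carrier G. act g x = x' \<and> act g y = y'"
    and card_\<Omega>: "card \<Omega> > 1"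
begin

lemma act_inj: "g \<in> carrier G \<Longrightarrow> x \<in> \<Omega> \<Longrightarrow> y \<in> \<Omega> \<Longrightarrow> act g x = act g y \<Longrightarrow> x = y"
  by (metis act_mult act_one inv_closed l_inv)

lemma transitive:
  assumes "x \<in> \<Omega>" "x' \<in> \<Omega>"
  shows "\<exists>g\<in>carrier G. act g x = x'"
proof -
  have other: "\<exists>y\<in>\<Omega>. y \<noteq> z" for z
  proof (rule ccontr)
    assume "\<not> ?thesis"
    then have "card \<Omega> \<le> card {z}" by (intro card_mono) auto
    then show False using card_\<Omega> by simp
  qed
  obtain y y' where y: "y \<in> \<Omega>" "y \<noteq> x" "y' \<in> \<Omega>" "y' \<noteq> x'" using other[of x] other[of x'] by blast
  show ?thesis using two_transitive[OF assms(1) y(1) y(2)[symmetric] assms(2) y(3) y(4)[symmetric]] by blast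
qed

text \<open>Left multiplication by an element taking \<open>y\<close> to \<open>z\<close> injects
  the fibre over \<open>y\<close> into the fibre over \<open>z\<close>, so the images of
  \<open>x\<close> are equidistributed.\<close>

lemma card_act_in:
  assumes x: "x \<in> \<Omega>" and P: "P \<subseteq> \<Omega>"
  shows "card {g\<in>carrier G. act g x \<in> P} * card \<Omega> = card P * card (carrier G)"
proof (rule card_equal_fibres[OF fin_G fin_\<Omega> _ P])
  show "(\<lambda>g. act g x) ` carrier G \<subseteq> \<Omega>" using act_closed x by auto
  fix y z assume "y \<in> \<Omega>" "z \<in> \<Omega>"
  then obtain a where a: "a \<in> carrier G" "act a y = z" using transitive by blast
  show "card {g\<in>carrier G. act g x = y} \<le> card {g\<in>carrier G. act g x = z}"
  proof (rule card_inj_on_le)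
    show "inj_on (\<lambda>g. a \<otimes> g) {g\<in>carrier G. act g x = y}" 
      by (rule inj_on_subset[OF inj_on_cmult[OF a(1)]]) auto
    show "(\<lambda>g. a \<otimes> g) ` {g\<in>carrier G. act g x = y} \<subseteq> {g\<in>carrier G. act g x = z}"
      using a x by (auto simp: act_mult)
  qed (use fin_G in auto)
qed

text \<open>The same argument on ordered pairs of distinct points, where transitivity is the
  two-transitivity of the action.\<close>

lemma card_act_pair_in:
  assumes x: "x \<in> \<Omega>" "y \<in> \<Omega>" "x \<noteq> y" and P: "P \<subseteq> \<Omega>"
  shows "card {g\<in>carrier G. act g x \<in> P \<and> act g y \<in> P} * (card \<Omega> * (card \<Omega> - 1))
    = card P * (card P - 1) * card (carrier G)"
proof -
  let ?D = "\<lambda>S. {(x, y)\<in>S \<times> S. x \<noteq> y}" and ?f = "\<lambda>g. (act g x, act g y)"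
  have fin_P: "finite P" using P fin_\<Omega> by (rule finite_subset)
  have "card {g\<in>carrier G. ?f g \<in> ?D P} * card (?D \<Omega>) = card (?D P) * card (carrier G)"
  proof (rule card_equal_fibres[OF fin_G])
    show "finite (?D \<Omega>)" using fin_\<Omega> by (auto intro: finite_subset[of _ "\<Omega> \<times> \<Omega>"])
    show "?f ` carrier G \<subseteq> ?D \<Omega>" using act_closed act_inj x by auto
    show "?D P \<subseteq> ?D \<Omega>" using P by auto
    fix u v assume "u \<in> ?D \<Omega>" "v \<in> ?D \<Omega>"
    then obtain a where a: "a \<in> carrier G" "act a (fst u) = fst v" "act a (snd u) = snd v"
      using two_transitive[of "fst u" "snd u" "fst v" "snd v"] by auto
    show "card {g\<in>carrier G. ?f g = u} \<le> card {g\<in>carrier G. ?f g = v}"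
    proof (rule card_inj_on_le)
      show "inj_on (\<lambda>g. a \<otimes> g) {g\<in>carrier G. ?f g = u}" 
      by (rule inj_on_subset[OF inj_on_cmult[OF a(1)]]) auto
      show "(\<lambda>g. a \<otimes> g) ` {g\<in>carrier G. ?f g = u} \<subseteq> {g\<in>carrier G. ?f g = v}"
        using a x by (auto simp: act_mult)
    qed (use fin_G in auto)
  qed
  moreover have "{g\<in>carrier G. ?f g \<in> ?D P} = {g\<in>carrier G. act g x \<in> P \<and> act g y \<in> P}"
    using act_inj x by auto
  ultimately show ?thesis by (simp only: card_distinct_pairs[OF fin_\<Omega>] card_distinct_pairs[OF fin_P])
qed

text \<open>Second moment method: \<open>N g\<close>, the number of points of \<open>S\<close> that \<open>g\<close> moves into \<open>T\<close>, satisfies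
  \<open>\<Sum>(1 - c N)^2 = |G| / (q + 1)\<close> for \<open>c = q / r\<close>, and every \<open>g\<close> with \<open>N g = 0\<close> contributes 1.\<close>

lemma card_avoiding_le:
  fixes q r :: nat
  assumes ST: "S \<subseteq> \<Omega>" "T \<subseteq> \<Omega>" "card S = r" "card T = r"
    and q: "q > 0" "r + q = q ^ 2 + 1" and card: "card \<Omega> = (q + 1) * r"
  shows "card {g\<in>carrier G. \<forall>x\<in>S. act g x \<notin> T} * (q + 1) \<le> card (carrier G)"
proof -
  define M where "M = real (card (carrier G))"
  define N where "N = (\<lambda>g. card {x\<in>S. act g x \<in> T})"
  have fin: "finite S" "finite T" using ST fin_\<Omega> by (auto intro: finite_subset)
  have qr: "real q > 0" "real r + real q = real q ^ 2 + 1"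
    using q by (simp, metis of_nat_add of_nat_1 of_nat_power)
  have r: "real r = real q ^ 2 - real q + 1" using qr by simp
  have r0: "real r > 0" using card card_\<Omega> by (cases r) auto
  have r1: "real r - 1 = real q * (real q - 1)" unfolding r by (simp add: power2_eq_square algebra_simps)
  have n: "real (card \<Omega>) = (real q + 1) * real r" by (simp add: card algebra_simps)
  have n1: "real (card \<Omega>) - 1 = real q ^ 3" unfolding n r by (simp add: power2_eq_square power3_eq_cube algebra_simps)
  have single: "real (card {g\<in>carrier G. act g x \<in> T}) = M / (real q + 1)" if "x \<in> S" for x
  proof -
    have "card {g\<in>carrier G. act g x \<in> T} * card \<Omega> = card T * card (carrier G)"
      by (rule card_act_in) (use that ST(1,2) in auto)
    from arg_cong[OF this, of real] have "real (card {g\<in>carrier G. act g x \<in> T}) * real (card \<Omega>) = real r * M"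
      by (simp only: ST(4) M_def of_nat_mult)
    then have "real r * (real (card {g\<in>carrier G. act g x \<in> T}) * (real q + 1)) = real r * M"
      unfolding n by (simp only: mult_ac)
    then have "real (card {g\<in>carrier G. act g x \<in> T}) * (real q + 1) = M" using r0 by simp
    then show ?thesis using qr(1) by (simp add: field_simps)
  qed
  have sum1: "(\<Sum>g\<in>carrier G. real (N g)) = M * (real r / (real q + 1))"
  proof -
    have "(\<Sum>g\<in>carrier G. N g) = (\<Sum>x\<in>S. card {g\<in>carrier G. act g x \<in> T})"
      unfolding N_def using fin fin_G by (rule_tac sum_multicount_gen) auto
    then have "real (\<Sum>g\<in>carrier G. N g) = (\<Sum>x\<in>S. M / (real q + 1))" using single by simp
    then show ?thesis using ST(3) by simp
  qed
  have sum2: "(\<Sum>g\<in>carrier G. real (N g) ^ 2) = M * (real r / (real q + 1) * (real r / real q))"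
  proof -
    \<comment> \<open>The square counts pairs of points of \<open>S\<close> that both land in
      \<open>T\<close>. Diagonal pairs are governed by \<open>single\<close>, the others by
      two-transitivity.\<close>
    have sq: "N g ^ 2 = card {z\<in>S \<times> S. act g (fst z) \<in> T \<and> act g (snd z) \<in> T}" for g
    proof -
      have "{z\<in>S \<times> S. act g (fst z) \<in> T \<and> act g (snd z) \<in> T} = {x\<in>S. act g x \<in> T} \<times> {x\<in>S. act g x \<in> T}"
        by auto
      then show ?thesis by (simp add: N_def card_cartesian_product power2_eq_square)
    qed
    have "(\<Sum>g\<in>carrier G. N g ^ 2)
      = (\<Sum>z\<in>S \<times> S. card {g\<in>carrier G. act g (fst z) \<in> T \<and> act g (snd z) \<in> T})"
      unfolding sq using fin fin_G by (rule_tac sum_multicount_gen) auto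
    then have "(\<Sum>g\<in>carrier G. real (N g) ^ 2)
      = (\<Sum>z\<in>S \<times> S. real (card {g\<in>carrier G. act g (fst z) \<in> T \<and> act g (snd z) \<in> T}))"
      by (simp flip: of_nat_power of_nat_sum)
    also have "\<dots> = (\<Sum>x\<in>S. \<Sum>y\<in>S. real (card {g\<in>carrier G. act g x \<in> T \<and> act g y \<in> T}))"
      by (simp add: sum.cartesian_product case_prod_beta)
    also have "\<dots> = (\<Sum>x\<in>S. M / (real q + 1) * (real r / real q))"
    proof (rule sum.cong[OF refl])
      fix x assume x: "x \<in> S"
      have same: "real (card {g\<in>carrier G. act g x \<in> T \<and> act g x \<in> T}) = M / (real q + 1)"
        using single[OF x] by simp
      have diff: "real (card {g\<in>carrier G. act g x \<in> T \<and> act g y \<in> T})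
          = M * (real r - 1) / ((real q + 1) * real q ^ 3)" if y: "y \<in> S - {x}" for y
      proof -
        have "card {g\<in>carrier G. act g x \<in> T \<and> act g y \<in> T} * (card \<Omega> * (card \<Omega> - 1))
            = card T * (card T - 1) * card (carrier G)"
          by (rule card_act_pair_in) (use x y ST(1,2) in auto)
        from arg_cong[OF this, of real] have "real (card {g\<in>carrier G. act g x \<in> T \<and> act g y \<in> T}) * (real (card \<Omega>) * real (card \<Omega> - 1))
            = real r * real (r - 1) * M"
          by (simp only: ST(4) M_def of_nat_mult)
        moreover have "real (card \<Omega> - 1) = real q ^ 3" using card_\<Omega> n1 by simp
        moreover have "real (r - 1) = real r - 1" using r0 by simp
        ultimately have "real r * (real (card {g\<in>carrier G. act g x \<in> T \<and> act g y \<in> T}) * ((real q + 1) * real q ^ 3))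
            = real r * (M * (real r - 1))"
          unfolding n by (simp only: mult_ac)
        then have "real (card {g\<in>carrier G. act g x \<in> T \<and> act g y \<in> T}) * ((real q + 1) * real q ^ 3)
            = M * (real r - 1)" using r0 by simp
        moreover have "(real q + 1) * real q ^ 3 \<noteq> 0" using qr(1) by simp
        ultimately show ?thesis by (rule iffD2[OF nonzero_eq_divide_eq, rotated])
      qed
      have "(\<Sum>y\<in>S. real (card {g\<in>carrier G. act g x \<in> T \<and> act g y \<in> T}))
        = M / (real q + 1) + (\<Sum>y\<in>S - {x}. M * (real r - 1) / ((real q + 1) * real q ^ 3))"
        using x fin same diff by (subst sum.remove[of S x]) auto
      also have "\<dots> = M / (real q + 1) + (real r - 1) * (M * (real r - 1) / ((real q + 1) * real q ^ 3))"
        using x fin ST(3) r0 by simp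
      also have "(real r - 1) * (M * (real r - 1) / ((real q + 1) * real q ^ 3))
          = M / (real q + 1) * ((real q - 1) ^ 2 / real q)"
        unfolding r1 using qr(1) by (simp add: power2_eq_square power3_eq_cube)
      also have "M / (real q + 1) + M / (real q + 1) * ((real q - 1) ^ 2 / real q)
          = M / (real q + 1) * (1 + (real q - 1) ^ 2 / real q)"
        by (simp only: distrib_left mult_1_right)
      also have "1 + (real q - 1) ^ 2 / real q = real r / real q"
        unfolding r using qr(1) by (simp add: field_simps power2_eq_square)
      finally show "(\<Sum>y\<in>S. real (card {g\<in>carrier G. act g x \<in> T \<and> act g y \<in> T}))
        = M / (real q + 1) * (real r / real q)" .
    qed
    finally show ?thesis using ST(3) by (simp add: field_simps)
  qed
  \<comment> \<open>The mean of \<open>N\<close> divided by the mean of its square, which is the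
    value minimising the sum of squares below.\<close>
  define c where "c = real q / real r"
  let ?bad = "{g\<in>carrier G. \<forall>x\<in>S. act g x \<notin> T}"
  have "N g = 0" if "g \<in> ?bad" for g
  proof -
    have "{x\<in>S. act g x \<in> T} = {}" using that by blast
    then show ?thesis by (simp only: N_def card.empty)
  qed
  then have "real (card ?bad) = (\<Sum>g\<in>?bad. (1 - c * real (N g)) ^ 2)" by simp
  also have "\<dots> \<le> (\<Sum>g\<in>carrier G. (1 - c * real (N g)) ^ 2)"
    using fin_G by (intro sum_mono2) auto
  also have "\<dots> = (\<Sum>g\<in>carrier G. 1 - 2 * c * real (N g) + c ^ 2 * real (N g) ^ 2)"
    by (intro sum.cong refl) (simp add: power2_eq_square algebra_simps)
  also have "\<dots> = M - 2 * c * (\<Sum>g\<in>carrier G. real (N g)) + c ^ 2 * (\<Sum>g\<in>carrier G. real (N g) ^ 2)"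
    by (simp add: sum.distrib sum_subtractf sum_distrib_left M_def)
  also have "\<dots> = M - M * (real q / (real q + 1))"
  proof -
    have "c * (M * (real r / (real q + 1))) = M * (real q / (real q + 1))"
      unfolding c_def using r0 by simp
    moreover have "c ^ 2 * (M * (real r / (real q + 1) * (real r / real q))) = M * (real q / (real q + 1))"
      unfolding c_def using r0 qr(1) by (simp add: power2_eq_square)
    ultimately show ?thesis unfolding sum1 sum2 by linarith
  qed
  also have "\<dots> = M / (real q + 1)" using qr(1) by (simp add: field_simps)
  finally have "real (card ?bad) * (real q + 1) \<le> M" using qr(1) by (simp add: field_simps)
  then have "real (card ?bad * (q + 1)) \<le> real (card (carrier G))" by (simp add: M_def algebra_simps)
  then show ?thesis by (simp only: of_nat_le_iff)
qed

text \<open>The blocks are paired as \<open>b i\<close> and \<open>b (p + i)\<close>. Uniqueness is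
  claimed for the pair in \<open>{\<one>, a} \<times> Y\<close>, not merely for the point it yields,
  because an exact product of sets is wanted later.\<close>

lemma block_matching:
  fixes q r p :: nat and blocks :: "'w set set"
  assumes blocks: "\<And>W. W \<in> blocks \<Longrightarrow> W \<subseteq> \<Omega> \<and> card W = r" "disjoint blocks" "card blocks = 2 * p"
    and q: "q + 1 = 2 * p" "r + q = q ^ 2 + 1" "q > 0" and card: "card \<Omega> = (q + 1) * r"
  obtains a Y where "a \<in> carrier G" "a \<noteq> \<one>" "Y \<subseteq> \<Omega>" "card Y = p"
    "\<forall>W\<in>blocks. \<exists>!z. z \<in> {\<one>, a} \<times> Y \<and> act (fst z) (snd z) \<in> W"
proof -
  have p0: "p > 0" using q by simp
  have fin: "finite blocks" using blocks(3) p0 by (metis card.infinite mult_is_0 less_numeral_extra(3) zero_neq_numeral)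
  obtain b where b: "bij_betw b {..<2 * p} blocks"
    using ex_bij_betw_nat_finite[OF fin] blocks(3) by (auto simp: atLeast0LessThan)
  have b_in: "b i \<in> blocks" if "i < 2 * p" for i using bij_betwE[OF b] that by auto
  have b_eq: "i = j" if "i < 2 * p" "j < 2 * p" "x \<in> b i" "x \<in> b j" for i j x
  proof -
    have "b i = b j" using disjointD[OF blocks(2) b_in[OF that(1)] b_in[OF that(2)]] that(3,4) by blast
    then show ?thesis using inj_onD[OF bij_betw_imp_inj_on[OF b]] that(1,2) by auto
  qed
  define bad where "bad = (\<lambda>i. {g\<in>carrier G. \<forall>x\<in>b i. act g x \<notin> b (p + i)})"
  have bad: "card (bad i) * (2 * p) \<le> card (carrier G)" if "i < p" for i
    unfolding bad_def q(1)[symmetric] using blocks(1)[OF b_in[of i]] blocks(1)[OF b_in[of "p + i"]] that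
    by (intro card_avoiding_le[OF _ _ _ _ q(3,2) card]) auto
  have "card (\<Union>i<p. bad i) * (2 * p) \<le> (\<Sum>i<p. card (bad i)) * (2 * p)"
    by (intro mult_right_mono card_UN_le) auto
  also have "\<dots> = (\<Sum>i<p. card (bad i) * (2 * p))" by (rule sum_distrib_right)
  also have "\<dots> \<le> (\<Sum>i<p. card (carrier G))" by (intro sum_mono bad) auto
  finally have "card (\<Union>i<p. bad i) * 2 \<le> card (carrier G)" using p0 by simp
  moreover have "card (carrier G) > 0" using fin_G by (auto simp: card_gt_0_iff)
  ultimately have "card (\<Union>i<p. bad i) < card (carrier G)" by linarith
  moreover have "(\<Union>i<p. bad i) \<subseteq> carrier G" by (auto simp: bad_def)
  ultimately obtain a where a: "a \<in> carrier G" "a \<notin> (\<Union>i<p. bad i)" by (metis less_irrefl subsetI subset_antisym)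
  then have "\<exists>x. x \<in> b i \<and> act a x \<in> b (p + i)" if "i < p" for i using that by (auto simp: bad_def)
  then obtain y where y: "\<And>i. i < p \<Longrightarrow> y i \<in> b i \<and> act a (y i) \<in> b (p + i)" by metis
  have y\<Omega>: "y i \<in> \<Omega>" if "i < p" for i using blocks(1)[OF b_in[of i]] y[OF that] that by auto
  have inj: "inj_on y {..<p}"
  proof (rule inj_onI)
    fix i j assume "i \<in> {..<p}" "j \<in> {..<p}" "y i = y j"
    then show "i = j" using b_eq[of i j "y i"] y[of i] y[of j] by simp
  qed
  show ?thesis
  proof (rule that[of a "y ` {..<p}"])
    show "a \<in> carrier G" by fact
    \<comment> \<open>Ensures that \<open>{\<one>, a}\<close> has two elements, a prime number.
      Otherwise \<open>y 0\<close> would lie in two blocks.\<close>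
    show neq: "a \<noteq> \<one>"
    proof
      assume "a = \<one>"
      then have "y 0 \<in> b (p + 0)" "y 0 \<in> b 0" using y[OF p0] act_one[OF y\<Omega>[OF p0]] by auto
      then show False using b_eq[of 0 p "y 0"] p0 by simp
    qed
    show "y ` {..<p} \<subseteq> \<Omega>" using y\<Omega> by auto
    show "card (y ` {..<p}) = p" using inj by (simp add: card_image)
    show "\<forall>W\<in>blocks. \<exists>!z. z \<in> {\<one>, a} \<times> y ` {..<p} \<and> act (fst z) (snd z) \<in> W"
    proof
      fix W assume "W \<in> blocks"
      then obtain j where j: "j < 2 * p" "W = b j" using bij_betw_imp_surj_on[OF b] by auto
      \<comment> \<open>The first block of each pair is met through the identity, the second through
        \<open>a\<close>.\<close>
      define z where "z = (if j < p then (\<one>, y j) else (a, y (j - p)))"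
      have uniq: "z' = z" if z': "z' \<in> {\<one>, a} \<times> y ` {..<p}" "act (fst z') (snd z') \<in> W" for z'
      proof -
        obtain i where i: "i < p" "snd z' = y i" using z'(1) by auto
        consider "fst z' = \<one>" | "fst z' = a" using z'(1) by auto
        then show ?thesis
        proof cases
          case 1
          then have "y i \<in> b j" using z'(2) i j act_one[OF y\<Omega>[OF i(1)]] by simp
          then have "i = j" using b_eq[of i j "y i"] y[OF i(1)] i j by simp
          then show ?thesis using 1 i by (simp add: z_def prod_eq_iff)
        next
          case 2
          then have "act a (y i) \<in> b j" using z'(2) i j by simp
          then have "p + i = j" using b_eq[of "p + i" j "act a (y i)"] y[OF i(1)] i j by simp
          then show ?thesis using 2 i by (auto simp: z_def prod_eq_iff)
        qed
      qed
      have "z \<in> {\<one>, a} \<times> y ` {..<p} \<and> act (fst z) (snd z) \<in> W"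
      proof (cases "j < p")
        case True
        then show ?thesis using y[of j] act_one[OF y\<Omega>[of j]] j by (auto simp: z_def)
      next
        case False
        then have "j - p < p" "p + (j - p) = j" using j by auto
        then show ?thesis using y[of "j - p"] j False by (auto simp: z_def)
      qed
      then show "\<exists>!z. z \<in> {\<one>, a} \<times> y ` {..<p} \<and> act (fst z) (snd z) \<in> W"
        by (rule ex1I) (erule conjE, rule uniq)
    qed
  qed
qed

end

section \<open>The action on isotropic points\<close>

context unitary_field
begin

definition isotropic :: "('a ^3) set set" where
  "isotropic = {line x | x. x \<noteq> 0 \<and> hform x x = 0}"

definition act :: "'a ^3^3 \<Rightarrow> ('a ^3) set \<Rightarrow> ('a ^3) set" where
  "act A L = (\<lambda>x. A *v x) ` L"

lemma act_line: "act A (line x) = line (A *v x)"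
proof -
  have line: "line y = (\<lambda>c. c *s y) ` (- {0})" for y :: "'a ^3" by (auto simp: line_def)
  show ?thesis unfolding act_def line image_image by (simp add: vector_scalar_commute)
qed

lemma act_mat_1: "act (mat 1) L = L"
  by (simp add: act_def)

lemma act_matrix_mult: "act (A ** B) L = act A (act B L)"
  by (simp add: act_def image_image matrix_vector_mul_assoc)

lemma act_isotropic:
  assumes "A \<in> carrier UG" "L \<in> isotropic"
  shows "act A L \<in> isotropic"
proof -
  obtain x where x: "L = line x" "x \<noteq> 0" "hform x x = 0" using assms(2) unfolding isotropic_def by blast
  then show ?thesis unfolding isotropic_def using assms(1)
    by (intro CollectI exI[of _ "A *v x"]) (simp add: act_line hform_UG)
qed

lemma isotropic_e1: "line e1 \<in> isotropic"
  unfolding isotropic_def by (intro CollectI exI[of _ e1]) (simp add: vec3_eq_iff hform_def)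

lemma isotropic_affine: "a + cj a + b * cj b = 0 \<Longrightarrow> line (vec3 a b 1) \<in> isotropic"
  unfolding isotropic_def by (intro CollectI exI[of _ "vec3 a b 1"]) (simp add: vec3_eq_iff hform_def add_ac)

lemma isotropic_cases:
  assumes "L \<in> isotropic"
  obtains "L = line e1" | a b where "L = line (vec3 a b 1)" "a + cj a + b * cj b = 0"
proof -
  obtain x where x: "L = line x" "x \<noteq> 0" "hform x x = 0" using assms unfolding isotropic_def by blast
  show ?thesis
  proof (cases "x $ 3 = 0")
    case True
    then have x2: "x $ 2 = 0" using x(3) by (simp add: hform_def)
    then have "x $ 1 \<noteq> 0" using True x(2) by (simp add: vec3_eq_iff)
    then have "line x = line e1" unfolding line_eq_iff using True x2
      by (intro exI[of _ "inverse (x $ 1)"]) (simp add: vec3_eq_iff)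
    then show ?thesis using that(1) x(1) by simp
  next
    case False
    let ?y = "vec3 (x $ 1 / x $ 3) (x $ 2 / x $ 3) 1"
    have y: "?y = inverse (x $ 3) *s x" using False by (simp add: vec3_eq_iff field_simps)
    have "hform ?y ?y = 0" unfolding y hform_scale x(3) by simp
    then have "x $ 1 / x $ 3 + cj (x $ 1 / x $ 3) + (x $ 2 / x $ 3) * cj (x $ 2 / x $ 3) = 0"
      unfolding hform_def by (simp add: add_ac)
    then show ?thesis using that(2) line_affine[OF False] x(1) by simp
  qed
qed

lemma line_e1_neq: "line e1 \<noteq> line (vec3 a b 1)" for a b :: 'a
  by (auto simp: line_eq_iff vec3_eq_iff)

lemma unip_act:
  assumes "a + cj a + b * cj b = 0"
  shows "unip b a \<in> carrier UG" "act (unip b a) (line e1) = line e1" "act (unip b a) (line e3) = line (vec3 a b 1)"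
proof -
  show "unip b a \<in> carrier UG" using assms by (rule unip_in_UG)
  have "unip b a *v e1 = e1" "unip b a *v e3 = vec3 a b 1"
    by (simp_all add: unip_def vec3_eq_iff matrix_vector_mult_nth)
  then show "act (unip b a) (line e1) = line e1" "act (unip b a) (line e3) = line (vec3 a b 1)"
    by (simp_all add: act_line)
qed

lemma weyl_act: "act weyl (line e1) = line e3" "act weyl (line e3) = line e1"
proof -
  have "weyl *v e1 = e3" "weyl *v e3 = e1"
    by (simp_all add: weyl_def vec3_eq_iff matrix_vector_mult_nth)
  then show "act weyl (line e1) = line e3" "act weyl (line e3) = line e1"
    by (simp_all add: act_line)
qed

lemma act_inv:
  assumes "A \<in> carrier UG"
  shows "act (inv\<^bsub>UG\<^esub> A) (act A L) = L" "act A (act (inv\<^bsub>UG\<^esub> A) L) = L"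
  using UG.l_inv[OF assms] UG.r_inv[OF assms] by (simp_all add: act_mat_1 flip: act_matrix_mult)

lemma transitive_isotropic:
  assumes "L \<in> isotropic"
  shows "\<exists>A\<in>carrier UG. act A (line e1) = L"
  using assms
proof (cases rule: isotropic_cases)
  case 1
  then show ?thesis using UG.one_closed act_mat_1 by (metis UG_simps(2))
next
  case (2 a b)
  have "unip b a ** weyl \<in> carrier UG"
    using UG.m_closed[OF unip_act(1)[OF 2(2)] weyl_in_UG] by simp
  then show ?thesis using unip_act(3)[OF 2(2)] 2(1) weyl_act(1) act_matrix_mult by metis
qed

text \<open>Once \<open>L\<close> is moved back to \<open>e1\<close>, unipotent elements fix that
  point and carry \<open>e3\<close> to any other isotropic point.\<close>

lemma two_transitive_isotropic:
  assumes "L \<in> isotropic" "L' \<in> isotropic" "L \<noteq> L'"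
  shows "\<exists>A\<in>carrier UG. act A (line e1) = L \<and> act A (line e3) = L'"
proof -
  obtain A where A: "A \<in> carrier UG" "act A (line e1) = L" using transitive_isotropic[OF assms(1)] by blast
  define K where "K = act (inv\<^bsub>UG\<^esub> A) L'"
  have K: "K \<in> isotropic" using assms(2) A(1) by (simp add: K_def act_isotropic)
  have AK: "act A K = L'" using act_inv(2)[OF A(1)] by (simp add: K_def)
  then have "K \<noteq> line e1" using A(2) assms(3) by auto
  then obtain a b where K': "K = line (vec3 a b 1)" and ab: "a + cj a + b * cj b = 0"
    using isotropic_cases[OF K] by metis
  have "A ** unip b a \<in> carrier UG" using UG.m_closed[OF A(1) unip_act(1)[OF ab]] by simp
  moreover have "act (A ** unip b a) (line e1) = L" "act (A ** unip b a) (line e3) = L'"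
    using unip_act(2,3)[OF ab] A(2) AK K' by (simp_all add: act_matrix_mult)
  ultimately show ?thesis by blast
qed

text \<open>Apart from \<open>e1\<close> there are \<open>q^2\<close> middle coordinates, each
  leaving a trace fibre of size \<open>q\<close> for the first coordinate.\<close>

lemma card_isotropic: "card isotropic = q ^ 3 + 1"
proof -
  define D where "D = (SIGMA b:UNIV. {a. a + cj a = - (b * cj b)})"
  define f where "f = (\<lambda>(b, a). line (vec3 a b (1 :: 'a)))"
  have "isotropic = insert (line e1) (f ` D)"
  proof (intro equalityI subsetI)
    fix L assume "L \<in> isotropic"
    then show "L \<in> insert (line e1) (f ` D)"
    proof (cases rule: isotropic_cases)
      case (2 a b)
      then have "(b, a) \<in> D" by (simp add: D_def eq_neg_iff_add_eq_0)
      then have "f (b, a) \<in> f ` D" by (rule imageI)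
      then show ?thesis using 2(1) by (simp add: f_def)
    qed simp
  next
    fix L assume "L \<in> insert (line e1) (f ` D)"
    then show "L \<in> isotropic"
      using isotropic_e1 isotropic_affine by (auto simp: D_def f_def eq_neg_iff_add_eq_0)
  qed
  moreover have "line e1 \<notin> f ` D" using line_e1_neq by (auto simp: f_def)
  moreover have "inj_on f D" by (auto simp: inj_on_def f_def line_vec3_eq_iff)
  moreover have "card D = (\<Sum>b\<in>UNIV. card {a. a + cj a = - (b * cj b)})"
    unfolding D_def by (rule card_SigmaI) auto
  moreover have "card {a. a + cj a = - (b * cj b)} = q" for b
    by (rule trace_fibre(2)) (simp add: mult.commute)
  ultimately show ?thesis
    by (simp add: card_image card_field power2_eq_square power3_eq_cube)
qed

sublocale isotropic: two_transitive_action UG act isotropic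
proof
  show "finite isotropic" by simp
  show "card isotropic > 1" using q_gt_2 by (simp add: card_isotropic)
  fix K L K' L' :: "('a ^3) set"
  assume "K \<in> isotropic" "L \<in> isotropic" "K \<noteq> L" "K' \<in> isotropic" "L' \<in> isotropic" "K' \<noteq> L'"
  then obtain A B where A: "A \<in> carrier UG" "act A (line e1) = K" "act A (line e3) = L"
    and B: "B \<in> carrier UG" "act B (line e1) = K'" "act B (line e3) = L'"
    using two_transitive_isotropic by metis
  have "B \<otimes>\<^bsub>UG\<^esub> inv\<^bsub>UG\<^esub> A \<in> carrier UG" using A(1) B(1) by (intro UG.m_closed UG.inv_closed)
  moreover have "act (B \<otimes>\<^bsub>UG\<^esub> inv\<^bsub>UG\<^esub> A) K = K'" "act (B \<otimes>\<^bsub>UG\<^esub> inv\<^bsub>UG\<^esub> A) L = L'"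
    using A B act_inv(1)[OF A(1)] by (auto simp: act_matrix_mult)
  ultimately show "\<exists>g\<in>carrier UG. act g K = K' \<and> act g L = L'" by blast
qed (simp_all add: act_isotropic act_matrix_mult act_mat_1)

end

section \<open>A cyclic subgroup of order q^2 - q + 1\<close>

context unitary_field
begin

definition singer :: nat where "singer = q ^ 2 - q + 1"

text \<open>The products equal to \<open>q^3 + 1\<close> and \<open>q^4 + q^2 + 1\<close> yield
  relations between the \<open>q\<close>-power conjugates of a root of unity of order
  \<open>singer\<close>; the equation with \<open>(q + 1) ^ 2\<close> controls the role of the prime
  3.\<close>

lemma singer_eqs: "singer + q = q ^ 2 + 1" "singer = q * (q - 1) + 1" "singer + 3 * q = (q + 1) ^ 2"
  "(q + 1) * singer = q ^ 3 + 1" "(q ^ 2 + q + 1) * singer = q ^ 4 + q ^ 2 + 1" "singer > q"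
proof -
  have "q * 2 \<le> q ^ 2" using q_gt_2 by (simp add: power2_eq_square)
  then show sum: "singer + q = q ^ 2 + 1" and "singer > q" using q_gt_2 by (simp_all add: singer_def)
  show "singer = q * (q - 1) + 1"
    by (simp add: singer_def power2_eq_square diff_mult_distrib2)
  show "singer + 3 * q = (q + 1) ^ 2" using sum by (simp add: power2_eq_square)
  obtain m where m: "q = Suc m" using q_gt_2 by (cases q) auto
  have r: "singer = q * m + 1" using \<open>singer = q * (q - 1) + 1\<close> by (simp add: m)
  show "(q + 1) * singer = q ^ 3 + 1"
    unfolding r unfolding m by (simp add: power3_eq_cube algebra_simps)
  show "(q ^ 2 + q + 1) * singer = q ^ 4 + q ^ 2 + 1"
    unfolding r unfolding m by (simp add: power2_eq_square power4_eq_xxxx algebra_simps)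
qed

text \<open>Modulo a divisor of \<open>q - 1\<close> the number \<open>singer\<close> is 1, and
  modulo a divisor of \<open>q + 1\<close> it is 3.\<close>

lemma coprime_singer:
  assumes "\<not> 3 dvd q + 1"
  shows "coprime singer (q ^ 2 - 1)"
proof (rule ccontr)
  assume "\<not> coprime singer (q ^ 2 - 1)"
  then have "gcd singer (q ^ 2 - 1) \<noteq> 1" by (simp add: coprime_iff_gcd_eq_1)
  then obtain s where "prime s" "s dvd gcd singer (q ^ 2 - 1)" using prime_factor_nat by blast
  then have s: "prime s" "s dvd singer" "s dvd q ^ 2 - 1" by simp_all
  have "q ^ 2 - 1 = (q - 1) * (q + 1)" using q_gt_2 by (simp add: algebra_simps power2_eq_square)
  then have "s dvd q - 1 \<or> s dvd q + 1" using s by (simp only: prime_dvd_mult_iff)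
  then consider "s dvd q - 1" | "s dvd q + 1" by blast
  then show False
  proof cases
    case 1
    then have "s dvd q * (q - 1)" by simp
    then have "s dvd 1" using s(2) unfolding singer_eqs(2) by (simp only: dvd_add_right_iff)
    then show False using s(1) by simp
  next
    case 2
    then have "s dvd (q + 1) ^ 2" unfolding power2_eq_square by (rule dvd_mult2)
    then have "s dvd singer + 3 * q" by (simp only: singer_eqs(3))
    then have "s dvd 3 * q" using s(2) by (simp only: dvd_add_right_iff)
    moreover have "\<not> s dvd q"
    proof
      assume "s dvd q"
      then have "s dvd 1" using 2 by (simp only: dvd_add_right_iff)
      then show False using s(1) by simp
    qed
    ultimately have "s dvd 3" using prime_dvd_mult_iff[OF s(1), of 3 q] by blast
    then have "s = 3" using s(1) primes_dvd_imp_eq[of s 3] by simp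
    then show False using 2 assms by simp
  qed
qed

lemma ac_power_add: "(x + y :: 'a alg_closure) ^ q = x ^ q + y ^ q"
  using q_eq_CHAR_power freshmans_dream'[where ?'a = "'a alg_closure"] by auto

lemma to_ac_cj: "to_ac (cj x) = to_ac x ^ q"
  by (simp add: cj_def)

text \<open>The embedded field already provides \<open>q^2\<close> roots of this equation, as many
  as its degree allows.\<close>

lemma in_range_to_ac:
  fixes x :: "'a alg_closure"
  assumes "x ^ (q ^ 2) = x"
  shows "x \<in> range to_ac"
proof -
  let ?S = "{x :: 'a alg_closure. x ^ (q ^ 2) = x}"
  have q2: "1 < q ^ 2" using q_gt_2 by (intro one_less_power) auto
  have ne: "monom 1 (q ^ 2) - monom 1 1 \<noteq> (0 :: 'a alg_closure poly)"
  proof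
    assume "monom 1 (q ^ 2) - monom 1 1 = (0 :: 'a alg_closure poly)"
    then have "coeff (monom 1 (q ^ 2) - monom 1 1 :: 'a alg_closure poly) 1 = 0" by simp
    then show False using q_gt_2 by simp
  qed
  have "?S = {x. poly (monom 1 (q ^ 2) - monom 1 1) x = 0}" by (simp add: poly_monom)
  then have fin: "finite ?S" using poly_roots_finite[OF ne] by simp
  have "card ?S \<le> q ^ 2"
    by (rule card_le_degree[of "monom 1 (q ^ 2) - monom 1 1"])
       (use q2 in \<open>auto simp: poly_monom degree_monom_eq intro!: degree_diff_le\<close>)
  moreover have "range to_ac \<subseteq> ?S"
    using finite_field_pow_card[where ?'a = 'a] by (auto simp: card_field simp flip: to_ac_power)
  moreover have "card (range (to_ac :: 'a \<Rightarrow> _)) = q ^ 2"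
    by (simp add: card_image inj_to_ac card_field)
  ultimately have "range to_ac = ?S" using fin by (intro card_seteq) auto
  then show ?thesis using assms by auto
qed

text \<open>The conjugates of \<open>c\<close> over the field are \<open>c\<close>,
  \<open>c^(q^2)\<close> and \<open>c^(q^4)\<close>, with product 1. Their \<open>q\<close>-th
  powers are their inverses in another order, so the second symmetric function is the conjugate of
  the trace \<tau>.\<close>

lemma singer_root:
  assumes "\<not> 3 dvd q + 1"
  obtains c :: "'a alg_closure" and \<tau> :: 'a where
    "\<And>t. c ^ t = 1 \<longleftrightarrow> singer dvd t"
    "c ^ 3 - to_ac \<tau> * c ^ 2 + to_ac (cj \<tau>) * c - 1 = 0"
    "\<And>A B C :: 'a. to_ac A + to_ac B * c + to_ac C * c ^ 2 = 0 \<Longrightarrow> A = 0 \<and> B = 0 \<and> C = 0"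
proof -
  \<comment> \<open>\<open>singer\<close> is 1 modulo \<open>q\<close>, hence not divisible by the
    characteristic.\<close>
  have "of_nat singer \<noteq> (0 :: 'a alg_closure)"
  proof
    assume "of_nat singer = (0 :: 'a alg_closure)"
    then have char: "CHAR('a) dvd singer" by (simp add: of_nat_eq_0_iff_char_dvd)
    obtain k where k: "q = CHAR('a) ^ k" using q_eq_CHAR_power(2) by blast
    then have "k \<noteq> 0" using q_gt_2 by (cases k) auto
    then have "CHAR('a) dvd q" using k by (simp add: dvd_power)
    then have "CHAR('a) dvd 1" using char singer_eqs(2) by (metis dvd_add_right_iff dvd_mult2)
    then show False using q_eq_CHAR_power(1) by simp
  qed
  then obtain c :: "'a alg_closure" where c: "\<And>t. c ^ t = 1 \<longleftrightarrow> singer dvd t"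
    using primitive_root_exists by blast
  \<comment> \<open>Even \<open>k\<close> give the conjugates over the field with \<open>q^2\<close>
    elements, odd \<open>k\<close> their inverses.\<close>
  define a where "a = (\<lambda>k. c ^ (q ^ k))"
  have a_Suc: "a (Suc k) = a k ^ q" for k by (simp add: a_def power_mult[symmetric] mult.commute)
  have "c ^ (q ^ 3 + 1) = 1" unfolding c by (metis dvd_triv_right singer_eqs(4))
  then have a03: "a 0 * a 3 = 1" by (simp add: a_def)
  have step3: "a k * a (k + 3) = 1" for k
  proof (induction k)
    case (Suc k)
    have "a (Suc k) * a (Suc (k + 3)) = (a k * a (k + 3)) ^ q"
      by (simp only: a_Suc power_mult_distrib)
    then show ?case by (simp only: Suc.IH add_Suc power_one)
  qed (simp add: a03)
  have "c ^ (q ^ 4 + q ^ 2 + 1) = 1" unfolding c by (metis dvd_triv_right singer_eqs(5))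
  then have norm: "a 0 * a 2 * a 4 = 1" by (simp add: a_def power_add mult_ac)
  have a_nz: "a k \<noteq> 0" for k using step3[of k] by auto
  have cancel: "x = y" if "z * x = 1" "z * y = 1" for x y z :: "'a alg_closure"
  proof -
    have "z \<noteq> 0" using that(1) by auto
    moreover have "z * x = z * y" using that by simp
    ultimately show ?thesis by simp
  qed
  have a6: "a 6 = a 0" by (rule cancel[of "a 3"]) (use step3[of 3] a03 in \<open>simp_all add: mult.commute\<close>)
  have a3: "a 3 = a 2 * a 4" by (rule cancel[OF a03]) (use norm in \<open>simp add: mult_ac\<close>)
  have a5: "a 5 = a 0 * a 4"
    by (rule cancel[of "a 2"]) (use step3[of 2] norm in \<open>simp_all add: mult_ac\<close>)
  have a1: "a 1 = a 0 * a 2"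
    by (rule cancel[of "a 4"]) (use step3[of 1] norm in \<open>simp_all add: mult_ac\<close>)
  define t where "t = a 0 + a 2 + a 4"
  have tq: "t ^ q = a 1 + a 3 + a 5"
    by (simp add: t_def ac_power_add numeral_eq_Suc a_Suc)
  have "t ^ (q ^ 2) = (t ^ q) ^ q" by (simp add: power2_eq_square power_mult)
  also have "\<dots> = a 2 + a 4 + a 6" unfolding tq by (simp add: ac_power_add numeral_eq_Suc a_Suc)
  also have "\<dots> = t" by (simp add: a6 t_def)
  finally obtain \<tau> where \<tau>: "t = to_ac \<tau>" using in_range_to_ac by blast
  have c_a0: "c = a 0" by (simp add: a_def)
  have "c ^ 3 - t * c ^ 2 + t ^ q * c - 1
      = a 0 ^ 3 - (a 0 + a 2 + a 4) * a 0 ^ 2 + (a 0 * a 2 + a 2 * a 4 + a 0 * a 4) * a 0 - a 0 * a 2 * a 4"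
    unfolding tq a1 a3 a5 norm by (simp add: c_a0 t_def)
  also have "\<dots> = 0" by (simp add: power2_eq_square power3_eq_cube algebra_simps)
  finally have cubic: "c ^ 3 - to_ac \<tau> * c ^ 2 + to_ac (cj \<tau>) * c - 1 = 0" by (simp add: to_ac_cj \<tau>)
  have "singer > 1" using singer_eqs(6) q_gt_2 by simp
  have c_pow: "singer dvd m - 1" if "c ^ m = c" "m > 0" for m
  proof -
    have "c * c ^ (m - 1) = c" using that by (simp flip: power_Suc)
    then show ?thesis using a_nz[of 0] c_a0 c[of "m - 1"] by simp
  qed
  have q_pow: "q ^ m > 0" for m using q_gt_2 by simp
  have d02: "a 0 \<noteq> a 2"
  proof
    assume "a 0 = a 2"
    then have "singer dvd q ^ 2 - 1" using c_pow[OF _ q_pow, of 2] by (simp add: a_def)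
    then have "is_unit singer" using coprime_singer[OF assms] by (metis coprime_def dvd_refl)
    then show False using \<open>singer > 1\<close> by simp
  qed
  \<comment> \<open>Since \<open>q^2 + 1 = singer + q\<close>, equality would make
    \<open>singer\<close> divide the smaller number \<open>q\<close>.\<close>
  have d04: "a 0 \<noteq> a 4"
  proof
    assume "a 0 = a 4"
    then have "singer dvd q ^ 4 - 1" using c_pow[OF _ q_pow, of 4] by (simp add: a_def)
    also have "q ^ 4 - 1 = (q ^ 2 - 1) * (q ^ 2 + 1)"
      using q_gt_2 by (simp add: diff_mult_distrib algebra_simps power2_eq_square power4_eq_xxxx)
    finally have "singer dvd singer + q"
      using coprime_singer[OF assms] singer_eqs(1) by (metis coprime_dvd_mult_right_iff)
    then have "singer dvd q" by simp
    then show False using singer_eqs(6) q_gt_2 by (auto dest: dvd_imp_le)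
  qed
  have inj_pow: "x = y" if "x ^ q = y ^ q" for x y :: "'a alg_closure"
  proof -
    have "x ^ q = ((x - y) + y) ^ q" by simp
    also have "\<dots> = (x - y) ^ q + y ^ q" by (rule ac_power_add)
    finally show ?thesis using that by simp
  qed
  have d24: "a 2 \<noteq> a 4"
  proof
    assume "a 2 = a 4"
    moreover have "a 2 = a 1 ^ q" "a 4 = a 3 ^ q" "a 1 = a 0 ^ q" "a 3 = a 2 ^ q"
      using a_Suc[of 1] a_Suc[of 3] a_Suc[of 0] a_Suc[of 2] by (simp_all add: eval_nat_numeral)
    ultimately have "a 0 = a 2" using inj_pow by metis
    then show False using d02 by simp
  qed
  have conj: "to_ac (cj A) + to_ac (cj B) * a (Suc k) + to_ac (cj C) * a (Suc k) ^ 2 = 0"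
    if "to_ac A + to_ac B * a k + to_ac C * a k ^ 2 = 0" for A B C k
  proof -
    have "(to_ac A + to_ac B * a k + to_ac C * a k ^ 2) ^ q = 0" using that q_gt_2 by simp
    then show ?thesis by (simp add: ac_power_add power_mult_distrib to_ac_cj a_Suc power2_eq_square)
  qed
  \<comment> \<open>A polynomial of degree at most two vanishes at three distinct conjugates;
    divided differences remove its coefficients one after another.\<close>
  have indep: "A = 0 \<and> B = 0 \<and> C = 0" if "to_ac A + to_ac B * c + to_ac C * c ^ 2 = 0" for A B C
  proof -
    have h0: "to_ac A + to_ac B * a 0 + to_ac C * a 0 ^ 2 = 0" using that by (simp add: c_a0)
    have h2: "to_ac A + to_ac B * a 2 + to_ac C * a 2 ^ 2 = 0"
      using conj[OF conj[OF h0]] by (simp add: numeral_2_eq_2)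
    have h4: "to_ac A + to_ac B * a 4 + to_ac C * a 4 ^ 2 = 0"
      using conj[OF conj[OF h2]] by (simp add: numeral_eq_Suc)
    have diff: "(a 0 - x) * (to_ac B + to_ac C * (a 0 + x))
        = (to_ac A + to_ac B * a 0 + to_ac C * a 0 ^ 2) - (to_ac A + to_ac B * x + to_ac C * x ^ 2)" for x
      by (simp add: algebra_simps power2_eq_square)
    have "(a 0 - a 2) * (to_ac B + to_ac C * (a 0 + a 2)) = 0"
      "(a 0 - a 4) * (to_ac B + to_ac C * (a 0 + a 4)) = 0"
      unfolding diff h0 h2 h4 by simp_all
    then have b2: "to_ac B + to_ac C * (a 0 + a 2) = 0" and b4: "to_ac B + to_ac C * (a 0 + a 4) = 0"
      using d02 d04 by simp_all
    have "to_ac C * (a 2 - a 4) = (to_ac B + to_ac C * (a 0 + a 2)) - (to_ac B + to_ac C * (a 0 + a 4))"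
      by (simp add: algebra_simps)
    then have "to_ac C * (a 2 - a 4) = 0" using b2 b4 by simp
    then have C: "C = 0" using d24 by simp
    then have B: "B = 0" using b2 by simp
    then show ?thesis using C h0 by simp
  qed
  show ?thesis by (rule that[OF c cubic indep])
qed


section \<open>From the standard Hermitian form to the hyperbolic one, and the centre\<close>

definition std_form :: "'a ^3 \<Rightarrow> 'a ^3 \<Rightarrow> 'a" where
  "std_form x y = x $ 1 * cj (y $ 1) + x $ 2 * cj (y $ 2) + x $ 3 * cj (y $ 3)"

text \<open>The defining equation concerns the rows of \<open>A\<close>, invariance of the form its
  columns. They agree because a one-sided inverse of a square matrix is two-sided.\<close>

lemma SU3_eq_isometries:
  "carrier (SU3 q) = {A :: 'a ^3^3. det A = 1 \<and> (\<forall>x y. std_form (A *v x) (A *v y) = std_form x y)}"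
proof -
  have "A ** conjT q A = mat 1 \<longleftrightarrow> (\<forall>x y. std_form (A *v x) (A *v y) = std_form x y)" for A :: "'a ^3^3"
  proof
    assume "A ** conjT q A = mat 1"
    then have "conjT q A ** A = mat 1" by (simp add: matrix_left_right_inverse)
    then have orth: "(conjT q A ** A) $ i $ j = (if i = j then 1 else 0)" for i j by (simp add: mat_def)
    have orth: "cj (A $ 1 $ i) * A $ 1 $ j + cj (A $ 2 $ i) * A $ 2 $ j + cj (A $ 3 $ i) * A $ 3 $ j
        = (if i = j then 1 else 0)" for i j
      using orth[of i j] by (simp add: matrix_matrix_mult_nth conjT_def cj_def)
    show "\<forall>x y. std_form (A *v x) (A *v y) = std_form x y"
    proof (intro allI)
      fix x y
      have "std_form (A *v x) (A *v y) = (\<Sum>j\<in>UNIV. \<Sum>i\<in>UNIV. x $ j * cj (y $ i) *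
          (cj (A $ 1 $ i) * A $ 1 $ j + cj (A $ 2 $ i) * A $ 2 $ j + cj (A $ 3 $ i) * A $ 3 $ j))"
        by (simp add: std_form_def matrix_vector_mult_nth sum_3 algebra_simps)
      also have "\<dots> = std_form x y" unfolding orth by (simp add: sum_3 std_form_def)
      finally show "std_form (A *v x) (A *v y) = std_form x y" .
    qed
  next
    assume iso: "\<forall>x y. std_form (A *v x) (A *v y) = std_form x y"
    have "(conjT q A ** A) $ i $ j = mat 1 $ i $ j" for i j
    proof -
      have "(A *v axis j 1) $ k = A $ k $ j" for j k
        using exhaust_3[of j] by (auto simp: matrix_vector_mult_nth axis_def)
      then have "std_form (A *v axis j 1) (A *v axis i 1) = (conjT q A ** A) $ i $ j"
        by (simp add: std_form_def matrix_matrix_mult_nth conjT_def cj_def mult.commute)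
      moreover have "std_form (axis j 1) (axis i 1) = (mat 1 :: 'a ^3^3) $ i $ j"
        using exhaust_3[of i] exhaust_3[of j] by (auto simp: std_form_def axis_def mat_def)
      ultimately show ?thesis using iso by metis
    qed
    then have "conjT q A ** A = mat 1" by (simp add: vec_eq_iff)
    then show "A ** conjT q A = mat 1" by (simp add: matrix_left_right_inverse)
  qed
  then show ?thesis by (auto simp: SU3_def SU3_set_def)
qed

lemma SU3_simps: "mult (SU3 q) = (**)" "one (SU3 q) = mat 1"
  by (simp_all add: SU3_def)

lemma SU3_iso_UG: "\<exists>\<phi>. \<phi> \<in> iso (SU3 q :: ('a ^3^3) monoid) UG \<and> group (SU3 q :: ('a ^3^3) monoid)"
proof -
  obtain s where s: "s * cj s = - 1" using norm_surj[of "- 1"] by auto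
  have s0: "s \<noteq> 0" using s by auto
  \<comment> \<open>Because \<open>s * cj s = -1\<close>, the outer columns \<open>(1, s, 0)\<close>
    and \<open>(1, - s, 0) / 2\<close> are isotropic for the standard form, and their product is
    1.\<close>
  define P where "P = mat3 1 0 (1 / 2) s 0 (- s / 2) 0 1 0"
  have "det P = s" by (simp add: P_def det_3)
  then have "invertible P" using s0 by (simp add: invertible_det_nz)
  then obtain P' where P': "P ** P' = mat 1" "P' ** P = mat 1" unfolding invertible_def by blast
  have form: "std_form (P *v x) (P *v y) = hform x y" for x y
  proof -
    have "std_form (P *v x) (P *v y) = (x $ 1 + x $ 3 / 2) * (cj (y $ 1) + cj (y $ 3) / 2)
        + (s * cj s) * ((x $ 1 - x $ 3 / 2) * (cj (y $ 1) - cj (y $ 3) / 2)) + x $ 2 * cj (y $ 2)"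
      by (simp add: std_form_def P_def matrix_vector_mult_nth algebra_simps)
    also have "\<dots> = hform x y" unfolding s by (simp add: hform_def field_simps)
    finally show ?thesis .
  qed
  have form': "hform (P' *v x) (P' *v y) = std_form x y" for x y
    using form[of "P' *v x" "P' *v y"] by (simp add: matrix_vector_mul_assoc P')
  have dets: "det P * det P' = 1" using P'(1) by (metis det_I det_mul)
  have fwd: "P' ** A ** P \<in> carrier UG" if "A \<in> carrier (SU3 q)" for A :: "'a ^3^3"
    using that dets unfolding SU3_eq_isometries UG_def
    by (simp add: det_mul form' form mult.commute mult.left_commute flip: matrix_vector_mul_assoc)
  have bwd: "P ** A ** P' \<in> carrier (SU3 q)" if "A \<in> carrier UG" for A
    using that dets unfolding SU3_eq_isometries UG_def
    by (simp add: det_mul form' form mult.commute mult.left_commute flip: matrix_vector_mul_assoc)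
  have inv1: "P ** (P' ** A ** P) ** P' = A" and inv2: "P' ** (P ** A ** P') ** P = A" for A
  proof -
    have "P ** (P' ** A ** P) ** P' = (P ** P') ** A ** (P ** P')" by (simp add: matrix_mul_assoc)
    then show "P ** (P' ** A ** P) ** P' = A" by (simp add: P')
    have "P' ** (P ** A ** P') ** P = (P' ** P) ** A ** (P' ** P)" by (simp add: matrix_mul_assoc)
    then show "P' ** (P ** A ** P') ** P = A" by (simp add: P')
  qed
  have mult: "P' ** (A ** B) ** P = (P' ** A ** P) ** (P' ** B ** P)" for A B
  proof -
    have "(P' ** A ** P) ** (P' ** B ** P) = P' ** A ** (P ** P') ** B ** P" by (simp add: matrix_mul_assoc)
    then show ?thesis by (simp add: P' matrix_mul_assoc)
  qed
  have mult': "P ** (A ** B) ** P' = (P ** A ** P') ** (P ** B ** P')" for A B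
  proof -
    have "(P ** A ** P') ** (P ** B ** P') = P ** A ** (P' ** P) ** B ** P'" by (simp add: matrix_mul_assoc)
    then show ?thesis by (simp add: P' matrix_mul_assoc)
  qed
  have bij: "bij_betw (\<lambda>A. P' ** A ** P) (carrier (SU3 q)) (carrier UG)"
    by (rule bij_betwI[where g = "\<lambda>A. P ** A ** P'"]) (use fwd bwd inv1 inv2 in auto)
  have hom': "(\<lambda>A. P ** A ** P') \<in> hom UG (SU3 q)"
    by (rule homI) (use bwd mult' in \<open>simp_all add: SU3_simps\<close>)
  have image: "(\<lambda>A. P ** A ** P') ` carrier UG = carrier (SU3 q)"
  proof
    show "carrier (SU3 q) \<subseteq> (\<lambda>A. P ** A ** P') ` carrier UG" using fwd inv1 by (metis (no_types, lifting) image_eqI subsetI)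
  qed (use bwd in auto)
  have one: "P ** mat 1 ** P' = mat 1" by (simp add: P')
  have "group (SU3 q :: ('a ^3^3) monoid)"
    using group.hom_imp_img_group[OF group_UG hom'] unfolding image UG_simps one
    by (simp add: SU3_def)
  moreover have "(\<lambda>A. P' ** A ** P) \<in> iso (SU3 q) UG"
    using bij fwd mult by (auto simp: iso_def hom_def SU3_simps)
  ultimately show ?thesis by blast
qed

lemma perm_in_SU3: "mat3 0 1 0 0 0 1 1 0 (0 :: 'a) \<in> carrier (SU3 q)"
  and diag_in_SU3: "mat3 1 0 0 0 (- 1) 0 0 0 (- 1 :: 'a) \<in> carrier (SU3 q)"
    "mat3 (- 1) 0 0 0 1 0 0 0 (- 1 :: 'a) \<in> carrier (SU3 q)"
  by (simp_all add: SU3_eq_isometries det_3 std_form_def matrix_vector_mult_nth)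

lemma neg_eq_self_iff: "- x = x \<longleftrightarrow> x = (0 :: 'a)"
proof
  assume "- x = x"
  then have "x + x = 0" by (metis add.right_inverse)
  then have "2 * x = 0" by (simp only: mult_2)
  then show "x = 0" by simp
qed simp

text \<open>Commuting with two diagonal sign matrices kills the off-diagonal entries, and a cyclic
  permutation equates the diagonal ones. The resulting scalar \<open>z\<close> satisfies
  \<open>z^3 = 1\<close> and \<open>z^(q + 1) = 1\<close>.\<close>

lemma center_SU3:
  assumes "\<not> 3 dvd q + 1"
  shows "group_center (SU3 q) = {mat 1 :: 'a ^3^3}"
proof
  show "{mat 1} \<subseteq> group_center (SU3 q :: ('a ^3^3) monoid)"
    by (auto simp: group_center_def SU3_eq_isometries SU3_simps)
  show "group_center (SU3 q) \<subseteq> {mat 1 :: 'a ^3^3}"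
  proof
    fix Z :: "'a ^3^3" assume Z: "Z \<in> group_center (SU3 q)"
    then have comm: "Z ** A = A ** Z" if "A \<in> carrier (SU3 q)" for A
      using that by (simp add: group_center_def SU3_simps)
    have ent: "(Z ** A) $ i $ j = (A ** Z) $ i $ j" if "A \<in> carrier (SU3 q)" for A i j
      using comm[OF that] by simp
    have "Z $ 1 $ 2 = 0" "Z $ 1 $ 3 = 0" "Z $ 2 $ 1 = 0" "Z $ 3 $ 1 = 0"
      using ent[OF diag_in_SU3(1), of 1 2] ent[OF diag_in_SU3(1), of 1 3]
        ent[OF diag_in_SU3(1), of 2 1] ent[OF diag_in_SU3(1), of 3 1]
      by (simp_all add: matrix_matrix_mult_nth neg_eq_self_iff)
    moreover have "Z $ 2 $ 3 = 0" "Z $ 3 $ 2 = 0"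
      using ent[OF diag_in_SU3(2), of 2 3] ent[OF diag_in_SU3(2), of 3 2]
      by (simp_all add: matrix_matrix_mult_nth neg_eq_self_iff)
    moreover have "Z $ 1 $ 1 = Z $ 2 $ 2" "Z $ 2 $ 2 = Z $ 3 $ 3"
      using ent[OF perm_in_SU3, of 1 2] ent[OF perm_in_SU3, of 2 3]
      by (simp_all add: matrix_matrix_mult_nth)
    ultimately obtain z where z: "Z $ 1 $ 1 = z" "Z $ 2 $ 2 = z" "Z $ 3 $ 3 = z"
      and off: "Z $ 1 $ 2 = 0" "Z $ 1 $ 3 = 0" "Z $ 2 $ 1 = 0" "Z $ 3 $ 1 = 0" "Z $ 2 $ 3 = 0" "Z $ 3 $ 2 = 0"
      by metis
    have Z': "Z \<in> carrier (SU3 q)" using Z by (simp add: group_center_def)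
    then have "det Z = 1" "std_form (Z *v vec3 1 0 0) (Z *v vec3 1 0 0) = std_form (vec3 1 0 0) (vec3 1 0 0)"
      by (simp_all add: SU3_eq_isometries)
    then have "z * z * z = 1" "z * cj z = 1"
      using z off by (simp_all add: det_3 std_form_def matrix_vector_mult_nth)
    then have "z ^ 3 = 1" "z ^ (q + 1) = 1"
      by (simp_all add: cj_def power3_eq_cube)
    then have "z ^ gcd 3 (q + 1) = 1" by (intro power_gcd_eq_1) auto
    moreover have "gcd 3 (q + 1) = 1" using assms prime_imp_coprime[of 3 "q + 1"] by simp
    ultimately have "z = 1" by simp
    then show "Z \<in> {mat 1}" using z off by (simp add: vec_eq_iff forall_3 mat_def)
  qed
qed

lemma has_MLS_PSU3:
  assumes "\<not> 3 dvd q + 1" "min_factorisable UG (carrier UG)"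
  shows "has_MLS (PSU3 q :: ('a ^3^3) set monoid)"
proof -
  obtain \<phi> where \<phi>: "\<phi> \<in> iso (SU3 q :: ('a ^3^3) monoid) UG" and group: "group (SU3 q :: ('a ^3^3) monoid)"
    using SU3_iso_UG by blast
  interpret SU3: group "SU3 q :: ('a ^3^3) monoid" by (rule group)
  have PSU3: "PSU3 q = SU3 q Mod {\<one>\<^bsub>SU3 q :: ('a ^3^3) monoid\<^esub>}"
    unfolding PSU3_def center_SU3[OF assms(1)] by (simp add: SU3_simps)
  have "group (PSU3 q :: ('a ^3^3) set monoid)"
    unfolding PSU3 by (rule normal.factorgroup_is_group[OF SU3.one_is_normal])
  moreover have "the_elem \<in> iso (PSU3 q) (SU3 q :: ('a ^3^3) monoid)"
    unfolding PSU3 by (rule SU3.trivial_factor_iso)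
  moreover have "min_factorisable (SU3 q) (carrier (SU3 q :: ('a ^3^3) monoid))"
    by (rule min_factorisable_iso[OF group group_UG \<phi> assms(2)])
  ultimately show ?thesis
    by (intro has_MLS_if_min_factorisable min_factorisable_iso[of "PSU3 q" "SU3 q" the_elem] group)
qed


text \<open>The matrix below is the product of the Weyl element and a unipotent one whose parameters are chosen
  so that it has the eigenvalue \<open>c\<close>; \<open>lin\<close> is the corresponding left eigenvector.\<close>

lemma singer_matrix:
  assumes "\<not> 3 dvd q + 1"
  obtains M where "M \<in> carrier UG" "M [^]\<^bsub>UG\<^esub> singer = mat 1"
    "\<And>(i :: nat) x. x \<noteq> 0 \<Longrightarrow> line ((M [^]\<^bsub>UG\<^esub> i) *v x) = line x \<Longrightarrow> singer dvd i"
proof -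
  obtain c :: "'a alg_closure" and \<tau> :: 'a where c: "\<And>t. c ^ t = 1 \<longleftrightarrow> singer dvd t"
    and cubic: "c ^ 3 - to_ac \<tau> * c ^ 2 + to_ac (cj \<tau>) * c - 1 = 0"
    and indep: "\<And>A B C :: 'a. to_ac A + to_ac B * c + to_ac C * c ^ 2 = 0 \<Longrightarrow> A = 0 \<and> B = 0 \<and> C = 0"
    using singer_root[OF assms] by metis
  have c1: "c + 1 \<noteq> 0"
  proof
    assume "c + 1 = 0"
    then have "to_ac 1 + to_ac 1 * c + to_ac 0 * c ^ 2 = 0" by (simp add: add.commute)
    then show False using indep by (metis one_neq_zero)
  qed
  \<comment> \<open>The trace of \<open>M\<close> below is \<open>\<beta> - 1\<close>, which has to
    be \<tau>; then \<alpha> is chosen to meet the unipotent condition.\<close>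
  define \<beta> where "\<beta> = \<tau> + 1"
  have "cj (- (\<beta> + cj \<beta>)) = - (\<beta> + cj \<beta>)" by simp
  then obtain \<alpha> where \<alpha>: "\<alpha> * cj \<alpha> = - (\<beta> + cj \<beta>)" using norm_surj by blast
  \<comment> \<open>For \<open>\<alpha> = 0\<close> the vector \<open>e2\<close> would have
    eigenvalue -1 and the cubic a factor \<open>c + 1\<close>, leaving a quadratic equation for
    \<open>c\<close>.\<close>
  have "\<alpha> \<noteq> 0"
  proof
    assume "\<alpha> = 0"
    then have "cj \<tau> + (\<tau> + 2) = 0" using \<alpha> by (simp add: \<beta>_def algebra_simps)
    then have cj\<tau>: "cj \<tau> = - (\<tau> + 2)" by (simp only: eq_neg_iff_add_eq_0)
    have "(c + 1) * (to_ac (- 1) + to_ac (- (\<tau> + 1)) * c + to_ac 1 * c ^ 2)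
        = c ^ 3 - to_ac \<tau> * c ^ 2 + to_ac (- (\<tau> + 2)) * c - 1"
      by (simp add: algebra_simps power2_eq_square power3_eq_cube)
    then have "to_ac (- 1) + to_ac (- (\<tau> + 1)) * c + to_ac 1 * c ^ 2 = 0"
      using cubic c1 unfolding cj\<tau> by simp
    then show False using indep by (metis one_neq_zero)
  qed
  define M where "M = weyl ** unip \<alpha> \<beta>"
  have "unip \<alpha> \<beta> \<in> carrier UG" using \<alpha> by (intro unip_in_UG) simp
  then have M: "M \<in> carrier UG" using UG.m_closed[OF weyl_in_UG, of "unip \<alpha> \<beta>"] by (simp add: M_def)
  define u where "u = - to_ac (cj \<alpha>) * c / (c + 1)"
  have u: "u * (c + 1) = - to_ac (cj \<alpha>) * c" using c1 by (simp add: u_def)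
  \<comment> \<open>An embedding of the vector space into the algebraic closure under which
    \<open>M\<close> becomes multiplication by \<open>c\<close>; the order of \<open>M\<close> and
    its fixed points are thus read off from \<open>c\<close>.\<close>
  define lin where "lin = (\<lambda>x :: 'a ^3. to_ac (x $ 1) + u * to_ac (x $ 2) + c * to_ac (x $ 3))"
  have lin_scale: "lin (k *s x) = to_ac k * lin x" for k x
    by (simp add: lin_def algebra_simps)
  have lin_diff: "lin (x - y) = lin x - lin y" for x y
    by (simp add: lin_def algebra_simps)
  have Mx: "(M *v x) $ 1 = x $ 3" "(M *v x) $ 2 = - x $ 2 - \<alpha> * x $ 3"
    "(M *v x) $ 3 = x $ 1 - cj \<alpha> * x $ 2 + \<beta> * x $ 3" for x
    by (simp_all add: M_def weyl_def unip_def matrix_vector_mult_nth matrix_matrix_mult_nth)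
  have u2: "- u - c * to_ac (cj \<alpha>) = c * u" using u by (simp add: algebra_simps) (metis add.commute diff_minus_eq_add minus_diff_eq eq_diff_eq)
  have "(c + 1) * (1 - u * to_ac \<alpha> + c * to_ac \<beta>) = (c + 1) * c ^ 2"
  proof -
    have "(c + 1) * (1 - u * to_ac \<alpha> + c * to_ac \<beta>)
        = (c + 1) * (1 + c * to_ac \<beta>) - (u * (c + 1)) * to_ac \<alpha>" by (simp add: algebra_simps)
    also have "\<dots> = (c + 1) * (1 + c * to_ac \<beta>) + to_ac (\<alpha> * cj \<alpha>) * c" unfolding u by (simp add: algebra_simps)
    also have "\<dots> = (c + 1) * c ^ 2 - (c ^ 3 - to_ac \<tau> * c ^ 2 + to_ac (cj \<tau>) * c - 1)"
      unfolding \<alpha> \<beta>_def by (simp add: algebra_simps power2_eq_square power3_eq_cube)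
    finally show ?thesis unfolding cubic by simp
  qed
  then have u3: "1 - u * to_ac \<alpha> + c * to_ac \<beta> = c ^ 2" using c1 by simp
  have lin_M: "lin (M *v x) = c * lin x" for x
  proof -
    have "lin (M *v x) = c * to_ac (x $ 1) + (- u - c * to_ac (cj \<alpha>)) * to_ac (x $ 2)
        + (1 - u * to_ac \<alpha> + c * to_ac \<beta>) * to_ac (x $ 3)"
      unfolding lin_def Mx by (simp add: algebra_simps)
    then show ?thesis unfolding u2 u3 by (simp add: lin_def algebra_simps power2_eq_square)
  qed
  have lin_pow: "lin ((M [^]\<^bsub>UG\<^esub> i) *v x) = c ^ i * lin x" for i :: nat and x
  proof (induction i arbitrary: x)
    case (Suc i)
    have "(M [^]\<^bsub>UG\<^esub> Suc i) *v x = (M [^]\<^bsub>UG\<^esub> i) *v (M *v x)"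
      by (simp add: matrix_vector_mul_assoc)
    then show ?case using Suc.IH[of "M *v x"] lin_M[of x] by simp
  qed simp
  \<comment> \<open>Multiplying by \<open>c + 1\<close> clears the denominator of \<open>u\<close>,
    so that \<open>indep\<close> applies.\<close>
  have lin_0: "x = 0" if "lin x = 0" for x
  proof -
    have "to_ac (x $ 1) + to_ac (x $ 1 - cj \<alpha> * x $ 2 + x $ 3) * c + to_ac (x $ 3) * c ^ 2
        = (c + 1) * (to_ac (x $ 1) + c * to_ac (x $ 3)) + (- to_ac (cj \<alpha>) * c) * to_ac (x $ 2)"
      by (simp add: algebra_simps power2_eq_square)
    also have "\<dots> = (c + 1) * lin x" unfolding u[symmetric] by (simp add: lin_def algebra_simps)
    finally have "to_ac (x $ 1) + to_ac (x $ 1 - cj \<alpha> * x $ 2 + x $ 3) * c + to_ac (x $ 3) * c ^ 2 = 0"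
      using that by simp
    from indep[OF this] show ?thesis using \<open>\<alpha> \<noteq> 0\<close> by (auto simp: vec3_eq_iff)
  qed
  show ?thesis
  proof (rule that[OF M])
    have "(M [^]\<^bsub>UG\<^esub> singer) *v x = mat 1 *v x" for x
    proof -
      have "lin ((M [^]\<^bsub>UG\<^esub> singer) *v x - x) = 0" using c[of singer] by (simp add: lin_diff lin_pow)
      then show ?thesis using lin_0 by fastforce
    qed
    then show "M [^]\<^bsub>UG\<^esub> singer = mat 1" unfolding matrix_eq by blast
    fix i :: nat and x :: "'a ^3"
    assume x: "x \<noteq> 0" "line ((M [^]\<^bsub>UG\<^esub> i) *v x) = line x"
    then obtain k where k: "k \<noteq> 0" "x = k *s ((M [^]\<^bsub>UG\<^esub> i) *v x)" unfolding line_eq_iff by blast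
    have "lin x = to_ac k * (c ^ i * lin x)" using arg_cong[OF k(2), of lin] by (simp only: lin_scale lin_pow)
    moreover have "lin x \<noteq> 0" using lin_0 x(1) by blast
    ultimately have "to_ac k * c ^ i = 1" by simp
    \<comment> \<open>The scalar \<open>k\<close> disappears under the power \<open>q^2 - 1\<close>,
      to which \<open>singer\<close> is coprime.\<close>
    then have "(to_ac k * c ^ i) ^ (q ^ 2 - 1) = 1" by simp
    moreover have "k ^ (q ^ 2 - 1) = 1"
    proof -
      have "k * k ^ (q ^ 2 - 1) = k" using finite_field_pow_card[of k] q_gt_2 by (simp add: card_field flip: power_Suc)
      then show ?thesis using k(1) by simp
    qed
    then have "to_ac k ^ (q ^ 2 - 1) = 1" by (simp flip: to_ac_power)
    ultimately have "c ^ (i * (q ^ 2 - 1)) = 1" by (simp add: power_mult_distrib power_mult)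
    then have "singer dvd i * (q ^ 2 - 1)" using c by simp
    then show "singer dvd i" using coprime_singer[OF assms] by (simp add: coprime_dvd_mult_left_iff)
  qed
qed

lemma singer_subgroup:
  assumes "\<not> 3 dvd q + 1"
  obtains C where "subgroup C UG" "min_factorisable UG C" "card C = singer"
    "\<And>A x. A \<in> C \<Longrightarrow> x \<noteq> 0 \<Longrightarrow> line (A *v x) = line x \<Longrightarrow> A = mat 1"
proof -
  obtain M where M: "M \<in> carrier UG" "M [^]\<^bsub>UG\<^esub> singer = mat 1"
    and free: "\<And>(i :: nat) x. x \<noteq> 0 \<Longrightarrow> line ((M [^]\<^bsub>UG\<^esub> i) *v x) = line x \<Longrightarrow> singer dvd i"
    using singer_matrix[OF assms] by metis
  have r0: "singer > 0" using singer_eqs(6) by simp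
  define C where "C = (\<lambda>i :: nat. M [^]\<^bsub>UG\<^esub> i) ` UNIV"
  have period: "M [^]\<^bsub>UG\<^esub> (singer * k) = mat 1" for k :: nat
    using M by (simp add: UG.nat_pow_pow[symmetric] flip: UG_simps(2))
  have one: "M [^]\<^bsub>UG\<^esub> i = mat 1" if "singer dvd i" for i using that period by (auto elim!: dvdE)
  have C_sub: "C \<subseteq> carrier UG" using M(1) by (auto simp: C_def)
  have sub: "subgroup C UG"
  proof (rule UG.subgroupI[OF C_sub])
    show "C \<noteq> {}" by (simp add: C_def)
    fix A assume "A \<in> C"
    then obtain i :: nat where i: "A = M [^]\<^bsub>UG\<^esub> i" by (auto simp: C_def)
    have "M [^]\<^bsub>UG\<^esub> ((singer - 1) * i) \<otimes>\<^bsub>UG\<^esub> A = M [^]\<^bsub>UG\<^esub> ((singer - 1) * i + i)"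
      unfolding i by (rule UG.nat_pow_mult[OF M(1)])
    also have "(singer - 1) * i + i = singer * i" using r0 by (cases singer) auto
    finally have "inv\<^bsub>UG\<^esub> A = M [^]\<^bsub>UG\<^esub> ((singer - 1) * i)"
      using M(1) i period by (intro UG.inv_equality) auto
    then show "inv\<^bsub>UG\<^esub> A \<in> C" by (simp add: C_def)
    fix B assume "B \<in> C"
    then obtain j :: nat where j: "B = M [^]\<^bsub>UG\<^esub> j" by (auto simp: C_def)
    have "A \<otimes>\<^bsub>UG\<^esub> B = M [^]\<^bsub>UG\<^esub> (i + j)" unfolding i j by (rule UG.nat_pow_mult[OF M(1)])
    then show "A \<otimes>\<^bsub>UG\<^esub> B \<in> C" by (simp add: C_def)
  qed
  have "comm_group (UG\<lparr>carrier := C\<rparr>)"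
  proof (rule group.group_comm_groupI[OF subgroup.subgroup_is_group[OF sub group_UG]])
    fix A B assume "A \<in> carrier (UG\<lparr>carrier := C\<rparr>)" "B \<in> carrier (UG\<lparr>carrier := C\<rparr>)"
    then obtain i j :: nat where ij: "A = M [^]\<^bsub>UG\<^esub> i" "B = M [^]\<^bsub>UG\<^esub> j" by (auto simp: C_def)
    show "A \<otimes>\<^bsub>UG\<lparr>carrier := C\<rparr>\<^esub> B = B \<otimes>\<^bsub>UG\<lparr>carrier := C\<rparr>\<^esub> A"
      using UG.nat_pow_mult[OF M(1), of i j] UG.nat_pow_mult[OF M(1), of j i] by (simp add: ij add.commute)
  qed
  then have "min_factorisable (UG\<lparr>carrier := C\<rparr>) C"
    using min_factorisable_comm_group[of "UG\<lparr>carrier := C\<rparr>"] by simp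
  then have mf: "min_factorisable UG C" using C_sub by (rule min_factorisable_mono)
  have "C = (\<lambda>i :: nat. M [^]\<^bsub>UG\<^esub> i) ` {..<singer}"
  proof (intro equalityI subsetI)
    fix A assume "A \<in> C"
    then obtain i :: nat where i: "A = M [^]\<^bsub>UG\<^esub> i" by (auto simp: C_def)
    have "M [^]\<^bsub>UG\<^esub> (singer * (i div singer)) \<otimes>\<^bsub>UG\<^esub> M [^]\<^bsub>UG\<^esub> (i mod singer) = M [^]\<^bsub>UG\<^esub> i"
      unfolding UG.nat_pow_mult[OF M(1)] by simp
    then have "A = M [^]\<^bsub>UG\<^esub> (i mod singer)" unfolding period i by simp
    then show "A \<in> (\<lambda>i :: nat. M [^]\<^bsub>UG\<^esub> i) ` {..<singer}" using r0 by auto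
  qed (auto simp: C_def)
  moreover have "inj_on (\<lambda>i :: nat. M [^]\<^bsub>UG\<^esub> i) {..<singer}"
  proof (rule linorder_inj_onI)
    fix i j :: nat assume ij: "i < j" "i \<in> {..<singer}" "j \<in> {..<singer}"
    show "M [^]\<^bsub>UG\<^esub> i \<noteq> M [^]\<^bsub>UG\<^esub> j"
    proof
      assume eq: "M [^]\<^bsub>UG\<^esub> i = M [^]\<^bsub>UG\<^esub> j"
      have "M [^]\<^bsub>UG\<^esub> i \<otimes>\<^bsub>UG\<^esub> M [^]\<^bsub>UG\<^esub> (j - i) = M [^]\<^bsub>UG\<^esub> i"
        using UG.nat_pow_mult[OF M(1), of i "j - i"] ij(1) eq by simp
      then have "M [^]\<^bsub>UG\<^esub> (j - i) = mat 1"
        using UG.l_cancel_one[of "M [^]\<^bsub>UG\<^esub> i" "M [^]\<^bsub>UG\<^esub> (j - i)"] M(1) by simp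
      moreover have "e1 \<noteq> 0" by (simp add: vec3_eq_iff)
      ultimately have "singer dvd j - i" using free[of e1 "j - i"] by simp
      then show False using ij by (auto dest: dvd_imp_le)
    qed
  qed auto
  ultimately have "card C = singer" by (simp add: card_image)
  moreover have "A = mat 1" if A: "A \<in> C" and x: "x \<noteq> 0" "line (A *v x) = line x" for A x
  proof -
    obtain i :: nat where i: "A = M [^]\<^bsub>UG\<^esub> i" using A by (auto simp: C_def)
    then show ?thesis using free[OF x(1), of i] x(2) one by simp
  qed
  ultimately show ?thesis using that[OF sub mf] by blast
qed

section \<open>The factorisation through the Borel subgroup\<close>

theorem min_factorisable_UG_twice_prime:
  assumes "\<not> 3 dvd q + 1" "prime p" "q + 1 = 2 * p"
  shows "min_factorisable UG (carrier UG)"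
proof -
  obtain C where C: "subgroup C UG" "min_factorisable UG C" "card C = singer"
    and free: "\<And>A x. A \<in> C \<Longrightarrow> x \<noteq> 0 \<Longrightarrow> line (A *v x) = line x \<Longrightarrow> A = mat 1"
    using singer_subgroup[OF assms(1)] by metis
  have CG: "A \<in> carrier UG" if "A \<in> C" for A using that C(1) by (rule subgroup.mem_carrier[rotated])
  have C_mult: "A ** B \<in> C" if "A \<in> C" "B \<in> C" for A B using subgroup.m_closed[OF C(1) that] by simp
  have C_inv: "inv\<^bsub>UG\<^esub> A \<in> C" if "A \<in> C" for A using subgroup.m_inv_closed[OF C(1) that] .
  have fixed: "A = B" if *: "A \<in> C" "B \<in> C" "L \<in> isotropic" "act A L = act B L" for A B L
  proof -
    obtain x where x: "L = line x" "x \<noteq> 0" using *(3) unfolding isotropic_def by blast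
    have "act (inv\<^bsub>UG\<^esub> A ** B) L = L"
      using *(4) act_inv(1)[OF CG[OF *(1)], of L] by (simp add: act_matrix_mult)
    then have "inv\<^bsub>UG\<^esub> A ** B = mat 1"
      using free[of "inv\<^bsub>UG\<^esub> A ** B" x] C_mult[OF C_inv[OF *(1)] *(2)] x by (simp add: act_line)
    then have "inv\<^bsub>UG\<^esub> B = inv\<^bsub>UG\<^esub> A"
      using UG.inv_equality[of "inv\<^bsub>UG\<^esub> A" B] CG[OF *(1)] CG[OF *(2)] by simp
    then show ?thesis using UG.inv_inv CG[OF *(1)] CG[OF *(2)] by metis
  qed
  define orb where "orb = (\<lambda>L. (\<lambda>A. act A L) ` C)"
  have orb_self: "L \<in> orb L" for L
    using subgroup.one_closed[OF C(1)] unfolding orb_def by (intro image_eqI[of _ _ "mat 1"]) (simp_all add: act_mat_1)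
  have orb_sub: "orb L \<subseteq> isotropic" if "L \<in> isotropic" for L
    using that CG act_isotropic unfolding orb_def by blast
  have orb_mono: "orb K \<subseteq> orb L" if K: "K \<in> orb L" for K L
  proof -
    obtain A where A: "A \<in> C" "K = act A L" using K unfolding orb_def by blast
    have "act B K = act (B ** A) L" for B by (simp add: A act_matrix_mult)
    then show ?thesis using C_mult[OF _ A(1)] unfolding orb_def by blast
  qed
  have orb_sym: "L \<in> orb K" if K: "K \<in> orb L" for K L
  proof -
    obtain A where A: "A \<in> C" "K = act A L" using K unfolding orb_def by blast
    then have "L = act (inv\<^bsub>UG\<^esub> A) K" using act_inv(1)[OF CG[OF A(1)]] by simp
    then show ?thesis using C_inv[OF A(1)] unfolding orb_def by (rule image_eqI)
  qed
  have orb_eq: "orb K = orb L" if "K \<in> orb L" for K L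
    using orb_mono[OF that] orb_mono[OF orb_sym[OF that]] by (rule equalityI)
  define blocks where "blocks = orb ` isotropic"
  have block: "W \<subseteq> isotropic \<and> card W = singer" if W: "W \<in> blocks" for W
  proof -
    obtain L where L: "L \<in> isotropic" "W = orb L" using W unfolding blocks_def by blast
    have "inj_on (\<lambda>A. act A L) C" by (rule inj_onI) (rule fixed[OF _ _ L(1)])
    then show ?thesis using L orb_sub C(3) by (simp add: orb_def card_image)
  qed
  have disj: "V \<inter> W = {}" if "V \<in> blocks" "W \<in> blocks" "V \<noteq> W" for V W
  proof (rule ccontr)
    assume "V \<inter> W \<noteq> {}"
    then obtain K where "K \<in> V" "K \<in> W" by blast
    then have "orb K = V" "orb K = W" using that(1,2) orb_eq unfolding blocks_def by auto
    then show False using that(3) by simp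
  qed
  have union: "\<Union>blocks = isotropic" using orb_self orb_sub unfolding blocks_def by blast
  have card: "card isotropic = (q + 1) * singer" using card_isotropic singer_eqs(4) by simp
  \<comment> \<open>The orbits are regular and partition \<open>(q + 1) * singer\<close> points,
    which fixes their number.\<close>
  have "singer * card blocks = card (\<Union>blocks)"
    by (rule card_partition) (use block disj in auto)
  then have "singer * card blocks = singer * (2 * p)" unfolding union card assms(3) by (simp only: mult.commute)
  moreover have "singer \<noteq> 0" using singer_eqs(6) by simp
  ultimately have card_blocks: "card blocks = 2 * p" using mult_left_cancel by metis
  have "disjoint blocks" using disj by (auto simp: disjoint_def)
  have "q > 0" using q_gt_2 by simp
  obtain a Y where a: "a \<in> carrier UG" "a \<noteq> \<one>\<^bsub>UG\<^esub>" and Y: "Y \<subseteq> isotropic" "card Y = p"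
    and match': "\<forall>W\<in>blocks. \<exists>!z. z \<in> {\<one>\<^bsub>UG\<^esub>, a} \<times> Y \<and> act (fst z) (snd z) \<in> W"
    by (rule isotropic.block_matching[OF block \<open>disjoint blocks\<close> card_blocks assms(3) singer_eqs(1) \<open>q > 0\<close> card])
  note match = bspec[OF match']
  define T where "T = {mat 1, a}"
  have T: "min_factorisable UG T" "card T > 0" "T \<subseteq> carrier UG"
  proof -
    have "card T = 2" using a(2) by (simp add: T_def)
    moreover show "T \<subseteq> carrier UG" using a(1) UG.one_closed by (simp add: T_def)
    ultimately show "min_factorisable UG T" "card T > 0"
      using min_factorisable_prime_card[OF group_UG] by simp_all
  qed
  have "\<forall>L\<in>Y. \<exists>A. A \<in> carrier UG \<and> act A (line e1) = L" using transitive_isotropic Y(1) by blast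
  from bchoice[OF this] obtain k where k: "\<And>L. L \<in> Y \<Longrightarrow> k L \<in> carrier UG \<and> act (k L) (line e1) = L" by blast
  define Xs where "Xs = k ` Y"
  have inj_k: "inj_on k Y"
  proof (rule inj_onI)
    fix K L assume "K \<in> Y" "L \<in> Y" "k K = k L"
    then show "K = L" using k by metis
  qed
  have Xs: "min_factorisable UG Xs" "card Xs > 0" "Xs \<subseteq> carrier UG"
  proof -
    have "card Xs = p" using inj_k Y(2) by (simp add: Xs_def card_image)
    moreover show "Xs \<subseteq> carrier UG" using k by (auto simp: Xs_def)
    ultimately show "min_factorisable UG Xs" "card Xs > 0"
      using min_factorisable_prime_card[OF group_UG, of Xs] assms(2) by (simp_all add: prime_gt_0_nat)
  qed
  have isoT: "act t y \<in> isotropic" if "t \<in> T" "y \<in> Y" for t y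
    using that T(3) Y(1) by (intro act_isotropic) auto
  \<comment> \<open>The orbit of the common image contains both \<open>act t y\<close> and
    \<open>act t' y'\<close>. The matching forces the same pair, and regularity then forces the same
    element of \<open>C\<close>.\<close>
  have unique: "A = A' \<and> t = t' \<and> y = y'"
    if *: "A \<in> C" "A' \<in> C" "t \<in> T" "t' \<in> T" "y \<in> Y" "y' \<in> Y" "act A (act t y) = act A' (act t' y')"
    for A A' t t' y y'
  proof -
    define z where "z = act A (act t y)"
    have "z \<in> isotropic" unfolding z_def using act_isotropic CG *(1) isoT[OF *(3,5)] by blast
    then have W: "orb z \<in> blocks" by (simp add: blocks_def)
    have "z \<in> orb (act t y)" "z \<in> orb (act t' y')"
      using *(1,2,7) unfolding z_def orb_def by blast+
    then have "act t y \<in> orb z" "act t' y' \<in> orb z" by (simp_all only: orb_sym)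
    moreover have "(t, y) \<in> {\<one>\<^bsub>UG\<^esub>, a} \<times> Y" "(t', y') \<in> {\<one>\<^bsub>UG\<^esub>, a} \<times> Y"
      using *(3-6) by (simp_all add: T_def)
    ultimately have "(t, y) = (t', y')" using match[OF W] by (metis fst_conv snd_conv)
    then show ?thesis using fixed[OF *(1,2) isoT[OF *(3,5)]] *(7) by simp
  qed
  have ex: "\<exists>A\<in>C. \<exists>t\<in>T. \<exists>y\<in>Y. act A (act t y) = z" if "z \<in> isotropic" for z
  proof -
    have "orb z \<in> blocks" using that by (simp add: blocks_def)
    then obtain w where w: "w \<in> {\<one>\<^bsub>UG\<^esub>, a} \<times> Y" "act (fst w) (snd w) \<in> orb z" using match by blast
    have "z \<in> orb (act (fst w) (snd w))" using w(2) by (rule orb_sym)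
    then obtain A where "A \<in> C" "z = act A (act (fst w) (snd w))" unfolding orb_def by blast
    moreover have "fst w \<in> T" "snd w \<in> Y" using w(1) by (auto simp: T_def)
    ultimately show ?thesis by blast
  qed
  define TX where "TX = (\<lambda>(t, x). t \<otimes>\<^bsub>UG\<^esub> x) ` (T \<times> Xs)"
  have act_k: "act (B ** k y) (line e1) = act B y" if "y \<in> Y" for B y
    using k[OF that] by (simp add: act_matrix_mult)
  have inj_TX: "inj_on (\<lambda>(t, x). t \<otimes>\<^bsub>UG\<^esub> x) (T \<times> Xs)"
  proof (rule inj_onI, clarify)
    fix t x t' x' assume *: "t \<in> T" "x \<in> Xs" "t' \<in> T" "x' \<in> Xs" "t \<otimes>\<^bsub>UG\<^esub> x = t' \<otimes>\<^bsub>UG\<^esub> x'"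
    then obtain y y' where y: "y \<in> Y" "x = k y" "y' \<in> Y" "x' = k y'" by (auto simp: Xs_def)
    have "act t y = act t' y'" using *(5) act_k[OF y(1), of t] act_k[OF y(3), of t'] y by simp
    then show "t = t' \<and> x = x'"
      using unique[of "mat 1" "mat 1" t t' y y'] subgroup.one_closed[OF C(1)] * y by (simp add: act_mat_1)
  qed
  have TX: "min_factorisable UG TX"
    unfolding TX_def by (rule min_factorisable_mult[OF group_UG T(1) Xs(1) T(2) Xs(2) inj_TX])
  have TX0: "card TX > 0"
    unfolding TX_def card_image[OF inj_TX] using T(2) Xs(2) by (simp add: card_cartesian_product)
  define S where "S = (\<lambda>(A, x). A \<otimes>\<^bsub>UG\<^esub> x) ` (C \<times> TX)"
  have TX_E: "\<exists>t\<in>T. \<exists>y\<in>Y. x = t ** k y" if "x \<in> TX" for x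
    using that unfolding TX_def Xs_def by auto
  have act_S: "act (A ** (t ** k y)) (line e1) = act A (act t y)" if "y \<in> Y" for A t y
    using act_k[OF that, of t] by (simp add: act_matrix_mult)
  have inj_S: "inj_on (\<lambda>(A, x). A \<otimes>\<^bsub>UG\<^esub> x) (C \<times> TX)"
  proof (rule inj_onI, clarify)
    fix A x A' x' assume *: "A \<in> C" "x \<in> TX" "A' \<in> C" "x' \<in> TX" "A \<otimes>\<^bsub>UG\<^esub> x = A' \<otimes>\<^bsub>UG\<^esub> x'"
    obtain t y where ty: "t \<in> T" "y \<in> Y" "x = t ** k y" using TX_E[OF *(2)] by blast
    obtain t' y' where ty': "t' \<in> T" "y' \<in> Y" "x' = t' ** k y'" using TX_E[OF *(4)] by blast
    have "act A (act t y) = act A' (act t' y')"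
      using *(5) act_S[OF ty(2), of A t] act_S[OF ty'(2), of A' t'] ty(3) ty'(3) by simp
    then show "A = A' \<and> x = x'" using unique[of A A' t t' y y'] * ty ty' by simp
  qed
  have S: "min_factorisable UG S"
    unfolding S_def using singer_eqs(6) C(3)
    by (intro min_factorisable_mult[OF group_UG C(2) TX _ TX0 inj_S]) simp
  have SG: "S \<subseteq> carrier UG" by (rule min_factorisable_subset[OF group_UG S])
  have borel: "min_factorisable UG (stab e1)" by (rule min_factorisable_borel[OF subgroup_stab]) simp
  show ?thesis
  proof (rule min_factorisable_transversal[OF group_UG S borel finite_UG
        subgroup_stab UG.subgroup_self SG subgroup.subset[OF subgroup_stab]])
    fix g assume g: "g \<in> carrier UG"
    have iff: "inv\<^bsub>UG\<^esub> s \<otimes>\<^bsub>UG\<^esub> g \<in> stab e1 \<longleftrightarrow> act s (line e1) = act g (line e1)" if "s \<in> S" for s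
      unfolding act_line using that SG g by (intro inv_mult_stab_iff) auto
    have "act g (line e1) \<in> isotropic" using act_isotropic[OF g isotropic_e1] .
    then obtain A t y where Aty: "A \<in> C" "t \<in> T" "y \<in> Y" "act A (act t y) = act g (line e1)" using ex by blast
    have "t ** k y \<in> TX"
      using Aty(2,3) unfolding TX_def Xs_def by (intro image_eqI[of _ _ "(t, k y)"]) auto
    then have mem: "A ** (t ** k y) \<in> S"
      using Aty(1) unfolding S_def by (intro image_eqI[of _ _ "(A, t ** k y)"]) auto
    show "\<exists>!s. s \<in> S \<and> inv\<^bsub>UG\<^esub> s \<otimes>\<^bsub>UG\<^esub> g \<in> stab e1"
    proof (rule ex1I[of _ "A ** (t ** k y)"])
      show "A ** (t ** k y) \<in> S \<and> inv\<^bsub>UG\<^esub> (A ** (t ** k y)) \<otimes>\<^bsub>UG\<^esub> g \<in> stab e1"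
        using mem iff[OF mem] act_S[OF Aty(3)] Aty(4) by simp
      fix s assume s: "s \<in> S \<and> inv\<^bsub>UG\<^esub> s \<otimes>\<^bsub>UG\<^esub> g \<in> stab e1"
      then obtain A' x where A': "A' \<in> C" "x \<in> TX" "s = A' ** x" unfolding S_def by auto
      obtain t' y' where ty': "t' \<in> T" "y' \<in> Y" "x = t' ** k y'" using TX_E[OF A'(2)] by blast
      have "act s (line e1) = act g (line e1)" using s iff by blast
      then have "act A (act t y) = act A' (act t' y')"
        using act_S[OF ty'(2), of A' t'] A'(3) ty'(3) Aty(4) by simp
      then show "s = A ** (t ** k y)"
        using unique[of A A' t t' y y'] Aty A' ty' by simp
    qed
  qed
qed

end

theorem theorem4p4:
  fixes q :: nat
  assumes "CARD('a::{field,finite}) = q ^ 2"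
    and "\<exists>p k. prime p \<and> k \<ge> 1 \<and> q = p ^ k"
    and "odd q"
  shows "(prime (q ^ 2 - q + 1) \<longrightarrow> has_MLS (PSU3 q :: ('a ^3^3) set monoid))
       \<and> ((q > 5 \<and> (\<exists>p::nat. prime p \<and> q + 1 = 2 * p)) \<longrightarrow> has_MLS (PSU3 q :: ('a ^3^3) set monoid))"
proof (intro conjI impI)
  interpret unitary_field q "TYPE('a)" by unfold_locales (use assms in auto)
  show "has_MLS (PSU3 q :: ('a ^3^3) set monoid)" if pr: "prime (q ^ 2 - q + 1)"
  proof (rule has_MLS_PSU3[OF _ min_factorisable_UG_prime[OF pr]])
    show "\<not> 3 dvd q + 1"
    proof
      \<comment> \<open>Then \<open>3\<close> divides \<open>singer\<close>, so the prime
        \<open>singer\<close> equals 3, which contradicts \<open>singer > q > 2\<close>.\<close>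
      assume "3 dvd q + 1"
      then have "3 dvd (q + 1) ^ 2" unfolding power2_eq_square by (rule dvd_mult2)
      then have "3 dvd singer + 3 * q" by (simp only: singer_eqs(3))
      then have "3 dvd singer" by (simp only: dvd_add_left_iff dvd_triv_left)
      then have "singer = 3" using pr primes_dvd_imp_eq[of 3 singer] by (simp add: singer_def)
      then show False using singer_eqs(6) q_gt_2 by simp
    qed
  qed
  show "has_MLS (PSU3 q :: ('a ^3^3) set monoid)"
    if *: "q > 5 \<and> (\<exists>p::nat. prime p \<and> q + 1 = 2 * p)"
  proof -
    obtain p where p: "prime p" "q + 1 = 2 * p" using * by blast
    have "\<not> 3 dvd q + 1"
    proof
      \<comment> \<open>This would force \<open>p = 3\<close> and \<open>q = 5\<close>, the case
        excluded by \<open>q > 5\<close>.\<close>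
      assume "3 dvd q + 1"
      then have "3 dvd p" using prime_dvd_mult_iff[of 3 2 p] p(2) by simp
      then have "p = 3" using primes_dvd_imp_eq[of 3 p] p(1) by simp
      then show False using p(2) * by simp
    qed
    then show ?thesis using has_MLS_PSU3 min_factorisable_UG_twice_prime p by blast
  qed
qed

end
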